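(* Let $\phi(x_h)$ and $\psi(x_h)$ be in the Schwartz space $\mathcal{S}(\mathbb{R}^2)$ with $\mathrm{supp}\,\hat\phi,\ \mathrm{supp}\,\hat\psi\subset\mathcal{C}_h$, where $\mathcal{C}_h$ is a ring of $\mathbb{R}^2$. Denote $\phi_\varepsilon(x_h)=e^{ix_1/\varepsilon}\phi(x_h)$ and $\psi_\varepsilon(x_h)=e^{ix_1/\varepsilon}\psi(x_h)$. Then, for any positive $\varepsilon$, any $q\in(1,\infty]$, any $\sigma>0$ and any $\alpha\in(0,2(1-\frac1q))$, we have $$\|\phi_\varepsilon\|_{\tilde B^{-\sigma}_{q,1}}\le C_\phi\,\varepsilon^\sigma,$$ $$\|\phi_\varepsilon\|_{\dot B^{-\alpha}_{q,1}}\le C_\phi\,\varepsilon^\alpha,$$ $$\|\phi_\varepsilon\|_{\dot B^{-\sigma}_{q,\infty}}\ge C_\phi\,\varepsilon^\sigma,$$ $$\int_0^\infty\|\phi_{\varepsilon,F'}\,\psi_{\varepsilon,F'}\|_{L^2(\mathbb{R}^2)}\,dt\le C_{\phi,\psi,\nu_h}\,\varepsilon^2.$$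
   Context: Here $x_h=(x_1,x_2)\in\mathbb{R}^2$, $\Delta_h=\partial_{x_1}^2+\partial_{x_2}^2$, and $\nu_h>0$ is a constant (the horizontal viscosity). $C_\phi$ and $C_{\phi,\psi,\nu_h}$ denote positive constants not depending on $\varepsilon$, with the dependence indicated by the subscripts; $C_\phi$ may differ from line to line. $\hat a=\mathcal{F}a$ is the Fourier transform. Let $\varphi\in\mathcal{D}((\frac34,\frac83))$ satisfy $\sum_{j\in\mathbb{Z}}\varphi(2^{-j}\tau)=1$ for all $\tau>0$. For $k\in\mathbb{Z}$ put $\Delta^h_ka=\mathcal{F}^{-1}(\varphi(2^{-k}|\xi_h|)\hat a)$ and $S^h_ka=\sum_{k'\le k-1}\Delta^h_{k'}a$. Define $$\phi_{\varepsilon,F'}(t)=e^{\nu_ht\Delta_h}\sum_{k\ge0}\Delta^h_k\phi_\varepsilon,\qquad \psi_{\varepsilon,F'}(t)=e^{\nu_ht\Delta_h}\sum_{k\ge0}\Delta^h_k\psi_\varepsilon,$$ $$\|a\|_{\tilde B^{-\sigma}_{q,1}}=\|S^h_0a\|_{L^2}+\sum_{k=0}^\infty2^{-\sigma k}\|\Delta^h_ka\|_{L^q},\qquad \|a\|_{\dot B^{-\alpha}_{q,1}}=\sum_{k\in\mathbb{Z}}2^{-\alpha k}\|\Delta^h_ka\|_{L^q},$$ $$\|a\|_{\dot B^{-\sigma}_{q,\infty}}=\sup_{k\in\mathbb{Z}}2^{-\sigma k}\|\Delta^h_ka\|_{L^q},$$ all norms being over $\mathbb{R}^2$. A ring of $\mathbb{R}^2$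 is an annulus $\{r\le|\xi_h|\le R\}$ with $0<r<R$.
   Formalization: The third estimate is stated for φ not identically zero and, for each M>0, with a constant valid for 0<ε≤M (it fails for φ=0 and as ε→∞). Constants may depend on the cut-off, on σ in estimates 1 and 3, on q and α in estimate 2, and on M in estimate 3. *)

theory Defs
  imports "HOL-Probability.Probability"
begin

definition partial_deriv :: "2 \<Rightarrow> (real^2 \<Rightarrow> complex) \<Rightarrow> real^2 \<Rightarrow> complex" where
  "partial_deriv j f x = frechet_derivative f (at x) (axis j 1)"

text \<open>Asking every iterated partial derivative to be differentiable makes each of them
  continuous, so the first clause says that \<open>f\<close> is of class \<open>C\<^sup>\<infinity>\<close>.\<close>

definition schwartz :: "(real^2 \<Rightarrow> complex) \<Rightarrow> bool" where
  "schwartz f \<longleftrightarrow>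
     (\<forall>js x. fold partial_deriv js f differentiable (at x)) \<and>
     (\<forall>js n. \<exists>B. \<forall>x. norm x ^ n * cmod (fold partial_deriv js f x) \<le> B)"

definition support :: "('a::topological_space \<Rightarrow> 'b::zero) \<Rightarrow> 'a set" where
  "support f = closure {x. f x \<noteq> 0}"

definition annulus :: "real \<Rightarrow> real \<Rightarrow> (real^2) set" where
  "annulus r R = {\<xi>. r \<le> norm \<xi> \<and> norm \<xi> \<le> R}"

definition fourier :: "(real^2 \<Rightarrow> complex) \<Rightarrow> real^2 \<Rightarrow> complex" where
  "fourier a \<xi> = (LINT x|lborel. cis (- (x \<bullet> \<xi>)) * a x)"

definition inv_fourier :: "(real^2 \<Rightarrow> complex) \<Rightarrow> real^2 \<Rightarrow> complex" where
  "inv_fourier b x = (LINT \<xi>|lborel. cis (x \<bullet> \<xi>) * b \<xi>) / of_real ((2 * pi)^2)"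

definition fourier_multiplier ::
    "(real^2 \<Rightarrow> real) \<Rightarrow> (real^2 \<Rightarrow> complex) \<Rightarrow> real^2 \<Rightarrow> complex" where
  "fourier_multiplier m a = inv_fourier (\<lambda>\<xi>. of_real (m \<xi>) * fourier a \<xi>)"

text \<open>Elements of \<open>\<D>((3/4, 8/3))\<close> are regarded as functions on the whole line, extended by zero.\<close>

definition dyadic_partition :: "(real \<Rightarrow> real) \<Rightarrow> bool" where
  "dyadic_partition \<theta> \<longleftrightarrow>
     (\<forall>n x. (deriv ^^ n) \<theta> differentiable (at x)) \<and>
     support \<theta> \<subseteq> {3/4<..<8/3} \<and>
     (\<forall>\<tau>>0. ((\<lambda>j::int. \<theta> (2 powi (- j) * \<tau>)) has_sum 1) UNIV)"

definition dyadic_block ::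
    "(real \<Rightarrow> real) \<Rightarrow> int \<Rightarrow> (real^2 \<Rightarrow> complex) \<Rightarrow> real^2 \<Rightarrow> complex" where
  "dyadic_block \<theta> k = fourier_multiplier (\<lambda>\<xi>. \<theta> (2 powi (- k) * norm \<xi>))"

text \<open>The sums of dyadic blocks are taken pointwise; for a Schwartz function they converge
  absolutely at every point.\<close>

definition low_freq ::
    "(real \<Rightarrow> real) \<Rightarrow> int \<Rightarrow> (real^2 \<Rightarrow> complex) \<Rightarrow> real^2 \<Rightarrow> complex" where
  "low_freq \<theta> k a x = (\<Sum>\<^sub>\<infinity>k'\<in>{..k - 1}. dyadic_block \<theta> k' a x)"

definition heat :: "real \<Rightarrow> real \<Rightarrow> (real^2 \<Rightarrow> complex) \<Rightarrow> real^2 \<Rightarrow> complex" where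
  "heat \<nu> t = fourier_multiplier (\<lambda>\<xi>. exp (- \<nu> * t * (norm \<xi>)\<^sup>2))"

definition high_freq_flow ::
    "(real \<Rightarrow> real) \<Rightarrow> real \<Rightarrow> (real^2 \<Rightarrow> complex) \<Rightarrow> real \<Rightarrow> real^2 \<Rightarrow> complex" where
  "high_freq_flow \<theta> \<nu> a t = heat \<nu> t (\<lambda>x. \<Sum>\<^sub>\<infinity>k\<in>{0..}. dyadic_block \<theta> k a x)"

definition Lq_norm :: "ennreal \<Rightarrow> (real^2 \<Rightarrow> complex) \<Rightarrow> ennreal" where
  "Lq_norm q f =
     (if q = \<infinity> then esssup lborel (\<lambda>x. ennreal (cmod (f x)))
      else let I = (\<integral>\<^sup>+ x. ennreal (cmod (f x) powr enn2real q) \<partial>lborel)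
           in if I = \<infinity> then \<infinity> else ennreal (enn2real I powr (1 / enn2real q)))"

text \<open>The regularity index \<open>s\<close> is negative in the spaces of interest, \<open>s = -\<sigma>\<close> or \<open>s = -\<alpha>\<close>.
  All norms take values in \<open>[0, \<infinity>]\<close>.\<close>

definition tilde_besov_norm ::
    "(real \<Rightarrow> real) \<Rightarrow> real \<Rightarrow> ennreal \<Rightarrow> (real^2 \<Rightarrow> complex) \<Rightarrow> ennreal" where
  "tilde_besov_norm \<theta> s q a =
     Lq_norm 2 (low_freq \<theta> 0 a) +
     (\<Sum>\<^sub>\<infinity>k\<in>{0..}. ennreal (2 powr (s * of_int k)) * Lq_norm q (dyadic_block \<theta> k a))"

definition besov_1_norm ::
    "(real \<Rightarrow> real) \<Rightarrow> real \<Rightarrow> ennreal \<Rightarrow> (real^2 \<Rightarrow> complex) \<Rightarrow> ennreal" where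
  "besov_1_norm \<theta> s q a =
     (\<Sum>\<^sub>\<infinity>k. ennreal (2 powr (s * of_int k)) * Lq_norm q (dyadic_block \<theta> k a))"

definition besov_inf_norm ::
    "(real \<Rightarrow> real) \<Rightarrow> real \<Rightarrow> ennreal \<Rightarrow> (real^2 \<Rightarrow> complex) \<Rightarrow> ennreal" where
  "besov_inf_norm \<theta> s q a =
     (SUP k. ennreal (2 powr (s * of_int k)) * Lq_norm q (dyadic_block \<theta> k a))"

definition modulate :: "real \<Rightarrow> (real^2 \<Rightarrow> complex) \<Rightarrow> real^2 \<Rightarrow> complex" where
  "modulate \<epsilon> f x = cis (x $ 1 / \<epsilon>) * f x"

end

theory Submission
  imports Defs
begin

text \<open>
  Multiplication by \<open>cis (x $ 1 / \<epsilon>)\<close> translates the Fourier transform by \<open>e\<^sub>1 / \<epsilon>\<close>. The spectrum of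
  \<open>\<phi>\<^sub>\<epsilon>\<close> therefore lies in the ball of radius \<open>R\<close> around \<open>e\<^sub>1 / \<epsilon>\<close>, while all norms of \<open>\<phi>\<^sub>\<epsilon>\<close> that
  only see the modulus are independent of \<open>\<epsilon>\<close>. A dyadic block with index \<open>k\<close> sees frequencies of
  size about \<open>2^k\<close>, and comparing the two spectra (\<open>block_frequency\<close>) gives, for all \<open>\<epsilon> > 0\<close> at once:
  a nonzero block with \<open>k \<ge> 0\<close> has \<open>2^k \<ge> c / \<epsilon>\<close>; the blocks with \<open>k < 0\<close> vanish unless \<open>\<epsilon>\<close> exceeds
  a fixed positive number; and a nonzero block has \<open>2^k \<le> Y / \<epsilon>\<close> as long as \<open>\<epsilon> \<le> M\<close>.

  Both upper bounds follow by summing geometric series, once every block is bounded in \<open>L^q\<close>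
  uniformly in \<open>\<epsilon>\<close>, \<open>k\<close> and \<open>q\<close>, with an additional factor \<open>2^(2 k (1 - 1/q))\<close> for \<open>k < 0\<close>, which is
  where the condition \<open>\<alpha> < 2 (1 - 1/q)\<close> comes from. These block bounds interpolate between \<open>L\<^sup>1\<close> and
  \<open>L\<^sup>\<infinity>\<close> (\<open>Lq_norm_interpolation\<close>, \<open>dyadic_block_bounds\<close>): a block is the convolution with a
  kernel \<open>4^k g (2^k x)\<close>, and \<open>g\<close> is integrable because \<open>\<bar>x\<bar>^4 g(x)\<close> is, up to a constant, the transform of the
  twice iterated Laplacian of a smooth radial function supported in an annulus (\<open>dyadic_kernel_decay\<close>).
  The low frequency part of \<open>tilde_besov_norm\<close> is estimated by Plancherel's inequality.

  For the lower bound, \<open>\<bar>\<phi>\<bar> = \<bar>\<phi>\<^sub>\<epsilon>\<bar>\<close> is at most the sum of the moduli of the blocks. Integrating over a ball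
  on which \<open>\<bar>\<phi>\<bar>\<close> is bounded below, each block contributes at most a constant times its \<open>L^q\<close> norm,
  which is at most \<open>2^(\<sigma> k)\<close> times the Besov norm; the sum over \<open>2^k \<le> Y / \<epsilon>\<close> is of order \<open>\<epsilon>^(-\<sigma>)\<close>.

  For the product estimate, the part of \<open>\<phi>\<^sub>\<epsilon>\<close> with \<open>k \<ge> 0\<close> has frequencies \<open>\<bar>\<xi>\<bar> \<ge> c / \<epsilon>\<close> for every \<open>\<epsilon> > 0\<close>,
  so the heat flow multiplies its transform by at most \<open>exp (- \<nu> c\<^sup>2 t / \<epsilon>\<^sup>2)\<close>. Since the transform
  lives on a ball of fixed radius, this factor survives in \<open>L\<^sup>\<infinity>\<close> and in \<open>L\<^sup>2\<close>; integration in time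
  gives \<open>\<epsilon>\<^sup>2\<close>.

  Fourier inversion and the inequality half of Plancherel's theorem are both proved by inserting a
  Gaussian and letting it flatten.
\<close>

section \<open>Lebesgue integration on Euclidean space\<close>

lemma borel_measurable_cis [measurable]:
  assumes [measurable]: "f \<in> borel_measurable M"
  shows "(\<lambda>x. cis (f x)) \<in> borel_measurable M"
  unfolding cis_conv_exp by measurable

lemma borel_measurable_cnj [measurable]:
  assumes "f \<in> borel_measurable M"
  shows "(\<lambda>x. cnj (f x)) \<in> borel_measurable M"
  by (rule measurable_compose[OF assms borel_measurable_continuous_onI]) (intro continuous_intros)

lemma integral_norm_le_nn_integral:
  fixes f :: "'a \<Rightarrow> complex"
  shows "ennreal (norm (integral\<^sup>L M f)) \<le> (\<integral>\<^sup>+x. norm (f x) \<partial>M)"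
  by (cases "integrable M f") (auto intro: integral_norm_bound_ennreal simp: not_integrable_integral_eq)

lemma nn_integral_lborel_affine:
  fixes f :: "'a::euclidean_space \<Rightarrow> ennreal"
  assumes [measurable]: "f \<in> borel_measurable borel" and c: "c \<noteq> 0"
  shows "(\<integral>\<^sup>+x. f x \<partial>lborel) = ennreal (\<bar>c\<bar> ^ DIM('a)) * (\<integral>\<^sup>+x. f (t + c *\<^sub>R x) \<partial>lborel)"
  by (subst lborel_affine[OF c, of t])
     (simp add: nn_integral_density nn_integral_distr nn_integral_cmult)

lemma lborel_integral_affine:
  fixes f :: "'a::euclidean_space \<Rightarrow> complex"
  assumes [measurable]: "f \<in> borel_measurable borel" and c: "c \<noteq> 0"
  shows "(LINT x|lborel. f x) = of_real (\<bar>c\<bar> ^ DIM('a)) * (LINT x|lborel. f (t + c *\<^sub>R x))"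
  by (subst lborel_affine[OF c, of t])
     (simp add: integral_density integral_distr scaleR_conv_of_real)

lemma integrable_lborel_affine:
  fixes f :: "'a::euclidean_space \<Rightarrow> complex"
  assumes f: "integrable lborel f" and c: "c \<noteq> 0"
  shows "integrable lborel (\<lambda>x. f (t + c *\<^sub>R x))"
proof -
  have [measurable]: "f \<in> borel_measurable borel" using borel_measurable_integrable[OF f] by simp
  have "(\<integral>\<^sup>+x. norm (f x) \<partial>lborel) < \<infinity>" using f by (simp add: integrable_iff_bounded)
  then have "(\<integral>\<^sup>+x. norm (f (t + c *\<^sub>R x)) \<partial>lborel) < \<infinity>"
    using c by (subst (asm) nn_integral_lborel_affine[OF _ c, of _ t])
       (auto simp: ennreal_mult_less_top)
  then show ?thesis by (simp add: integrable_iff_bounded)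
qed

text \<open>
  The Lebesgue measure is a product measure along the basis, so products of functions of the single
  coordinates integrate factor by factor.
\<close>

lemma lborel_prod_integral:
  fixes f :: "'a::euclidean_space \<Rightarrow> real \<Rightarrow> complex"
  assumes f: "\<And>b. b \<in> Basis \<Longrightarrow> integrable lborel (f b)"
  shows "integrable lborel (\<lambda>x::'a. \<Prod>b\<in>Basis. f b (x \<bullet> b))" (is ?I)
    and "(LINT x|lborel. (\<Prod>b\<in>Basis. f b ((x::'a) \<bullet> b))) = (\<Prod>b\<in>Basis. LINT x|lborel. f b x)" (is ?E)
proof -
  interpret product_sigma_finite "\<lambda>_::'a. lborel :: real measure" ..
  have [measurable]: "\<And>b. b \<in> Basis \<Longrightarrow> f b \<in> borel_measurable borel"
    using f[THEN borel_measurable_integrable] by simp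
  have *: "(\<Prod>b\<in>Basis. f b ((\<Sum>b\<in>Basis. g b *\<^sub>R b) \<bullet> b)) = (\<Prod>b\<in>Basis. f b (g b))" for g :: "'a \<Rightarrow> real"
    by (intro prod.cong refl) simp
  show ?I
    by (subst lborel_eq, subst integrable_distr_eq) (auto simp: * intro!: product_integrable_prod f)
  show ?E
    by (subst lborel_eq, subst integral_distr) (auto simp: * intro!: product_integral_prod f)
qed

text \<open>
  In the plane \<open>1 + \<bar>x\<bar>^4\<close> dominates half of \<open>(1 + x\<^sub>1\<^sup>2) (1 + x\<^sub>2\<^sup>2)\<close>, whose reciprocal is a product of integrable
  functions.
\<close>

lemma integrable_decay4:
  "integrable lborel (\<lambda>x::real^2. 1 / (1 + norm x ^ 4))"
proof -
  have 1: "integrable lborel (\<lambda>x::real. complex_of_real (inverse (1 + x\<^sup>2)))"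
    using integrable_inverse_1_plus_square
    by (intro integrable_of_real) (simp add: set_integrable_def)
  have "integrable lborel (\<lambda>x::real^2. \<Prod>b\<in>Basis. complex_of_real (inverse (1 + (x \<bullet> b)\<^sup>2)))"
    by (intro lborel_prod_integral 1)
  then have "integrable lborel (\<lambda>x::real^2. 2 * (\<Prod>b\<in>Basis. complex_of_real (inverse (1 + (x \<bullet> b)\<^sup>2))))"
    by simp
  then show ?thesis
  proof (rule Bochner_Integration.integrable_bound)
    show "AE x::real^2 in lborel. norm (1 / (1 + norm x ^ 4)) \<le>
        norm (2 * (\<Prod>b\<in>Basis. complex_of_real (inverse (1 + (x \<bullet> b)\<^sup>2))))"
    proof (rule AE_I2)
      fix x :: "real^2"
      have B: "(Basis :: (real^2) set) = {axis 1 1, axis 2 1}"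
        by (auto simp: Basis_vec_def UNIV_2)
      have ne: "axis (1::2) (1::real) \<noteq> axis 2 1" by (simp add: axis_eq_axis)
      define a b where "a = (x $ 1)\<^sup>2" and "b = (x $ 2)\<^sup>2"
      have ab: "a \<ge> 0" "b \<ge> 0" by (auto simp: a_def b_def)
      have n: "norm x ^ 4 = (a + b)\<^sup>2"
      proof -
        have "norm x ^ 2 = a + b" by (simp add: norm_vec_def L2_set_def sum_2 a_def b_def)
        then show ?thesis by (metis power_mult mult_2 numeral_Bit0)
      qed
      have key: "(1 + a) * (1 + b) \<le> 2 + 2 * (a + b)\<^sup>2"
      proof -
        have "2 * (a + b) \<le> 1 + (a + b)\<^sup>2"
          using zero_le_power2[of "a + b - 1"] by (simp add: power2_eq_square algebra_simps)
        moreover have "a * b \<le> (a + b)\<^sup>2" using ab by (simp add: power2_eq_square algebra_simps)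
        moreover have "1 + x + y \<le> 2 + 2 * s" if "2 * x \<le> 1 + s" "y \<le> s" "0 \<le> s" for x y s :: real
          using that by linarith
        ultimately have "1 + (a + b) + a * b \<le> 2 + 2 * (a + b)\<^sup>2"
          using zero_le_power2[of "a + b"] by metis
        moreover have "(1 + a) * (1 + b) = 1 + (a + b) + a * b" by (simp add: distrib_left distrib_right)
        ultimately show ?thesis by (simp only:)
      qed
      have gen: "1 / (1 + s) \<le> 2 * (inverse u * inverse v)" if "u * v \<le> 2 + 2 * s" "u > 0" "v > 0" "s \<ge> 0" for u v s :: real
      proof -
        have "u * v / 2 \<le> 2 / 2 + 2 * s / 2" using that(1) divide_right_mono[of "u * v" "2 + 2 * s" 2] by (simp only: add_divide_distrib)
        then have "u * v / 2 \<le> 1 + s" by (simp only: nonzero_mult_div_cancel_left[of 2 s])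
        then have "inverse (1 + s) \<le> inverse (u * v / 2)"
          using that by (intro le_imp_inverse_le) auto
        also have "inverse (u * v / 2) = 2 * (inverse u * inverse v)" by (simp only: divide_inverse inverse_mult_distrib inverse_inverse_eq mult_ac)
        finally show ?thesis by (simp add: divide_inverse)
      qed
      have "1 / (1 + (a + b)\<^sup>2) \<le> 2 * (inverse (1 + a) * inverse (1 + b))"
        using ab by (intro gen key) auto
      moreover have "norm (1 / (1 + norm x ^ 4)) = 1 / (1 + (a + b)\<^sup>2)"
        unfolding n real_norm_def by (rule abs_of_nonneg) simp
      moreover have "(\<Prod>b\<in>Basis. complex_of_real (inverse (1 + (x \<bullet> b)\<^sup>2))) = of_real (inverse (1 + a) * inverse (1 + b))"
        unfolding B a_def b_def using ne by (simp add: inner_axis)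
      moreover have "norm (2 * complex_of_real (inverse (1 + a) * inverse (1 + b))) = 2 * (inverse (1 + a) * inverse (1 + b))"
        unfolding norm_mult norm_of_real using ab by (simp add: abs_mult)
      ultimately show "norm (1 / (1 + norm x ^ 4)) \<le>
        norm (2 * (\<Prod>b\<in>Basis. complex_of_real (inverse (1 + (x \<bullet> b)\<^sup>2))))"
        by (simp only:)
    qed
  qed simp
qed

section \<open>Gaussians\<close>

abbreviation gauss :: "'a::real_normed_vector \<Rightarrow> real" where
  "gauss x \<equiv> exp (- (norm x)\<^sup>2 / 2)"

lemma char_gaussian_real:
  fixes z :: real
  shows "integrable lborel (\<lambda>x. cis (z * x) * complex_of_real (exp (- x\<^sup>2 / 2)))"
    and "(LINT x|lborel. cis (z * x) * complex_of_real (exp (- x\<^sup>2 / 2))) = complex_of_real (sqrt (2 * pi) * exp (- z\<^sup>2 / 2))"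
proof -
  interpret S: real_distribution std_normal_distribution by (rule real_dist_normal_dist)
  have d: "std_normal_density x *\<^sub>R cis (z * x) = (1 / sqrt (2 * pi)) *\<^sub>R (cis (z * x) * complex_of_real (exp (- x\<^sup>2 / 2)))" for x
    by (simp add: std_normal_density_def scaleR_conv_of_real)
  have "integrable lborel std_normal_density" by simp
  then have "integrable lborel (\<lambda>x. std_normal_density x *\<^sub>R cis (z * x))"
    by (rule Bochner_Integration.integrable_bound) (auto simp: norm_mult)
  then have I: "integrable lborel (\<lambda>x. (1 / sqrt (2 * pi)) *\<^sub>R (cis (z * x) * complex_of_real (exp (- x\<^sup>2 / 2))))"
    unfolding d .
  have "(\<lambda>x. sqrt (2*pi) *\<^sub>R ((1 / sqrt (2 * pi)) *\<^sub>R (cis (z * x) * complex_of_real (exp (- x\<^sup>2 / 2))))) =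
    (\<lambda>x. cis (z * x) * complex_of_real (exp (- x\<^sup>2 / 2)))"
    by (simp add: scaleR_conv_of_real fun_eq_iff)
  then show J: "integrable lborel (\<lambda>x. cis (z * x) * complex_of_real (exp (- x\<^sup>2 / 2)))"
    using integrable_scaleR_right[OF I, of "sqrt (2*pi)"] by simp
  have "char std_normal_distribution z = (LINT x|lborel. std_normal_density x *\<^sub>R cis (z * x))"
    unfolding char_def by (subst integral_density) (auto simp: cis_conv_exp mult_ac)
  also have "\<dots> = (1 / sqrt (2 * pi)) *\<^sub>R (LINT x|lborel. cis (z * x) * complex_of_real (exp (- x\<^sup>2 / 2)))"
    unfolding d by simp
  finally have "complex_of_real (exp (- z\<^sup>2 / 2)) = (1 / sqrt (2 * pi)) *\<^sub>R (LINT x|lborel. cis (z * x) * complex_of_real (exp (- x\<^sup>2 / 2)))"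
    by (simp add: char_std_normal_distribution)
  then have "sqrt (2*pi) *\<^sub>R complex_of_real (exp (- z\<^sup>2 / 2)) = (LINT x|lborel. cis (z * x) * complex_of_real (exp (- x\<^sup>2 / 2)))"
    by simp
  then show "(LINT x|lborel. cis (z * x) * complex_of_real (exp (- x\<^sup>2 / 2))) = complex_of_real (sqrt (2 * pi) * exp (- z\<^sup>2 / 2))"
    by (simp add: scaleR_conv_of_real)
qed


lemma char_gaussian:
  fixes z :: "'a::euclidean_space"
  shows "integrable lborel (\<lambda>x::'a. cis (x \<bullet> z) * complex_of_real (gauss x))"
    and "(LINT x|lborel. cis ((x::'a) \<bullet> z) * complex_of_real (gauss x)) =
          complex_of_real (sqrt (2 * pi) ^ DIM('a) * gauss z)"
proof -
  let ?f = "\<lambda>b y. cis ((z \<bullet> b) * y) * complex_of_real (exp (- y\<^sup>2 / 2))"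
  have cis_sum: "cis (sum g A) = (\<Prod>b\<in>A. cis (g b))" for g :: "'a \<Rightarrow> real" and A
    by (induction A rule: infinite_finite_induct) (auto simp: cis_mult[symmetric])
  have n: "(norm x)\<^sup>2 = (\<Sum>b\<in>Basis. (x \<bullet> b)\<^sup>2)" for x :: 'a
    by (subst power2_norm_eq_inner, subst euclidean_inner) (simp add: power2_eq_square)
  have e: "gauss x = (\<Prod>b\<in>Basis. exp (- (x \<bullet> b)\<^sup>2 / 2))" for x :: 'a
    by (simp add: n exp_sum[symmetric] sum_negf sum_divide_distrib)
  have eq: "cis (x \<bullet> z) * complex_of_real (gauss x) = (\<Prod>b\<in>Basis. ?f b (x \<bullet> b))" for x :: 'a
    unfolding e prod.distrib of_real_prod cis_sum[symmetric] euclidean_inner[of x z] by (simp add: mult.commute)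
  show "integrable lborel (\<lambda>x::'a. cis (x \<bullet> z) * complex_of_real (gauss x))"
    unfolding eq by (intro lborel_prod_integral char_gaussian_real)
  show "(LINT x|lborel. cis ((x::'a) \<bullet> z) * complex_of_real (gauss x)) =
          complex_of_real (sqrt (2 * pi) ^ DIM('a) * gauss z)"
    unfolding eq
    by (subst lborel_prod_integral(2)[OF char_gaussian_real(1)])
       (simp only: char_gaussian_real(2) e prod.distrib prod_constant of_real_mult of_real_prod of_real_power)
qed

lemma char_gaussian_scaled:
  fixes z :: "real^2" and \<delta> :: real
  assumes "\<delta> > 0"
  shows "integrable lborel (\<lambda>x::real^2. cis (x \<bullet> z) * complex_of_real (gauss (\<delta> *\<^sub>R x)))" (is ?I)
    and "(LINT x|lborel. cis ((x::real^2) \<bullet> z) * complex_of_real (gauss (\<delta> *\<^sub>R x))) =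
          complex_of_real (2 * pi / \<delta>\<^sup>2 * gauss ((1 / \<delta>) *\<^sub>R z))" (is "?L = ?R")
proof -
  let ?g = "\<lambda>x::real^2. cis (x \<bullet> ((1 / \<delta>) *\<^sub>R z)) * complex_of_real (gauss x)"
  have g: "?g (0 + \<delta> *\<^sub>R x) = cis (x \<bullet> z) * complex_of_real (gauss (\<delta> *\<^sub>R x))" for x
    using assms by simp
  show ?I using integrable_lborel_affine[OF char_gaussian(1)[of "(1 / \<delta>) *\<^sub>R z"], of \<delta> 0] assms
    unfolding g by simp
  have "(LINT x|lborel. ?g x) = of_real (\<bar>\<delta>\<bar> ^ DIM(real^2)) * (LINT x|lborel. ?g (0 + \<delta> *\<^sub>R x))"
    using assms by (intro lborel_integral_affine) auto
  then have "complex_of_real (2 * pi * gauss ((1 / \<delta>) *\<^sub>R z)) = of_real (\<delta>\<^sup>2) * ?L"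
    unfolding g char_gaussian(2) using assms by simp
  then show "?L = ?R" using assms by (simp add: field_simps)
qed

section \<open>Fourier inversion and Plancherel's inequality\<close>

text \<open>
  Fubini in the only form used below: \<open>K\<close> is always a character \<open>cis (\<plusminus> x \<bullet> y)\<close>, so this is the
  multiplication formula for the Fourier transform.
\<close>

lemma integral_kernel_swap:
  fixes a b :: "'a::euclidean_space \<Rightarrow> complex" and K :: "'a \<Rightarrow> 'a \<Rightarrow> complex"
  assumes a: "integrable lborel a" and b: "integrable lborel b"
    and K[measurable]: "case_prod K \<in> borel_measurable (borel \<Otimes>\<^sub>M borel)"
    and K1: "\<And>x y. norm (K x y) \<le> 1"
  shows "(LINT x|lborel. a x * (LINT y|lborel. K x y * b y)) = (LINT y|lborel. b y * (LINT x|lborel. K x y * a x))"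
proof -
  have [measurable]: "a \<in> borel_measurable borel" "b \<in> borel_measurable borel"
    using assms by auto
  have "integrable (lborel \<Otimes>\<^sub>M lborel) (\<lambda>(x, y). K x y * (a x * b y))"
  proof (rule Bochner_Integration.integrable_bound)
    show "integrable (lborel \<Otimes>\<^sub>M lborel) (\<lambda>(x, y). a x * b y)"
      using a b by (intro lborel_pair.Fubini_integrable) (auto simp: norm_mult)
    show "AE x in lborel \<Otimes>\<^sub>M lborel. cmod (case x of (x, y) \<Rightarrow> K x y * (a x * b y)) \<le> cmod (case x of (x, y) \<Rightarrow> a x * b y)"
      using K1 by (auto simp: norm_mult mult_left_le_one_le)
  qed measurable
  then have "(LINT y|lborel. LINT x|lborel. K x y * (a x * b y)) = (LINT x|lborel. LINT y|lborel. K x y * (a x * b y))"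
    by (rule lborel_pair.Fubini_integral)
  moreover have "(LINT y|lborel. K x y * (a x * b y)) = a x * (LINT y|lborel. K x y * b y)" for x
    by (subst integral_mult_right_zero[symmetric]) (simp add: mult_ac)
  moreover have "(LINT x|lborel. K x y * (a x * b y)) = b y * (LINT x|lborel. K x y * a x)" for y
    by (subst integral_mult_right_zero[symmetric]) (simp add: mult_ac)
  ultimately show ?thesis by simp
qed


text \<open>
  Insert the factor \<open>exp (- \<bar>\<delta> \<xi>\<bar>\<^sup>2 / 2)\<close> into the inversion integral. As \<open>\<delta> \<rightarrow> 0\<close> the integral tends to
  the one without the factor; on the other hand Fubini turns it into the average of \<open>a\<close> against a
  Gaussian of width \<open>\<delta>\<close> centred at \<open>x\<close>, which tends to \<open>a x\<close>.
\<close>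

lemma fourier_inversion:
  fixes a :: "real^2 \<Rightarrow> complex"
  assumes a: "integrable lborel a" and cont: "\<And>x. isCont a x" and B: "\<And>x. norm (a x) \<le> B"
    and fa: "integrable lborel (fourier a)"
  shows "inv_fourier (fourier a) = a"
proof
  fix x :: "real^2"
  define \<delta> where "\<delta> n = 1 / real (Suc n)" for n
  have \<delta>: "\<delta> n > 0" for n by (simp add: \<delta>_def)
  have \<delta>0: "\<delta> \<longlonglongrightarrow> 0" unfolding \<delta>_def by (rule LIMSEQ_Suc[OF lim_1_over_n])
  have [measurable]: "a \<in> borel_measurable borel" "fourier a \<in> borel_measurable borel"
    using a fa by auto
  define G where "G n \<xi> = complex_of_real (gauss (\<delta> n *\<^sub>R \<xi>))" for n and \<xi> :: "real^2"
  have [measurable]: "G n \<in> borel_measurable borel" for n unfolding G_def by measurable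
  define L where "L n = (LINT \<xi>|lborel. (cis (x \<bullet> \<xi>) * G n \<xi>) * fourier a \<xi>)" for n
  have L1: "L \<longlonglongrightarrow> (LINT \<xi>|lborel. cis (x \<bullet> \<xi>) * fourier a \<xi>)"
    unfolding L_def
  proof (rule integral_dominated_convergence[where w = "\<lambda>\<xi>. norm (fourier a \<xi>)"])
    show "integrable lborel (\<lambda>\<xi>. norm (fourier a \<xi>))" using fa by simp
    have "(\<lambda>n. cis (x \<bullet> \<xi>) * G n \<xi> * fourier a \<xi>) \<longlonglongrightarrow> cis (x \<bullet> \<xi>) * of_real (gauss (0 *\<^sub>R \<xi>)) * fourier a \<xi>" for \<xi>
      unfolding G_def by (intro tendsto_intros \<delta>0) auto
    then show "AE \<xi> in lborel. (\<lambda>n. cis (x \<bullet> \<xi>) * G n \<xi> * fourier a \<xi>) \<longlonglongrightarrow> cis (x \<bullet> \<xi>) * fourier a \<xi>"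
      by simp
    show "AE \<xi> in lborel. cmod (cis (x \<bullet> \<xi>) * G n \<xi> * fourier a \<xi>) \<le> cmod (fourier a \<xi>)" for n
      by (auto simp: norm_mult G_def mult_left_le_one_le)
  qed measurable
  have Leq: "L n = 2 * pi * (LINT z|lborel. a (x + \<delta> n *\<^sub>R z) * of_real (gauss z))" for n
  proof -
    have I: "integrable lborel (\<lambda>\<xi>. cis (x \<bullet> \<xi>) * G n \<xi>)"
      using char_gaussian_scaled(1)[OF \<delta>[of n], of x] by (simp add: G_def inner_commute)
    have "L n = (LINT y|lborel. a y * (LINT \<xi>|lborel. cis (- (y \<bullet> \<xi>)) * (cis (x \<bullet> \<xi>) * G n \<xi>)))"
      unfolding L_def fourier_def by (rule integral_kernel_swap[OF I a]) auto
    also have "(\<lambda>y. LINT \<xi>|lborel. cis (- (y \<bullet> \<xi>)) * (cis (x \<bullet> \<xi>) * G n \<xi>)) = 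
       (\<lambda>y. complex_of_real (2 * pi / (\<delta> n)\<^sup>2 * gauss ((1 / \<delta> n) *\<^sub>R (x - y))))"
    proof
      fix y
      have eq: "cis (- (y \<bullet> \<xi>)) * (cis (x \<bullet> \<xi>) * G n \<xi>) = cis (\<xi> \<bullet> (x - y)) * G n \<xi>" for \<xi>
        by (simp add: mult.assoc[symmetric] cis_mult inner_diff_right inner_commute)
      show "(LINT \<xi>|lborel. cis (- (y \<bullet> \<xi>)) * (cis (x \<bullet> \<xi>) * G n \<xi>)) = complex_of_real (2 * pi / (\<delta> n)\<^sup>2 * gauss ((1 / \<delta> n) *\<^sub>R (x - y)))"
        unfolding eq using char_gaussian_scaled(2)[OF \<delta>[of n], of "x - y"] by (simp add: G_def)
    qed
    also have "(LINT y|lborel. a y * complex_of_real (2 * pi / (\<delta> n)\<^sup>2 * gauss ((1 / \<delta> n) *\<^sub>R (x - y))))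
      = of_real (\<bar>\<delta> n\<bar> ^ DIM(real^2)) * (LINT z|lborel. a (x + \<delta> n *\<^sub>R z) * complex_of_real (2 * pi / (\<delta> n)\<^sup>2 * gauss ((1 / \<delta> n) *\<^sub>R (x - (x + \<delta> n *\<^sub>R z)))))"
      using \<delta>[of n] by (intro lborel_integral_affine) auto
    also have "(\<lambda>z. a (x + \<delta> n *\<^sub>R z) * complex_of_real (2 * pi / (\<delta> n)\<^sup>2 * gauss ((1 / \<delta> n) *\<^sub>R (x - (x + \<delta> n *\<^sub>R z)))))
       = (\<lambda>z. complex_of_real (2 * pi / (\<delta> n)\<^sup>2) * (a (x + \<delta> n *\<^sub>R z) * of_real (gauss z)))"
      using \<delta>[of n] by (simp add: fun_eq_iff)
    also have "of_real (\<bar>\<delta> n\<bar> ^ DIM(real^2)) * (LINT z|lborel. complex_of_real (2 * pi / (\<delta> n)\<^sup>2) * (a (x + \<delta> n *\<^sub>R z) * of_real (gauss z)))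
      = 2 * pi * (LINT z|lborel. a (x + \<delta> n *\<^sub>R z) * of_real (gauss z))"
      using \<delta>[of n] by (subst integral_mult_right_zero) (simp add: field_simps power2_eq_square)
    finally show ?thesis .
  qed
  have "(\<lambda>n. 2 * pi * (LINT z|lborel. a (x + \<delta> n *\<^sub>R z) * complex_of_real (gauss z)))
     \<longlonglongrightarrow> 2 * pi * (LINT z|lborel. a x * complex_of_real (gauss (z::real^2)))"
  proof (intro tendsto_mult_left integral_dominated_convergence[where w = "\<lambda>z. B * gauss z"])
    show "integrable lborel (\<lambda>z::real^2. B * gauss z)"
      using integrable_norm[OF char_gaussian(1)[of "0::real^2"]] by simp
    have "(\<lambda>n. a (x + \<delta> n *\<^sub>R z)) \<longlonglongrightarrow> a (x + 0 *\<^sub>R z)" for z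
      using cont[of "x + 0 *\<^sub>R z"] by (rule isCont_tendsto_compose) (intro tendsto_intros \<delta>0)
    then have "(\<lambda>n. a (x + \<delta> n *\<^sub>R z)) \<longlonglongrightarrow> a x" for z by simp
    then show "AE z in lborel. (\<lambda>n. a (x + \<delta> n *\<^sub>R z) * complex_of_real (gauss z)) \<longlonglongrightarrow> a x * complex_of_real (gauss z)"
      by (auto intro!: tendsto_intros)
    show "AE z in lborel. cmod (a (x + \<delta> n *\<^sub>R z) * complex_of_real (gauss z)) \<le> B * gauss z" for n
      using B by (auto simp: norm_mult intro!: mult_right_mono)
  qed measurable
  then have "L \<longlonglongrightarrow> 2 * pi * (LINT z|lborel. a x * complex_of_real (gauss (z::real^2)))"
    unfolding Leq[symmetric] .
  then have "L \<longlonglongrightarrow> 2 * pi * (a x * (2 * pi))"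
    using char_gaussian(2)[of "0::real^2"] by (subst (asm) integral_mult_right_zero) simp
  with L1 have "(LINT \<xi>|lborel. cis (x \<bullet> \<xi>) * fourier a \<xi>) = 2 * pi * (a x * (2 * pi))"
    by (rule LIMSEQ_unique)
  then show "inv_fourier (fourier a) x = a x"
    by (simp add: inv_fourier_def power2_eq_square)
qed

text \<open>
  The two transforms differ by a reflection and a constant, so this is \<open>fourier_inversion\<close> for \<open>b\<close>.
\<close>

lemma fourier_inv_fourier:
  assumes b: "integrable lborel b" and cont: "\<And>x. isCont b x" and B: "\<And>x. norm (b x) \<le> B"
    and fb: "integrable lborel (inv_fourier b)"
  shows "fourier (inv_fourier b) = b"
proof -
  have r: "inv_fourier b x = fourier b (- x) / of_real ((2 * pi)\<^sup>2)" for x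
    by (simp add: inv_fourier_def fourier_def inner_commute)
  then have r': "fourier b x = of_real ((2 * pi)\<^sup>2) * inv_fourier b (0 + (-1) *\<^sub>R x)" for x
    by simp
  have fi: "integrable lborel (fourier b)"
    unfolding r' by (intro integrable_mult_right integrable_lborel_affine fb) simp
  have [measurable]: "b \<in> borel_measurable borel" "inv_fourier b \<in> borel_measurable borel"
    using b fb by auto
  have "fourier (inv_fourier b) \<xi> = b \<xi>" for \<xi>
  proof -
    have "fourier (inv_fourier b) \<xi> = of_real (\<bar>-1\<bar> ^ DIM(real^2)) * (LINT x|lborel. cis (- ((0 + (-1) *\<^sub>R x) \<bullet> \<xi>)) * inv_fourier b (0 + (-1) *\<^sub>R x))"
      unfolding fourier_def by (rule lborel_integral_affine) auto
    also have "\<dots> = (LINT x|lborel. (cis (\<xi> \<bullet> x) * fourier b x) / of_real ((2 * pi)\<^sup>2))"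
      by (simp add: r' inner_commute)
    also have "\<dots> = inv_fourier (fourier b) \<xi>"
      unfolding inv_fourier_def by (rule integral_divide_zero)
    finally show ?thesis using fourier_inversion[OF b cont B fi] by simp
  qed
  then show ?thesis ..
qed

text \<open>
  Let \<open>M\<close> be the unnormalised inverse transform of \<open>m\<close>. Integrated against a Gaussian, \<open>\<bar>M\<bar>\<^sup>2\<close> becomes the
  quadratic form of \<open>m\<close> with the kernel \<open>W (\<xi> - \<eta>)\<close>, where \<open>W\<close> is the transform of that Gaussian. As \<open>W\<close> is
  nonnegative with total mass \<open>(2 \<pi>)\<^sup>2\<close>, the inequality \<open>2 \<bar>m \<xi> m \<eta>\<bar> \<le> \<bar>m \<xi>\<bar>\<^sup>2 + \<bar>m \<eta>\<bar>\<^sup>2\<close> bounds the form by the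
  square of the \<open>L\<^sup>2\<close> norm. Fatou's lemma removes the Gaussian.
\<close>

lemma inv_fourier_L2_le:
  fixes m :: "real^2 \<Rightarrow> complex"
  assumes m: "integrable lborel m"
  shows "(\<integral>\<^sup>+x. ennreal ((cmod (inv_fourier m x))\<^sup>2) \<partial>lborel) \<le> (\<integral>\<^sup>+\<xi>. ennreal ((cmod (m \<xi>))\<^sup>2) \<partial>lborel)"
proof -
  define \<delta> where "\<delta> n = 1 / real (Suc n)" for n
  have \<delta>: "\<delta> n > 0" for n by (simp add: \<delta>_def)
  have \<delta>0: "\<delta> \<longlonglongrightarrow> 0" unfolding \<delta>_def by (rule LIMSEQ_Suc[OF lim_1_over_n])
  have [measurable]: "m \<in> borel_measurable borel" using m by auto
  define g where "g n x = gauss (\<delta> n *\<^sub>R x)" for n and x :: "real^2"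
  define W where "W n z = 2 * pi / (\<delta> n)\<^sup>2 * gauss ((1 / \<delta> n) *\<^sub>R z)" for n and z :: "real^2"
  have [measurable]: "g n \<in> borel_measurable borel" "W n \<in> borel_measurable borel" for n
    unfolding g_def W_def by measurable
  have W0: "W n z \<ge> 0" for n z by (simp add: W_def)
  have gI: "integrable lborel (\<lambda>x. cis (x \<bullet> z) * complex_of_real (g n x))"
    and gW: "(LINT x|lborel. cis (x \<bullet> z) * complex_of_real (g n x)) = W n z" for n z
    using char_gaussian_scaled[OF \<delta>, of z n] by (simp_all only: g_def W_def)
  have g01: "0 \<le> g n x" "g n x \<le> 1" for n x by (auto simp: g_def)
  have W1: "(\<integral>\<^sup>+z. ennreal (W n z) \<partial>lborel) = ennreal ((2 * pi)\<^sup>2)" for n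
  proof -
    let ?h = "\<lambda>z::real^2. gauss ((1 / \<delta> n) *\<^sub>R z)"
    have "integrable lborel (\<lambda>z::real^2. cis (z \<bullet> 0) * complex_of_real (?h z))"
      using char_gaussian_scaled(1)[of "1 / \<delta> n" 0] \<delta>[of n] by simp
    then have I: "integrable lborel ?h" 
      using integrable_norm by fastforce
    have "(LINT z|lborel. cis ((z::real^2) \<bullet> 0) * complex_of_real (?h z)) = complex_of_real (2 * pi * (\<delta> n)\<^sup>2)"
      using char_gaussian_scaled(2)[of "1 / \<delta> n" 0] \<delta>[of n] by (simp add: power_divide)
    then have "complex_of_real (LINT z|lborel. ?h z) = complex_of_real (2 * pi * (\<delta> n)\<^sup>2)"
      by (subst integral_complex_of_real[symmetric]) simp
    then have h: "(LINT z|lborel. ?h z) = 2 * pi * (\<delta> n)\<^sup>2"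
      using of_real_eq_iff by blast
    have "(\<integral>\<^sup>+z. ennreal (W n z) \<partial>lborel) = ennreal (LINT z|lborel. W n z)"
      using I W0 by (intro nn_integral_eq_integral) (auto simp: W_def)
    also have "(LINT z|lborel. W n z) = 2 * pi / (\<delta> n)\<^sup>2 * (2 * pi * (\<delta> n)\<^sup>2)"
      unfolding W_def h[symmetric] by (rule integral_mult_right_zero)
    also have "\<dots> = (2 * pi)\<^sup>2" using \<delta>[of n] by (simp add: power2_eq_square)
    finally show ?thesis .
  qed
  define J where "J = (\<integral>\<^sup>+\<xi>. ennreal ((cmod (m \<xi>))\<^sup>2) \<partial>lborel)"
  define M where "M x = (LINT \<xi>|lborel. cis (x \<bullet> \<xi>) * m \<xi>)" for x
  have [measurable]: "M \<in> borel_measurable borel" unfolding M_def by measurable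
  have Mb: "cmod (M x) \<le> (LINT \<xi>|lborel. cmod (m \<xi>))" for x
    unfolding M_def by (rule order_trans[OF integral_norm_bound]) (simp add: norm_mult)
  have key: "(\<integral>\<^sup>+x. ennreal ((cmod (M x))\<^sup>2 * g n x) \<partial>lborel) \<le> ennreal ((2*pi)\<^sup>2) * J" for n
  proof -
    let ?b = "\<lambda>x. cnj (M x) * complex_of_real (g n x)"
    have gi: "integrable lborel (\<lambda>x. complex_of_real (g n x))" using gI[of 0 n] by simp
    then have bI: "integrable lborel (\<lambda>x. of_real (LINT \<xi>|lborel. cmod (m \<xi>)) * complex_of_real (g n x))"
      by (rule integrable_mult_right)
    have bI: "integrable lborel ?b"
      by (rule Bochner_Integration.integrable_bound[OF bI])
        (use Mb g01 in \<open>auto simp: norm_mult intro!: mult_right_mono order_trans[OF Mb]\<close>)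
    have inner: "(LINT x|lborel. cis (x \<bullet> \<xi>) * ?b x) = (LINT \<eta>|lborel. cnj (m \<eta>) * complex_of_real (W n (\<xi> - \<eta>)))" for \<xi>
    proof -
      \<comment> \<open>Expanding the second factor \<open>cnj (M x)\<close> as an integral produces the transform of the Gaussian.\<close>
      have cM: "cnj (M x) = (LINT \<eta>|lborel. cis (- (x \<bullet> \<eta>)) * cnj (m \<eta>))" for x
        unfolding M_def Bochner_Integration.integral_cnj[symmetric] by (simp add: cis_cnj del: Bochner_Integration.integral_cnj)
      have "(LINT x|lborel. cis (x \<bullet> \<xi>) * ?b x) = 
         (LINT x|lborel. (cis (x \<bullet> \<xi>) * complex_of_real (g n x)) * (LINT \<eta>|lborel. cis (- (x \<bullet> \<eta>)) * cnj (m \<eta>)))"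
        by (simp add: cM mult_ac)
      also have "\<dots> = (LINT \<eta>|lborel. cnj (m \<eta>) * (LINT x|lborel. cis (- (x \<bullet> \<eta>)) * (cis (x \<bullet> \<xi>) * complex_of_real (g n x))))"
        by (rule integral_kernel_swap[OF gI]) (use m in auto)
      also have "(\<lambda>\<eta>. LINT x|lborel. cis (- (x \<bullet> \<eta>)) * (cis (x \<bullet> \<xi>) * complex_of_real (g n x))) = (\<lambda>\<eta>. complex_of_real (W n (\<xi> - \<eta>)))"
      proof
        fix \<eta>
        have "cis (- (x \<bullet> \<eta>)) * (cis (x \<bullet> \<xi>) * complex_of_real (g n x)) = cis (x \<bullet> (\<xi> - \<eta>)) * complex_of_real (g n x)" for x
          by (simp add: mult.assoc[symmetric] cis_mult inner_diff_right)
        then show "(LINT x|lborel. cis (- (x \<bullet> \<eta>)) * (cis (x \<bullet> \<xi>) * complex_of_real (g n x))) = complex_of_real (W n (\<xi> - \<eta>))"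
          by (simp only: gW)
      qed
      finally show ?thesis .
    qed
    have sq: "?b x * M x = complex_of_real ((cmod (M x))\<^sup>2 * g n x)" for x
      by (simp add: complex_norm_square mult_ac del: of_real_power)
    have gi': "integrable lborel (g n)" using integrable_Re[OF gi] by simp
    have MI: "integrable lborel (\<lambda>x. (cmod (M x))\<^sup>2 * g n x)"
    proof (rule Bochner_Integration.integrable_bound)
      show "integrable lborel (\<lambda>x. (LINT \<xi>|lborel. cmod (m \<xi>))\<^sup>2 * g n x)"
        using gi' by (rule integrable_mult_right)
      show "AE x in lborel. norm ((cmod (M x))\<^sup>2 * g n x) \<le> norm ((LINT \<xi>|lborel. cmod (m \<xi>))\<^sup>2 * g n x)"
        using Mb g01 by (auto simp: abs_mult intro!: mult_right_mono power_mono)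
    qed measurable
    have "complex_of_real (LINT x|lborel. (cmod (M x))\<^sup>2 * g n x) = (LINT x|lborel. ?b x * M x)"
      unfolding sq by (rule integral_complex_of_real[symmetric])
    also have "\<dots> = (LINT \<xi>|lborel. m \<xi> * (LINT x|lborel. cis (x \<bullet> \<xi>) * ?b x))"
      unfolding M_def[of "_::real^2"] by (rule integral_kernel_swap[OF bI[unfolded M_def] m]) auto
    also have "\<dots> = (LINT \<xi>|lborel. m \<xi> * (LINT \<eta>|lborel. cnj (m \<eta>) * complex_of_real (W n (\<xi> - \<eta>))))"
      unfolding inner ..
    finally have eq: "complex_of_real (LINT x|lborel. (cmod (M x))\<^sup>2 * g n x) = \<dots>" .
    have "(\<integral>\<^sup>+x. ennreal ((cmod (M x))\<^sup>2 * g n x) \<partial>lborel) = ennreal (LINT x|lborel. (cmod (M x))\<^sup>2 * g n x)"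
      using MI g01 by (intro nn_integral_eq_integral) auto
    also have "\<dots> \<le> ennreal (norm (complex_of_real (LINT x|lborel. (cmod (M x))\<^sup>2 * g n x)))"
      by (intro ennreal_leI) simp
    also have "\<dots> \<le> (\<integral>\<^sup>+\<xi>. norm (m \<xi> * (LINT \<eta>|lborel. cnj (m \<eta>) * complex_of_real (W n (\<xi> - \<eta>)))) \<partial>lborel)"
      unfolding eq by (rule integral_norm_le_nn_integral)
    also have "\<dots> \<le> (\<integral>\<^sup>+\<xi>. \<integral>\<^sup>+\<eta>. ennreal ((cmod (m \<xi>))\<^sup>2 / 2 * W n (\<xi> - \<eta>)) + ennreal ((cmod (m \<eta>))\<^sup>2 / 2 * W n (\<xi> - \<eta>)) \<partial>lborel \<partial>lborel)"
    proof (rule nn_integral_mono)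
      fix \<xi>
      have "ennreal (norm (m \<xi> * (LINT \<eta>|lborel. cnj (m \<eta>) * complex_of_real (W n (\<xi> - \<eta>))))) 
        = ennreal (norm (LINT \<eta>|lborel. m \<xi> * (cnj (m \<eta>) * complex_of_real (W n (\<xi> - \<eta>)))))"
        by simp
      also have "\<dots> \<le> (\<integral>\<^sup>+\<eta>. norm (m \<xi> * (cnj (m \<eta>) * complex_of_real (W n (\<xi> - \<eta>)))) \<partial>lborel)"
        by (rule integral_norm_le_nn_integral)
      also have "\<dots> \<le> (\<integral>\<^sup>+\<eta>. ennreal ((cmod (m \<xi>))\<^sup>2 / 2 * W n (\<xi> - \<eta>)) + ennreal ((cmod (m \<eta>))\<^sup>2 / 2 * W n (\<xi> - \<eta>)) \<partial>lborel)"
      proof (rule nn_integral_mono)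
        fix \<eta>
        have "cmod (m \<xi>) * cmod (m \<eta>) \<le> (cmod (m \<xi>))\<^sup>2 / 2 + (cmod (m \<eta>))\<^sup>2 / 2"
          using sum_squares_bound[of "cmod (m \<xi>)" "cmod (m \<eta>)"] by simp
        then have "cmod (m \<xi>) * cmod (m \<eta>) * W n (\<xi> - \<eta>) \<le> ((cmod (m \<xi>))\<^sup>2 / 2 + (cmod (m \<eta>))\<^sup>2 / 2) * W n (\<xi> - \<eta>)"
          using W0 by (rule mult_right_mono)
        then have "ennreal (norm (m \<xi> * (cnj (m \<eta>) * complex_of_real (W n (\<xi> - \<eta>))))) \<le>
             ennreal ((cmod (m \<xi>))\<^sup>2 / 2 * W n (\<xi> - \<eta>) + (cmod (m \<eta>))\<^sup>2 / 2 * W n (\<xi> - \<eta>))"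
          using W0 by (intro ennreal_leI) (simp add: norm_mult algebra_simps)
        then show "ennreal (norm (m \<xi> * (cnj (m \<eta>) * complex_of_real (W n (\<xi> - \<eta>))))) \<le>
             ennreal ((cmod (m \<xi>))\<^sup>2 / 2 * W n (\<xi> - \<eta>)) + ennreal ((cmod (m \<eta>))\<^sup>2 / 2 * W n (\<xi> - \<eta>))"
          using W0 by (subst (asm) ennreal_plus) auto
      qed
      finally show "ennreal (norm (m \<xi> * (LINT \<eta>|lborel. cnj (m \<eta>) * complex_of_real (W n (\<xi> - \<eta>))))) \<le> \<dots>" .
    qed
    also have "\<dots> = (\<integral>\<^sup>+\<xi>. \<integral>\<^sup>+\<eta>. ennreal ((cmod (m \<xi>))\<^sup>2 / 2 * W n (\<xi> - \<eta>)) \<partial>lborel \<partial>lborel) +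
       (\<integral>\<^sup>+\<xi>. \<integral>\<^sup>+\<eta>. ennreal ((cmod (m \<eta>))\<^sup>2 / 2 * W n (\<xi> - \<eta>)) \<partial>lborel \<partial>lborel)"
      by (subst nn_integral_add[symmetric]) (auto simp: nn_integral_add)
    also have "(\<integral>\<^sup>+\<xi>. \<integral>\<^sup>+\<eta>. ennreal ((cmod (m \<eta>))\<^sup>2 / 2 * W n (\<xi> - \<eta>)) \<partial>lborel \<partial>lborel)
       = (\<integral>\<^sup>+\<eta>. \<integral>\<^sup>+\<xi>. ennreal ((cmod (m \<eta>))\<^sup>2 / 2 * W n (\<xi> - \<eta>)) \<partial>lborel \<partial>lborel)"
      by (rule lborel_pair.Fubini'[symmetric]) measurable
    also have "(\<integral>\<^sup>+\<xi>. \<integral>\<^sup>+\<eta>. ennreal ((cmod (m \<xi>))\<^sup>2 / 2 * W n (\<xi> - \<eta>)) \<partial>lborel \<partial>lborel) = 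
        (\<integral>\<^sup>+\<xi>. ennreal ((cmod (m \<xi>))\<^sup>2 / 2) * ennreal ((2 * pi)\<^sup>2) \<partial>lborel)"
    proof (intro nn_integral_cong)
      fix \<xi>
      have "(\<integral>\<^sup>+z. ennreal (W n z) \<partial>lborel) = ennreal (\<bar>-1\<bar> ^ DIM(real^2)) * (\<integral>\<^sup>+\<eta>. ennreal (W n (\<xi> + (-1) *\<^sub>R \<eta>)) \<partial>lborel)"
        by (rule nn_integral_lborel_affine) auto
      then have *: "(\<integral>\<^sup>+\<eta>. ennreal (W n (\<xi> - \<eta>)) \<partial>lborel) = ennreal ((2 * pi)\<^sup>2)" by (simp add: W1)
      show "(\<integral>\<^sup>+\<eta>. ennreal ((cmod (m \<xi>))\<^sup>2 / 2 * W n (\<xi> - \<eta>)) \<partial>lborel) = ennreal ((cmod (m \<xi>))\<^sup>2 / 2) * ennreal ((2 * pi)\<^sup>2)"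
        unfolding *[symmetric] by (subst nn_integral_cmult[symmetric]) (measurable, simp only: ennreal_mult''[OF W0])
    qed
    also have "(\<integral>\<^sup>+\<eta>. \<integral>\<^sup>+\<xi>. ennreal ((cmod (m \<eta>))\<^sup>2 / 2 * W n (\<xi> - \<eta>)) \<partial>lborel \<partial>lborel) = 
        (\<integral>\<^sup>+\<eta>. ennreal ((cmod (m \<eta>))\<^sup>2 / 2) * ennreal ((2 * pi)\<^sup>2) \<partial>lborel)"
    proof (intro nn_integral_cong)
      fix \<eta>
      have "(\<integral>\<^sup>+z. ennreal (W n z) \<partial>lborel) = ennreal (\<bar>1\<bar> ^ DIM(real^2)) * (\<integral>\<^sup>+\<xi>. ennreal (W n (- \<eta> + 1 *\<^sub>R \<xi>)) \<partial>lborel)"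
        by (rule nn_integral_lborel_affine) auto
      then have *: "(\<integral>\<^sup>+\<xi>. ennreal (W n (\<xi> - \<eta>)) \<partial>lborel) = ennreal ((2 * pi)\<^sup>2)" by (simp add: W1)
      show "(\<integral>\<^sup>+\<xi>. ennreal ((cmod (m \<eta>))\<^sup>2 / 2 * W n (\<xi> - \<eta>)) \<partial>lborel) = ennreal ((cmod (m \<eta>))\<^sup>2 / 2) * ennreal ((2 * pi)\<^sup>2)"
        unfolding *[symmetric] by (subst nn_integral_cmult[symmetric]) (measurable, simp only: ennreal_mult''[OF W0])
    qed
    also have "(\<integral>\<^sup>+\<xi>. ennreal ((cmod (m \<xi>))\<^sup>2 / 2) * ennreal ((2 * pi)\<^sup>2) \<partial>lborel) + (\<integral>\<^sup>+\<xi>. ennreal ((cmod (m \<xi>))\<^sup>2 / 2) * ennreal ((2 * pi)\<^sup>2) \<partial>lborel)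
        = ((\<integral>\<^sup>+\<xi>. ennreal ((cmod (m \<xi>))\<^sup>2 / 2) \<partial>lborel) + (\<integral>\<^sup>+\<xi>. ennreal ((cmod (m \<xi>))\<^sup>2 / 2) \<partial>lborel)) * ennreal ((2 * pi)\<^sup>2)"
      unfolding distrib_right by (subst (1 2) nn_integral_multc; measurable)
    also have "(\<integral>\<^sup>+\<xi>. ennreal ((cmod (m \<xi>))\<^sup>2 / 2) \<partial>lborel) + (\<integral>\<^sup>+\<xi>. ennreal ((cmod (m \<xi>))\<^sup>2 / 2) \<partial>lborel) = J"
      unfolding J_def by (subst nn_integral_add[symmetric]) (auto simp flip: ennreal_plus)
    also have "J * ennreal ((2 * pi)\<^sup>2) = ennreal ((2 * pi)\<^sup>2) * J" by (rule mult.commute)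
    finally show ?thesis .
  qed
  have lim: "(\<lambda>n. ennreal ((cmod (M x))\<^sup>2 * g n x)) \<longlonglongrightarrow> ennreal ((cmod (M x))\<^sup>2)" for x
  proof -
    have "(\<lambda>n. (cmod (M x))\<^sup>2 * g n x) \<longlonglongrightarrow> (cmod (M x))\<^sup>2 * gauss (0 *\<^sub>R x)"
      unfolding g_def by (intro tendsto_intros \<delta>0) auto
    then show ?thesis by (intro tendsto_ennrealI) simp
  qed
  have "(\<integral>\<^sup>+x. ennreal ((cmod (M x))\<^sup>2) \<partial>lborel) = (\<integral>\<^sup>+x. liminf (\<lambda>n. ennreal ((cmod (M x))\<^sup>2 * g n x)) \<partial>lborel)"
    by (intro nn_integral_cong lim_imp_Liminf[symmetric] lim) simp
  also have "\<dots> \<le> liminf (\<lambda>n. \<integral>\<^sup>+x. ennreal ((cmod (M x))\<^sup>2 * g n x) \<partial>lborel)"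
    by (rule nn_integral_liminf) measurable
  also have "\<dots> \<le> liminf (\<lambda>n::nat. ennreal ((2*pi)\<^sup>2) * J)"
    by (intro Liminf_mono always_eventually allI key)
  also have "\<dots> = ennreal ((2*pi)\<^sup>2) * J" by (simp add: Liminf_const)
  finally have fin: "(\<integral>\<^sup>+x. ennreal ((cmod (M x))\<^sup>2) \<partial>lborel) \<le> ennreal ((2*pi)\<^sup>2) * J" .
  have p1: "(2 * pi)\<^sup>2 \<ge> 1"
    using pi_gt3 by (intro one_le_power) auto
  have inv: "ennreal ((cmod (inv_fourier m x))\<^sup>2) = ennreal (1 / ((2*pi)\<^sup>2)\<^sup>2) * ennreal ((cmod (M x))\<^sup>2)" for x
    by (subst ennreal_mult'[symmetric]) (auto simp: inv_fourier_def M_def[symmetric] norm_divide power_divide norm_mult norm_power power_mult_distrib)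
  have "(\<integral>\<^sup>+x. ennreal ((cmod (inv_fourier m x))\<^sup>2) \<partial>lborel) = ennreal (1 / ((2*pi)\<^sup>2)\<^sup>2) * (\<integral>\<^sup>+x. ennreal ((cmod (M x))\<^sup>2) \<partial>lborel)"
    unfolding inv by (rule nn_integral_cmult) measurable
  also have "\<dots> \<le> ennreal (1 / ((2*pi)\<^sup>2)\<^sup>2) * (ennreal ((2*pi)\<^sup>2) * J)"
    by (intro mult_left_mono fin) auto
  also have "\<dots> = ennreal (1 / ((2*pi)\<^sup>2)\<^sup>2 * (2*pi)\<^sup>2) * J"
    by (simp add: mult.assoc[symmetric] ennreal_mult'[symmetric])
  also have "\<dots> \<le> 1 * J"
  proof (rule mult_right_mono)
    have "1 / c\<^sup>2 * c \<le> 1" if "c \<ge> 1" for c :: real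
      using that by (simp add: power2_eq_square)
    then show "ennreal (1 / ((2*pi)\<^sup>2)\<^sup>2 * (2*pi)\<^sup>2) \<le> 1"
      using p1 unfolding ennreal_le_1 by blast
  qed simp
  finally show ?thesis by (simp add: J_def)
qed

section \<open>Decay of the dyadic kernel\<close>

text \<open>
  Integration by parts without iterated integrals: by translation invariance the difference quotients
  have integral zero, and they converge dominatedly because \<open>F\<close> is Lipschitz with bounded support.
\<close>

lemma integral_directional_deriv_zero:
  fixes F D :: "'a::euclidean_space \<Rightarrow> complex" and e :: 'a
  assumes deriv: "\<And>x. ((\<lambda>h. F (x + h *\<^sub>R e)) has_vector_derivative D x) (at 0)"
    and D: "\<And>x. norm (D x) \<le> B" and F0: "\<And>x. norm x > \<rho> \<Longrightarrow> F x = 0" and ne: "norm e = 1"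
    and F: "integrable lborel F"
    and [measurable]: "D \<in> borel_measurable borel"
  shows "(LINT x|lborel. D x) = 0"
proof -
  define \<delta> where "\<delta> n = 1 / real (Suc n)" for n
  have \<delta>: "\<delta> n > 0" "\<delta> n \<le> 1" for n by (auto simp: \<delta>_def)
  have \<delta>0: "\<delta> \<longlonglongrightarrow> 0" unfolding \<delta>_def by (rule LIMSEQ_Suc[OF lim_1_over_n])
  have [measurable]: "F \<in> borel_measurable borel" using F by auto
  let ?Q = "\<lambda>n x. (F (x + \<delta> n *\<^sub>R e) - F x) /\<^sub>R \<delta> n"
  have deriv': "((\<lambda>h. F (x + h *\<^sub>R e)) has_vector_derivative D (x + t *\<^sub>R e)) (at t)" for x t
  proof -
    have "((\<lambda>h. F ((x + t *\<^sub>R e) + (h - t) *\<^sub>R e)) has_vector_derivative D (x + t *\<^sub>R e)) (at t)"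
    proof (rule vector_diff_chain_at[of "\<lambda>h. h - t" 1 t "\<lambda>h. F ((x + t *\<^sub>R e) + h *\<^sub>R e)" "D (x + t *\<^sub>R e)", unfolded o_def scaleR_one])
      show "((\<lambda>h. h - t) has_vector_derivative 1) (at t)" by (auto intro!: derivative_eq_intros)
    qed (use deriv[of "x + t *\<^sub>R e"] in simp)
    then show ?thesis by (simp add: algebra_simps)
  qed
  have bound: "norm (?Q n x) \<le> B * indicator (cball 0 (\<rho> + 1)) x" for n x
  proof (cases "norm x \<le> \<rho> + 1")
    case True
    have "\<exists>t\<in>{0<..<\<delta> n}. norm (F (x + \<delta> n *\<^sub>R e) - F (x + 0 *\<^sub>R e)) \<le> norm ((\<delta> n - 0) *\<^sub>R D (x + t *\<^sub>R e))"
    proof (rule mvt_general[OF \<delta>(1)])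
      show "continuous_on {0..\<delta> n} (\<lambda>h. F (x + h *\<^sub>R e))"
        by (intro continuous_at_imp_continuous_on ballI has_vector_derivative_continuous[OF deriv'])
      show "\<And>t. 0 < t \<Longrightarrow> t < \<delta> n \<Longrightarrow> ((\<lambda>h. F (x + h *\<^sub>R e)) has_derivative (\<lambda>y. y *\<^sub>R D (x + t *\<^sub>R e))) (at t)"
        using deriv' by (simp add: has_vector_derivative_def)
    qed
    then obtain t where "norm (F (x + \<delta> n *\<^sub>R e) - F x) \<le> \<delta> n * norm (D (x + t *\<^sub>R e))"
      using \<delta>[of n] by auto
    also have "\<dots> \<le> \<delta> n * B" using \<delta>[of n] D by (intro mult_left_mono) auto
    finally have "norm (?Q n x) \<le> B" using \<delta>(1)[of n] by (simp only: norm_scaleR) (simp add: field_simps)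
    then show ?thesis using True by simp
  next
    case False
    have "norm x - norm (\<delta> n *\<^sub>R e) \<le> norm (x + \<delta> n *\<^sub>R e)" 
      by (rule norm_diff_ineq)
    then have "norm (x + \<delta> n *\<^sub>R e) > \<rho>" using False \<delta>[of n] ne by simp
    then have "F (x + \<delta> n *\<^sub>R e) = 0" "F x = 0" using False by (auto intro!: F0)
    then show ?thesis using False by simp
  qed
  have "(\<lambda>n. LINT x|lborel. ?Q n x) \<longlonglongrightarrow> (LINT x|lborel. D x)"
  proof (rule integral_dominated_convergence[where w = "\<lambda>x. B * indicator (cball 0 (\<rho> + 1)) x"])
    show "integrable lborel (\<lambda>x::'a. B * indicator (cball 0 (\<rho> + 1)) x)"
      by (intro integrable_mult_right integrable_real_indicator) (use emeasure_lborel_cball_finite[of "0::'a"] in auto)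
    show "AE x in lborel. (\<lambda>n. ?Q n x) \<longlonglongrightarrow> D x"
    proof (rule AE_I2)
      fix x
      have "((\<lambda>h. norm (F (x + (0 + h) *\<^sub>R e) - F (x + 0 *\<^sub>R e) - h *\<^sub>R D x) / norm h) \<longlongrightarrow> 0) (at 0)"
        using deriv[of x] unfolding has_vector_derivative_def has_derivative_at by blast
      moreover have "\<forall>\<^sub>F h in at 0. norm (F (x + (0 + h) *\<^sub>R e) - F (x + 0 *\<^sub>R e) - h *\<^sub>R D x) / norm h
          = norm ((F (x + h *\<^sub>R e) - F x) /\<^sub>R h - D x)"
      proof (rule eventually_at_filter[THEN iffD2], intro always_eventually allI impI)
        fix h :: real assume "h \<noteq> 0"
        then have "(F (x + h *\<^sub>R e) - F x) /\<^sub>R h - D x = (F (x + h *\<^sub>R e) - F x - h *\<^sub>R D x) /\<^sub>R h"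
          by (simp add: scaleR_diff_right)
        then show "norm (F (x + (0 + h) *\<^sub>R e) - F (x + 0 *\<^sub>R e) - h *\<^sub>R D x) / norm h
          = norm ((F (x + h *\<^sub>R e) - F x) /\<^sub>R h - D x)"
          by (simp add: divide_inverse mult.commute)
      qed
      ultimately have "((\<lambda>h. norm ((F (x + h *\<^sub>R e) - F x) /\<^sub>R h - D x)) \<longlongrightarrow> 0) (at 0)"
        by (rule Lim_transform_eventually)
      then have "((\<lambda>h. (F (x + h *\<^sub>R e) - F x) /\<^sub>R h) \<longlongrightarrow> D x) (at 0)"
        by (simp add: tendsto_norm_zero_iff LIM_zero_iff)
      moreover have "filterlim \<delta> (at 0) sequentially"
        using \<delta>0 \<delta>(1) by (auto simp: filterlim_at less_imp_neq[symmetric])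
      ultimately show "(\<lambda>n. ?Q n x) \<longlonglongrightarrow> D x" by (rule filterlim_compose)
    qed
  qed (use bound in auto)
  moreover have "(LINT x|lborel. ?Q n x) = 0" for n
  proof -
    have 1: "(LINT x|lborel. F x) = of_real (\<bar>1\<bar> ^ DIM('a)) * (LINT x|lborel. F (\<delta> n *\<^sub>R e + 1 *\<^sub>R x))"
      by (rule lborel_integral_affine) auto
    have 2: "integrable lborel (\<lambda>x. F (\<delta> n *\<^sub>R e + 1 *\<^sub>R x))"
      by (rule integrable_lborel_affine[OF F]) simp
    have "(LINT x|lborel. ?Q n x) = (LINT x|lborel. F (x + \<delta> n *\<^sub>R e) - F x) /\<^sub>R \<delta> n" by simp
    also have "(LINT x|lborel. F (x + \<delta> n *\<^sub>R e) - F x) = 0"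
      using 1 2 F by (subst Bochner_Integration.integral_diff) (simp_all add: add.commute)
    finally show ?thesis by simp
  qed
  ultimately have "(\<lambda>n::nat. 0) \<longlonglongrightarrow> (LINT x|lborel. D x)" by (simp only:)
  then show ?thesis using LIMSEQ_unique tendsto_const by blast
qed

lemma integrable_bounded_cball:
  fixes f :: "'a::euclidean_space \<Rightarrow> complex"
  assumes [measurable]: "f \<in> borel_measurable borel" and B: "\<And>x. norm (f x) \<le> B"
    and supp: "\<And>x. f x \<noteq> 0 \<Longrightarrow> norm (x - c) \<le> \<rho>"
  shows "integrable lborel f"
proof (rule Bochner_Integration.integrable_bound)
  show "integrable lborel (\<lambda>x::'a. B * indicator (cball c \<rho>) x)"
    by (intro integrable_mult_right integrable_real_indicator) (use emeasure_lborel_cball_finite[of c] in auto)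
  show "AE x in lborel. norm (f x) \<le> norm (B * indicator (cball c \<rho>) x)"
  proof (rule AE_I2)
    fix x show "norm (f x) \<le> norm (B * indicator (cball c \<rho>) x)"
    proof (cases "f x = 0")
      case False
      then have "x \<in> cball c \<rho>" using supp[of x] by (simp add: dist_norm norm_minus_commute)
      then show ?thesis using B[of x] by simp
    qed simp
  qed
qed simp

lemma bounded_of_continuous_interval_support:
  fixes w :: "real \<Rightarrow> real"
  assumes "\<And>r. isCont w r" and "\<And>r. r \<notin> {a<..<b} \<Longrightarrow> w r = 0"
  obtains B where "B > 0" "\<And>r. \<bar>w r\<bar> \<le> B"
proof -
  have "compact (w ` {a..b})"
    using assms(1) by (intro compact_continuous_image continuous_at_imp_continuous_on) auto
  then obtain B where B: "B > 0" "\<And>y. y \<in> w ` {a..b} \<Longrightarrow> norm y \<le> B"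
    using compact_imp_bounded bounded_pos by metis
  have "\<bar>w r\<bar> \<le> B" for r
    using B assms(2)[of r] by (cases "r \<in> {a<..<b}") auto
  with B(1) show ?thesis by (rule that)
qed

text \<open>
  The field differentiated here is \<open>cis (x \<bullet> \<xi>) (\<partial>\<^sub>e m - \<i> (x \<bullet> e) m)\<close> with \<open>m \<xi> = w \<bar>\<xi>\<bar>\<close>. In its derivative along \<open>e\<close>
  the first order terms cancel and \<open>cis (x \<bullet> \<xi>) (\<partial>\<^sub>e\<^sup>2 m + (x \<bullet> e)\<^sup>2 m)\<close> remains, so that two
  integrations by parts are done at once.
\<close>

lemma radial_wave_directional_deriv:
  fixes w w1 w2 :: "real \<Rightarrow> real" and x \<xi> e :: "'a::euclidean_space"
  assumes d1: "\<And>r. (w has_real_derivative w1 r) (at r)" and d2: "\<And>r. (w1 has_real_derivative w2 r) (at r)"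
    and e: "norm e = 1" and \<xi>: "\<xi> \<noteq> 0"
  shows "((\<lambda>h. cis (x \<bullet> (\<xi> + h *\<^sub>R e)) * (of_real (w1 (norm (\<xi> + h *\<^sub>R e)) * ((\<xi> + h *\<^sub>R e) \<bullet> e) / norm (\<xi> + h *\<^sub>R e))
            - \<i> * of_real ((x \<bullet> e) * w (norm (\<xi> + h *\<^sub>R e)))))
     has_vector_derivative
       cis (x \<bullet> \<xi>) * of_real (w2 (norm \<xi>) * ((\<xi> \<bullet> e) / norm \<xi>)\<^sup>2 + w1 (norm \<xi>) / norm \<xi>
          - w1 (norm \<xi>) / norm \<xi> * ((\<xi> \<bullet> e) / norm \<xi>)\<^sup>2 + (x \<bullet> e)\<^sup>2 * w (norm \<xi>))) (at 0)"
proof -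
  define n p \<beta> where "n = norm \<xi>" and "p = \<xi> \<bullet> e" and "\<beta> = x \<bullet> e"
  define \<rho> where "\<rho> h = norm (\<xi> + h *\<^sub>R e)" for h :: real
  have n: "n > 0" using \<xi> by (simp add: n_def)
  have ee: "e \<bullet> e = 1" using e by (simp add: norm_eq_sqrt_inner)
  have "(\<rho> has_derivative (\<lambda>h. (h *\<^sub>R e) \<bullet> (sgn (\<xi> + 0 *\<^sub>R e)))) (at 0)"
    unfolding \<rho>_def by (rule has_derivative_compose[OF _ has_derivative_norm, of "\<lambda>h. \<xi> + h *\<^sub>R e"]) 
      (auto intro!: derivative_eq_intros simp: \<xi>)
  then have \<rho>: "(\<rho> has_real_derivative p / n) (at 0)"
    unfolding has_field_derivative_def
    by (rule has_derivative_eq_rhs) (simp add: fun_eq_iff sgn_div_norm p_def n_def inner_commute divide_inverse mult_ac)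
  have \<rho>0: "\<rho> 0 = n" by (simp add: \<rho>_def n_def)
  have W: "((\<lambda>h. w (\<rho> h)) has_real_derivative w1 n * (p / n)) (at 0)"
    using DERIV_chain2[OF d1 \<rho>] by (simp add: \<rho>0)
  have W1: "((\<lambda>h. w1 (\<rho> h)) has_real_derivative w2 n * (p / n)) (at 0)"
    using DERIV_chain2[OF d2 \<rho>] by (simp add: \<rho>0)
  have "((\<lambda>h. w1 (\<rho> h) * (p + h) / \<rho> h) has_real_derivative
     ((w2 n * (p / n) * (p + 0) + w1 (\<rho> 0) * 1) * \<rho> 0 - w1 (\<rho> 0) * (p + 0) * (p / n)) / (\<rho> 0 * \<rho> 0)) (at 0)"
    by (rule derivative_eq_intros W1 \<rho> refl | use n in \<open>simp add: \<rho>0\<close>)+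
  then have U: "((\<lambda>h. w1 (\<rho> h) * (p + h) / \<rho> h) has_real_derivative
      (w2 n * (p / n)\<^sup>2 + w1 n / n - w1 n / n * (p / n)\<^sup>2)) (at 0)"
    by (rule DERIV_cong) (use n in \<open>simp add: \<rho>0 field_simps power2_eq_square\<close>)
  have C: "((\<lambda>h. cis (x \<bullet> \<xi> + h * \<beta>)) has_vector_derivative \<i> * of_real \<beta> * cis (x \<bullet> \<xi>)) (at 0)"
  proof -
    have "((\<lambda>h. \<i> * complex_of_real (x \<bullet> \<xi> + h * \<beta>)) has_vector_derivative \<i> * of_real \<beta>) (at 0)"
      by (intro has_vector_derivative_mult_right has_vector_derivative_of_real)
         (auto intro!: derivative_eq_intros simp flip: has_real_derivative_iff_has_vector_derivative)
    from field_vector_diff_chain_at[OF this DERIV_exp] show ?thesis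
      by (simp add: o_def cis_conv_exp)
  qed
  have "((\<lambda>h. cis (x \<bullet> \<xi> + h * \<beta>) * (complex_of_real (w1 (\<rho> h) * (p + h) / \<rho> h) - \<i> * complex_of_real (\<beta> * w (\<rho> h))))
    has_vector_derivative
    (cis (x \<bullet> \<xi> + 0 * \<beta>) * (complex_of_real (w2 n * (p / n)\<^sup>2 + w1 n / n - w1 n / n * (p / n)\<^sup>2) - \<i> * complex_of_real (\<beta> * (w1 n * (p / n))))
      + \<i> * of_real \<beta> * cis (x \<bullet> \<xi>) * (complex_of_real (w1 (\<rho> 0) * (p + 0) / \<rho> 0) - \<i> * complex_of_real (\<beta> * w (\<rho> 0))))) (at 0)"
    by (intro has_vector_derivative_mult C has_vector_derivative_diff has_vector_derivative_mult_right
         has_vector_derivative_of_real U DERIV_cmult[OF W] has_real_derivative_iff_has_vector_derivative[THEN iffD1])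
  moreover have "(cis (x \<bullet> \<xi> + 0 * \<beta>) * (complex_of_real (w2 n * (p / n)\<^sup>2 + w1 n / n - w1 n / n * (p / n)\<^sup>2) - \<i> * complex_of_real (\<beta> * (w1 n * (p / n))))
      + \<i> * of_real \<beta> * cis (x \<bullet> \<xi>) * (complex_of_real (w1 (\<rho> 0) * (p + 0) / \<rho> 0) - \<i> * complex_of_real (\<beta> * w (\<rho> 0))))
     = cis (x \<bullet> \<xi>) * complex_of_real (w2 n * (p / n)\<^sup>2 + w1 n / n - w1 n / n * (p / n)\<^sup>2 + \<beta>\<^sup>2 * w n)"
    unfolding \<rho>0 by (simp add: algebra_simps power2_eq_square)
  moreover have "x \<bullet> (\<xi> + h *\<^sub>R e) = x \<bullet> \<xi> + h * \<beta>" "(\<xi> + h *\<^sub>R e) \<bullet> e = p + h" for h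
    by (auto simp: inner_add_right inner_add_left \<beta>_def p_def ee)
  ultimately show ?thesis
    unfolding \<beta>_def[symmetric] n_def[symmetric] p_def[symmetric] \<rho>_def[symmetric] by (simp only:)
qed


text \<open>
  In the plane the Laplacian of \<open>w \<bar>\<xi>\<bar>\<close> is \<open>w'' + w' / r\<close>. The sum of the fields of the previous lemma over
  a basis shows that it corresponds to \<open>- \<bar>x\<bar>\<^sup>2\<close> on the other side. The result is radial again, which
  makes the lemma applicable twice; the support stays away from the origin, where \<open>\<bar>\<xi>\<bar>\<close> is not smooth.
\<close>

lemma radial_laplacian_fourier:
  fixes w w1 w2 :: "real \<Rightarrow> real" and x :: "real^2"
  assumes d1: "\<And>r. (w has_real_derivative w1 r) (at r)" and d2: "\<And>r. (w1 has_real_derivative w2 r) (at r)"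
    and c2: "\<And>r. isCont w2 r" and a: "a > 0"
    and z: "\<And>r. r \<notin> {a<..<b} \<Longrightarrow> w r = 0" "\<And>r. r \<notin> {a<..<b} \<Longrightarrow> w1 r = 0" "\<And>r. r \<notin> {a<..<b} \<Longrightarrow> w2 r = 0"
  shows "(norm x)\<^sup>2 * (LINT \<xi>|lborel. cis (x \<bullet> \<xi>) * of_real (w (norm \<xi>))) =
     - (LINT \<xi>|lborel. cis (x \<bullet> \<xi>) * of_real (w2 (norm \<xi>) + w1 (norm \<xi>) / norm \<xi>))"
proof -
  have cw: "isCont w r" "isCont w1 r" for r using d1 d2 DERIV_isCont by blast+
  obtain B0 where B0: "B0 > 0" "\<And>r. \<bar>w r\<bar> \<le> B0"
    using bounded_of_continuous_interval_support[OF cw(1) z(1)] by metis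
  obtain B1 where B1: "B1 > 0" "\<And>r. \<bar>w1 r\<bar> \<le> B1"
    using bounded_of_continuous_interval_support[OF cw(2) z(2)] by metis
  obtain B2 where B2: "B2 > 0" "\<And>r. \<bar>w2 r\<bar> \<le> B2"
    using bounded_of_continuous_interval_support[OF c2 z(3)] by metis
  have [measurable]: "w \<in> borel_measurable borel" "w1 \<in> borel_measurable borel" "w2 \<in> borel_measurable borel"
    using cw c2 by (auto intro!: borel_measurable_continuous_onI continuous_at_imp_continuous_on)
  define F where "F e \<xi> = cis (x \<bullet> \<xi>) * (of_real (w1 (norm \<xi>) * (\<xi> \<bullet> e) / norm \<xi>) - \<i> * of_real ((x \<bullet> e) * w (norm \<xi>)))" for e \<xi> :: "real^2"
  define D where "D e \<xi> = cis (x \<bullet> \<xi>) * complex_of_real (w2 (norm \<xi>) * ((\<xi> \<bullet> e) / norm \<xi>)\<^sup>2 + w1 (norm \<xi>) / norm \<xi>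
          - w1 (norm \<xi>) / norm \<xi> * ((\<xi> \<bullet> e) / norm \<xi>)\<^sup>2 + (x \<bullet> e)\<^sup>2 * w (norm \<xi>))" for e \<xi> :: "real^2"
  have [measurable]: "F e \<in> borel_measurable borel" "D e \<in> borel_measurable borel" for e
    unfolding F_def D_def by measurable
  have ratio: "\<bar>(\<xi> \<bullet> e) / norm \<xi>\<bar> \<le> 1" if "norm e = 1" for e \<xi> :: "real^2"
    using Cauchy_Schwarz_ineq2[of \<xi> e] that by (cases "\<xi> = 0") (auto simp: divide_le_eq)
  have wr: "\<bar>w1 r / r\<bar> \<le> B1 / a" for r
  proof (cases "r \<in> {a<..<b}")
    case True
    then have "\<bar>w1 r\<bar> / \<bar>r\<bar> \<le> B1 / a" using a B1 by (intro frac_le) auto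
    then show ?thesis by simp
  qed (use z a B1 in auto)
  have F0: "F e \<xi> = 0" "D e \<xi> = 0" if "norm \<xi> \<notin> {a<..<b}" for e \<xi>
    using z[OF that] by (auto simp: F_def D_def)
  have D0: "(LINT \<xi>|lborel. D e \<xi>) = 0" and DI: "integrable lborel (D e)" if e: "norm e = 1" for e
  proof -
    have DB: "norm (D e \<xi>) \<le> B2 + B1 / a + B1 / a + (x \<bullet> e)\<^sup>2 * B0" for \<xi>
    proof -
      have q: "((\<xi> \<bullet> e) / norm \<xi>)\<^sup>2 \<le> 1" using ratio[OF e, of \<xi>] by (simp only: abs_square_le_1)
      have "\<bar>w2 (norm \<xi>) * ((\<xi> \<bullet> e) / norm \<xi>)\<^sup>2\<bar> \<le> B2 * 1"
        unfolding abs_mult using q B2 by (intro mult_mono) auto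
      moreover have "\<bar>w1 (norm \<xi>) / norm \<xi> * ((\<xi> \<bullet> e) / norm \<xi>)\<^sup>2\<bar> \<le> B1 / a * 1"
        unfolding abs_mult using q wr B1 a by (intro mult_mono wr) auto
      moreover have "\<bar>(x \<bullet> e)\<^sup>2 * w (norm \<xi>)\<bar> \<le> (x \<bullet> e)\<^sup>2 * B0"
        unfolding abs_mult using B0 by (intro mult_mono) auto
      moreover have "\<bar>w1 (norm \<xi>) / norm \<xi>\<bar> \<le> B1 / a" by (rule wr)
      moreover have "\<bar>u + v - y + t\<bar> \<le> U + V + Y + T" if "\<bar>u\<bar> \<le> U" "\<bar>y\<bar> \<le> Y" "\<bar>t\<bar> \<le> T" "\<bar>v\<bar> \<le> V" for u v y t U V Y T :: real
        using that by linarith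
      ultimately show ?thesis
        unfolding D_def norm_mult norm_cis norm_of_real mult_1_left mult_1_right by blast
    qed
    have FB: "norm (F e \<xi>) \<le> B1 + \<bar>x \<bullet> e\<bar> * B0" for \<xi>
    proof -
      have "\<bar>w1 (norm \<xi>) * ((\<xi> \<bullet> e) / norm \<xi>)\<bar> \<le> B1 * 1"
        unfolding abs_mult using ratio[OF e, of \<xi>] B1 by (intro mult_mono) auto
      moreover have "\<bar>(x \<bullet> e) * w (norm \<xi>)\<bar> \<le> \<bar>x \<bullet> e\<bar> * B0"
        unfolding abs_mult using B0 by (intro mult_mono) auto
      moreover have "norm (F e \<xi>) \<le> \<bar>w1 (norm \<xi>) * ((\<xi> \<bullet> e) / norm \<xi>)\<bar> + \<bar>(x \<bullet> e) * w (norm \<xi>)\<bar>"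
        unfolding F_def norm_mult norm_cis mult_1
        by (rule order_trans[OF norm_triangle_ineq4]) (simp only: norm_mult norm_ii norm_of_real mult_1 times_divide_eq_right order_refl)
      ultimately show ?thesis unfolding mult_1_right by linarith
    qed
    have supp: "norm (\<xi> - 0) \<le> b" if "F e \<xi> \<noteq> 0 \<or> D e \<xi> \<noteq> 0" for \<xi>
      using that F0[of \<xi> e] by (cases "norm \<xi> \<in> {a<..<b}") auto
    have FI: "integrable lborel (F e)"
      by (rule integrable_bounded_cball[of _ _ 0 b]) (use FB supp in auto)
    show "integrable lborel (D e)"
      by (rule integrable_bounded_cball[of _ _ 0 b]) (use DB supp in auto)
    have deriv: "((\<lambda>h. F e (\<xi> + h *\<^sub>R e)) has_vector_derivative D e \<xi>) (at 0)" for \<xi>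
    proof (cases "\<xi> = 0")
      case False
      then show ?thesis unfolding F_def D_def by (intro radial_wave_directional_deriv d1 d2 e)
    next
      case True
      have "((\<lambda>h. 0) has_vector_derivative 0) (at (0::real))" by (rule has_vector_derivative_const)
      then have "((\<lambda>h. F e (\<xi> + h *\<^sub>R e)) has_vector_derivative 0) (at 0)"
      proof (rule has_vector_derivative_transform_within_open)
        show "open {-a<..<a}" "0 \<in> {-a<..<a}" using a by auto
        fix h assume "h \<in> {-a<..<a}"
        then have "norm (\<xi> + h *\<^sub>R e) \<notin> {a<..<b}" using True e by auto
        then show "0 = F e (\<xi> + h *\<^sub>R e)" using F0 by simp
      qed
      moreover have "D e \<xi> = 0" using True a by (intro F0) auto
      ultimately show ?thesis by simp
    qed
    show "(LINT \<xi>|lborel. D e \<xi>) = 0"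
      by (rule integral_directional_deriv_zero[OF deriv DB _ e FI, of b]) (use F0 in auto)
  qed
  have "(\<Sum>e\<in>Basis. LINT \<xi>|lborel. D e \<xi>) = 0" by (intro sum.neutral ballI D0) auto
  then have "(LINT \<xi>|lborel. (\<Sum>e\<in>Basis. D e \<xi>)) = 0"
    by (subst Bochner_Integration.integral_sum) (auto intro!: DI)
  moreover have "(\<Sum>e\<in>Basis. D e \<xi>) = cis (x \<bullet> \<xi>) * of_real (w2 (norm \<xi>) + w1 (norm \<xi>) / norm \<xi>) + (norm x)\<^sup>2 * (cis (x \<bullet> \<xi>) * of_real (w (norm \<xi>)))" for \<xi>
  proof (cases "\<xi> = 0")
    case True
    then show ?thesis using a z[of 0] by (simp add: D_def)
  next
    case False
    have nn: "(norm y)\<^sup>2 = (\<Sum>e\<in>Basis. (y \<bullet> e)\<^sup>2)" for y :: "real^2"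
      by (subst power2_norm_eq_inner, subst euclidean_inner) (simp add: power2_eq_square)
    have q: "(\<Sum>e\<in>Basis. ((\<xi> \<bullet> e) / norm \<xi>)\<^sup>2) = 1"
      using False by (simp add: power_divide sum_divide_distrib[symmetric] nn[symmetric])
    have "(\<Sum>e\<in>Basis. D e \<xi>) = cis (x \<bullet> \<xi>) * of_real (w2 (norm \<xi>) * (\<Sum>e\<in>Basis. ((\<xi> \<bullet> e) / norm \<xi>)\<^sup>2) + 2 * (w1 (norm \<xi>) / norm \<xi>)
          - w1 (norm \<xi>) / norm \<xi> * (\<Sum>e\<in>Basis. ((\<xi> \<bullet> e) / norm \<xi>)\<^sup>2) + (\<Sum>e\<in>Basis. (x \<bullet> e)\<^sup>2) * w (norm \<xi>))"
      unfolding D_def sum_distrib_left[symmetric] of_real_sum[symmetric] sum.distrib sum_subtractf sum_distrib_right[symmetric]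
      by simp
    also have "\<dots> = cis (x \<bullet> \<xi>) * of_real (w2 (norm \<xi>) + w1 (norm \<xi>) / norm \<xi>) + (norm x)\<^sup>2 * (cis (x \<bullet> \<xi>) * of_real (w (norm \<xi>)))"
      unfolding q nn[symmetric] by (simp add: algebra_simps)
    finally show ?thesis .
  qed
  moreover have "integrable lborel (\<lambda>\<xi>. cis (x \<bullet> \<xi>) * complex_of_real (w2 (norm \<xi>) + w1 (norm \<xi>) / norm \<xi>))"
  proof (rule integrable_bounded_cball[of _ "B2 + B1 / a" 0 b])
    fix \<xi> :: "real^2"
    have "\<bar>w2 (norm \<xi>)\<bar> \<le> B2" by (rule B2(2))
    moreover have "\<bar>w1 (norm \<xi>) / norm \<xi>\<bar> \<le> B1 / a" by (rule wr)
    ultimately show "norm (cis (x \<bullet> \<xi>) * complex_of_real (w2 (norm \<xi>) + w1 (norm \<xi>) / norm \<xi>)) \<le> B2 + B1 / a"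
      unfolding norm_mult norm_cis norm_of_real mult_1_left by linarith
    show "norm (\<xi> - 0) \<le> b" if "cis (x \<bullet> \<xi>) * complex_of_real (w2 (norm \<xi>) + w1 (norm \<xi>) / norm \<xi>) \<noteq> 0"
      using that z[of "norm \<xi>"] by (cases "norm \<xi> \<in> {a<..<b}") auto
  qed measurable
  moreover have "integrable lborel (\<lambda>\<xi>. (norm x)\<^sup>2 * (cis (x \<bullet> \<xi>) * complex_of_real (w (norm \<xi>))))"
  proof (intro integrable_mult_right integrable_bounded_cball[of _ B0 0 b])
    fix \<xi> :: "real^2"
    show "norm (cis (x \<bullet> \<xi>) * complex_of_real (w (norm \<xi>))) \<le> B0"
      using B0 by (simp add: norm_mult)
    show "norm (\<xi> - 0) \<le> b" if "cis (x \<bullet> \<xi>) * complex_of_real (w (norm \<xi>)) \<noteq> 0"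
      using that z[of "norm \<xi>"] by (cases "norm \<xi> \<in> {a<..<b}") auto
  qed measurable
  ultimately have "(LINT \<xi>|lborel. cis (x \<bullet> \<xi>) * of_real (w2 (norm \<xi>) + w1 (norm \<xi>) / norm \<xi>)) + 
      (LINT \<xi>|lborel. (norm x)\<^sup>2 * (cis (x \<bullet> \<xi>) * complex_of_real (w (norm \<xi>)))) = 0"
    by (subst Bochner_Integration.integral_add[symmetric]) simp_all
  then show ?thesis
    unfolding integral_mult_right_zero by (simp add: eq_neg_iff_add_eq_0 add.commute)
qed


lemma dyadic_partition_derivs:
  assumes "dyadic_partition \<theta>"
  shows "((deriv ^^ n) \<theta> has_real_derivative (deriv ^^ Suc n) \<theta> r) (at r)"
    and "r \<notin> {3/4<..<8/3} \<Longrightarrow> (deriv ^^ n) \<theta> r = 0"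
    and "isCont ((deriv ^^ n) \<theta>) r"
proof -
  have "(deriv ^^ n) \<theta> differentiable (at r)" for n r
    using assms by (simp add: dyadic_partition_def)
  then show d: "((deriv ^^ n) \<theta> has_real_derivative (deriv ^^ Suc n) \<theta> r) (at r)" for n r
    by (simp add: DERIV_deriv_iff_real_differentiable)
  then show "isCont ((deriv ^^ n) \<theta>) r" using DERIV_isCont by blast
  have "(deriv ^^ n) \<theta> r = 0" if "r \<in> - support \<theta>" for r
    using that
  proof (induction n arbitrary: r)
    case 0
    have "r \<notin> {x. \<theta> x \<noteq> 0}" using 0 closure_subset[of "{x. \<theta> x \<noteq> 0}"] unfolding support_def by blast
    then show ?case by simp
  next
    case (Suc n)
    have "((\<lambda>_. 0) has_real_derivative 0) (at r)" by simp
    then have "((deriv ^^ n) \<theta> has_real_derivative 0) (at r)"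
      by (rule has_field_derivative_transform_within_open[of _ _ _ "- support \<theta>"])
         (use Suc in \<open>auto simp: support_def\<close>)
    then show ?case using DERIV_unique d by blast
  qed
  moreover have "support \<theta> \<subseteq> {3/4<..<8/3}" using assms by (simp add: dyadic_partition_def)
  ultimately show "(deriv ^^ n) \<theta> r = 0" if "r \<notin> {3/4<..<8/3}" using that by blast
qed

text \<open>
  Two applications of \<open>radial_laplacian_fourier\<close> bound \<open>\<bar>x\<bar>^4\<close> times the kernel; \<open>v\<close> is the radial profile of the
  Laplacian of \<open>\<theta> \<bar>\<xi>\<bar>\<close>, and \<open>v1\<close>, \<open>v2\<close> are its first two derivatives.
\<close>

lemma dyadic_kernel_decay:
  assumes \<theta>: "dyadic_partition \<theta>"
  obtains C where "C > 0" 
    "\<And>x::real^2. norm (LINT \<xi>|lborel. cis (x \<bullet> \<xi>) * of_real (\<theta> (norm \<xi>))) \<le> C / (1 + norm x ^ 4)"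
proof -
  define d where "d n = (deriv ^^ n) \<theta>" for n
  have d: "(d n has_real_derivative d (Suc n) r) (at r)" for n r
    unfolding d_def by (rule dyadic_partition_derivs(1)[OF \<theta>])
  have z: "d n r = 0" if "r \<notin> {3/4<..<8/3}" for n r
    unfolding d_def using dyadic_partition_derivs(2)[OF \<theta> that] .
  have c: "isCont (d n) r" for n r using d DERIV_isCont by blast
  define v where "v r = d 2 r + d 1 r / r" for r
  define v1 where "v1 r = d 3 r + d 2 r / r - d 1 r / r^2" for r
  define v2 where "v2 r = d 4 r + d 3 r / r - 2 * d 2 r / r^2 + 2 * d 1 r / r^3" for r
  have vz: "v r = 0" "v1 r = 0" "v2 r = 0" if "r \<notin> {3/4<..<8/3}" for r
    using z[OF that] by (auto simp: v_def v1_def v2_def)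
  have S: "open {-3/4<..<3/4::real}" "0 \<in> {-3/4<..<3/4::real}" by auto
  have D1: "(v has_real_derivative v1 r) (at r)" for r
  proof (cases "r = 0")
    case True
    \<comment> \<open>Division by \<open>r\<close> is harmless: all functions vanish for \<open>r < 3/4\<close>.\<close>
    have "((\<lambda>_. 0) has_real_derivative 0) (at (0::real))" by simp
    then have "(v has_real_derivative 0) (at 0)"
      by (rule has_field_derivative_transform_within_open[OF _ S]) (use vz in auto)
    then show ?thesis using True vz[of 0] by simp
  next
    case False
    show ?thesis unfolding v_def v1_def using False d[of 1 r] d[of 2 r]
      by (auto intro!: derivative_eq_intros simp: eval_nat_numeral field_simps)
  qed
  have D2: "(v1 has_real_derivative v2 r) (at r)" for r
  proof (cases "r = 0")
    case True
    have "((\<lambda>_. 0) has_real_derivative 0) (at (0::real))" by simp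
    then have "(v1 has_real_derivative 0) (at 0)"
      by (rule has_field_derivative_transform_within_open[OF _ S]) (use vz in auto)
    then show ?thesis using True vz[of 0] by simp
  next
    case False
    show ?thesis unfolding v1_def v2_def using False d[of 1 r] d[of 2 r] d[of 3 r]
      by (auto intro!: derivative_eq_intros simp: eval_nat_numeral field_simps)
  qed
  have C2: "isCont v2 r" for r
  proof (cases "r = 0")
    case True
    have "isCont (\<lambda>_. 0::real) 0" by simp
    moreover have "eventually (\<lambda>r. 0 = v2 r) (nhds 0)"
      using eventually_nhds_in_open[OF S] by eventually_elim (use vz in auto)
    ultimately show ?thesis using isCont_cong[of "\<lambda>_. 0" v2 0] True by blast
  next
    case False
    then show ?thesis unfolding v2_def by (intro continuous_intros c) auto
  qed
  define K where "K f = (LINT \<xi>|lborel. f \<xi>)" for f :: "real^2 \<Rightarrow> complex"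
  define C0 where "C0 = (LINT \<xi>::real^2|lborel. \<bar>\<theta> (norm \<xi>)\<bar>)"
  define C4 where "C4 = (LINT \<xi>::real^2|lborel. \<bar>v2 (norm \<xi>) + v1 (norm \<xi>) / norm \<xi>\<bar>)"
  have nb: "norm (LINT \<xi>|lborel. cis (x \<bullet> \<xi>) * complex_of_real (f \<xi>)) \<le> (LINT \<xi>|lborel. \<bar>f \<xi>\<bar>)" for f and x :: "real^2"
    by (rule order_trans[OF integral_norm_bound]) (simp add: norm_mult)
  have "norm (LINT \<xi>|lborel. cis (x \<bullet> \<xi>) * of_real (\<theta> (norm \<xi>))) \<le> (C0 + C4 + 1) / (1 + norm x ^ 4)" for x :: "real^2"
  proof -
    let ?K = "LINT \<xi>|lborel. cis (x \<bullet> \<xi>) * of_real (\<theta> (norm \<xi>))"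
    let ?V = "LINT \<xi>|lborel. cis (x \<bullet> \<xi>) * of_real (v (norm \<xi>))"
    let ?V2 = "LINT \<xi>|lborel. cis (x \<bullet> \<xi>) * of_real (v2 (norm \<xi>) + v1 (norm \<xi>) / norm \<xi>)"
    have 1: "(norm x)\<^sup>2 * ?K = - ?V"
    proof -
      have e: "d 0 = \<theta>" "Suc 0 = 1" "Suc 1 = 2" by (auto simp: d_def)
      have d01: "(\<theta> has_real_derivative d 1 r) (at r)" "(d 1 has_real_derivative d 2 r) (at r)" for r
        using d[of 0 r] d[of 1 r] unfolding e by auto
      have z0: "\<theta> r = 0" if "r \<notin> {3/4<..<8/3}" for r using z[OF that, of 0] unfolding e .
      show ?thesis unfolding v_def
        by (rule radial_laplacian_fourier[where a="3/4" and b="8/3", OF d01(1) d01(2) c _ z0 z z]) auto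
    qed
    have 2: "(norm x)\<^sup>2 * ?V = - ?V2"
      by (rule radial_laplacian_fourier[where a="3/4" and b="8/3", OF D1 D2 C2 _ vz]) auto
    have "(norm x)\<^sup>2 * ((norm x)\<^sup>2 * ?K) = ?V2" unfolding 1 using 2 by simp
    then have "norm ((norm x)\<^sup>2 * ((norm x)\<^sup>2 * ?K)) = norm ?V2" by simp
    then have "norm x ^ 4 * norm ?K = norm ?V2" 
      by (simp add: norm_mult norm_power mult.assoc[symmetric] power_add[symmetric])
    also have "norm ?V2 \<le> C4" unfolding C4_def by (rule nb)
    finally have "norm x ^ 4 * norm ?K \<le> C4" .
    moreover have "norm ?K \<le> C0" unfolding C0_def by (rule nb)
    ultimately have "norm ?K * (1 + norm x ^ 4) \<le> C0 + C4 + 1"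
      unfolding distrib_left mult_1_right by (simp add: mult.commute)
    then show ?thesis by (subst pos_le_divide_eq) (auto intro: add_pos_nonneg)
  qed
  moreover have "C0 \<ge> 0" "C4 \<ge> 0" by (auto simp: C0_def C4_def)
  then have "C0 + C4 + 1 > 0" by simp
  ultimately show ?thesis using that by blast
qed

section \<open>Lebesgue norms\<close>

lemma enn2real_gt_1:
  assumes "q > 1" and "q \<noteq> \<infinity>"
  shows "enn2real q > 1"
  using assms ennreal_less_iff[of 1] by (cases q) auto

lemma Lq_norm_infinity_le:
  assumes [measurable]: "f \<in> borel_measurable borel" and "\<And>x. norm (f x) \<le> B"
  shows "Lq_norm \<infinity> f \<le> ennreal B"
  unfolding Lq_norm_def using assms by (auto intro!: esssup_I ennreal_leI)

lemma Lq_norm_finite: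
  assumes "q \<noteq> \<infinity>"
  shows "Lq_norm q f = (if (\<integral>\<^sup>+ x. ennreal (cmod (f x) powr enn2real q) \<partial>lborel) = \<infinity> then \<infinity>
      else ennreal (enn2real (\<integral>\<^sup>+ x. ennreal (cmod (f x) powr enn2real q) \<partial>lborel) powr (1 / enn2real q)))"
  using assms by (simp add: Lq_norm_def Let_def)

lemma Lq_norm_finite_le:
  assumes "q \<noteq> \<infinity>" and "(\<integral>\<^sup>+ x. ennreal (cmod (f x) powr enn2real q) \<partial>lborel) \<le> ennreal J" and "J \<ge> 0"
  shows "Lq_norm q f \<le> ennreal (J powr (1 / enn2real q))"
proof -
  have "(\<integral>\<^sup>+ x. ennreal (cmod (f x) powr enn2real q) \<partial>lborel) \<noteq> \<infinity>"
    using assms(2) by (auto simp: top_unique)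
  moreover have "enn2real (\<integral>\<^sup>+ x. ennreal (cmod (f x) powr enn2real q) \<partial>lborel) \<le> J"
    using assms(2,3) by (intro enn2real_leI) auto
  ultimately show ?thesis
    unfolding Lq_norm_finite[OF assms(1)] by (auto intro!: ennreal_leI powr_mono2)
qed

lemma Lq_norm_2_le:
  assumes "(\<integral>\<^sup>+ x. ennreal ((cmod (f x))\<^sup>2) \<partial>lborel) \<le> ennreal J" and "J \<ge> 0"
  shows "Lq_norm 2 f \<le> ennreal (sqrt J)"
proof -
  have e: "enn2real 2 = 2" by simp
  have *: "cmod (f x) powr 2 = (cmod (f x))\<^sup>2" for x
    by (simp add: powr_numeral)
  have "Lq_norm 2 f \<le> ennreal (J powr (1 / enn2real 2))"
    by (rule Lq_norm_finite_le) (use assms in \<open>simp_all add: e *\<close>)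
  then show ?thesis using assms by (simp add: e powr_half_sqrt)
qed

text \<open>
  \<open>\<bar>f\<bar>^q \<le> B^(q - 1) \<bar>f\<bar>\<close>. For \<open>q = \<infinity>\<close> the value \<open>enn2real \<infinity> = 0\<close> makes \<open>1 / enn2real q\<close> vanish, which is the correct
  exponent, so that one formula covers all \<open>q\<close>.
\<close>

lemma Lq_norm_interpolation:
  assumes [measurable]: "f \<in> borel_measurable borel" and B: "\<And>x. norm (f x) \<le> B" "B > 0"
    and A: "(\<integral>\<^sup>+x. ennreal (norm (f x)) \<partial>lborel) \<le> ennreal A" "A > 0" and q: "q > 1"
  shows "Lq_norm q f \<le> ennreal (B powr (1 - 1 / enn2real q) * A powr (1 / enn2real q))"
proof (cases "q = \<infinity>")
  case True
  then show ?thesis using Lq_norm_infinity_le[of f B] B A by simp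
next
  case False
  define p where "p = enn2real q"
  have p: "p > 1" unfolding p_def using q False by (rule enn2real_gt_1)
  have "(\<integral>\<^sup>+ x. ennreal (cmod (f x) powr p) \<partial>lborel) \<le> (\<integral>\<^sup>+ x. ennreal (B powr (p - 1)) * ennreal (norm (f x)) \<partial>lborel)"
  proof (rule nn_integral_mono)
    fix x
    have "cmod (f x) powr p = cmod (f x) powr (p - 1) * cmod (f x)"
      by (cases "f x = 0") (auto simp: powr_diff)
    also have "\<dots> \<le> B powr (p - 1) * cmod (f x)"
      using B p by (intro mult_right_mono powr_mono2) auto
    finally show "ennreal (cmod (f x) powr p) \<le> ennreal (B powr (p - 1)) * ennreal (norm (f x))"
      by (subst ennreal_mult[symmetric]) (auto intro: ennreal_leI)
  qed
  also have "\<dots> = ennreal (B powr (p - 1)) * (\<integral>\<^sup>+ x. ennreal (norm (f x)) \<partial>lborel)"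
    by (rule nn_integral_cmult) measurable
  also have "\<dots> \<le> ennreal (B powr (p - 1)) * ennreal A"
    by (intro mult_left_mono A) auto
  also have "\<dots> = ennreal (B powr (p - 1) * A)"
    using A by (subst ennreal_mult) auto
  finally have "Lq_norm q f \<le> ennreal ((B powr (p - 1) * A) powr (1 / enn2real q))"
    using A(2) False by (intro Lq_norm_finite_le) (auto simp: p_def)
  also have "(B powr (p - 1) * A) powr (1 / enn2real q) = B powr (1 - 1 / enn2real q) * A powr (1 / enn2real q)"
    using B A p unfolding p_def[symmetric] by (simp add: powr_mult powr_powr diff_divide_distrib)
  finally show ?thesis .
qed

text \<open>
  A substitute for Hoelder's inequality whose constant does not depend on \<open>q\<close>: for finite \<open>q\<close> and the norm \<open>N\<close> of \<open>f\<close>,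
  apply \<open>t \<le> 1 + t^q\<close> to \<open>t = \<bar>f\<bar> / N\<close> and integrate over \<open>E\<close>.
\<close>

lemma set_nn_integral_le_Lq_norm:
  assumes [measurable]: "f \<in> borel_measurable borel" "E \<in> sets borel" and q: "q > 1"
  shows "(\<integral>\<^sup>+x\<in>E. ennreal (norm (f x)) \<partial>lborel) \<le> (emeasure lborel E + 1) * Lq_norm q f"
proof (cases "q = \<infinity>")
  case True
  have ae: "AE x in lborel. ennreal (cmod (f x)) \<le> Lq_norm q f"
    using True esssup_AE by (simp add: Lq_norm_def)
  have "(\<integral>\<^sup>+x\<in>E. ennreal (norm (f x)) \<partial>lborel) \<le> (\<integral>\<^sup>+x\<in>E. Lq_norm q f \<partial>lborel)"
    using ae by (intro nn_integral_mono_AE) (auto simp: indicator_def)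
  also have "\<dots> = Lq_norm q f * emeasure lborel E"
    by (subst nn_integral_cmult_indicator) auto
  also have "\<dots> \<le> Lq_norm q f * (emeasure lborel E + 1)"
    by (intro mult_left_mono) auto
  finally show ?thesis by (simp add: mult.commute)
next
  case False
  define p where "p = enn2real q"
  have p: "p > 1" unfolding p_def using q False by (rule enn2real_gt_1)
  define I where "I = (\<integral>\<^sup>+ x. ennreal (cmod (f x) powr p) \<partial>lborel)"
  show ?thesis
  proof (cases "I = \<infinity>")
    case True
    then have "Lq_norm q f = \<infinity>" using False by (simp add: Lq_norm_finite I_def p_def)
    then show ?thesis by (simp add: ennreal_mult_top)
  next
    case fin: False
    define N where "N = enn2real I powr (1 / p)"
    have LN: "Lq_norm q f = ennreal N" using False fin by (simp add: Lq_norm_finite I_def p_def N_def)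
    show ?thesis
    proof (cases "N = 0")
      case True
      then have "enn2real I = 0" by (simp add: N_def)
      then have "I = 0" using fin by (auto simp: enn2real_eq_0_iff)
      then have "AE x in lborel. ennreal (cmod (f x) powr p) = 0" 
        unfolding I_def by (subst (asm) nn_integral_0_iff_AE) auto
      then have ae: "AE x in lborel. f x = 0" by eventually_elim (use p in \<open>auto simp: ennreal_eq_0_iff\<close>)
      have "(\<integral>\<^sup>+x\<in>E. ennreal (norm (f x)) \<partial>lborel) = (\<integral>\<^sup>+(x::real^2). 0 \<partial>lborel)"
        by (rule nn_integral_cong_AE) (use ae in \<open>eventually_elim, simp\<close>)
      then show ?thesis by simp
    next
      case N: False
      then have N0: "N > 0" by (simp add: N_def)
      have Np: "I = ennreal (N powr p)"
        using p fin N by (simp add: N_def powr_powr less_top)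
      have "(\<integral>\<^sup>+x\<in>E. ennreal (norm (f x)) \<partial>lborel) \<le> (\<integral>\<^sup>+x. ennreal N * indicator E x + ennreal (N / N powr p) * ennreal (cmod (f x) powr p) \<partial>lborel)"
      proof (rule nn_integral_mono)
        fix x
        define t where "t = norm (f x) / N"
        have t0: "t \<ge> 0" using N0 by (simp add: t_def)
        have "t \<le> 1 + t powr p"
        proof (cases "t \<le> 1")
          case False
          then have "t powr 1 \<le> t powr p" using p by (intro powr_mono) auto
          then show ?thesis using False by simp
        qed (simp add: add_increasing2)
        then have "N * t \<le> N * (1 + t powr p)" using N0 by (intro mult_left_mono) auto
        also have "\<dots> = N + N / N powr p * norm (f x) powr p"
          using N0 by (simp add: t_def powr_divide distrib_left)
        finally have "norm (f x) \<le> N + N / N powr p * norm (f x) powr p" using N0 by (simp add: t_def)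
        then have "ennreal (norm (f x)) \<le> ennreal (N + N / N powr p * norm (f x) powr p)" by (rule ennreal_leI)
        also have "\<dots> = ennreal N + ennreal (N / N powr p) * ennreal (norm (f x) powr p)"
          using N0 by (subst ennreal_mult[symmetric], simp, simp, subst ennreal_plus[symmetric]) auto
        finally show "ennreal (norm (f x)) * indicator E x \<le> ennreal N * indicator E x + ennreal (N / N powr p) * ennreal (cmod (f x) powr p)"
          by (auto simp: indicator_def)
      qed
      also have "\<dots> = ennreal N * emeasure lborel E + ennreal (N / N powr p) * I"
        unfolding I_def by (simp add: nn_integral_add nn_integral_cmult)
      also have "ennreal (N / N powr p) * I = ennreal N"
        unfolding Np using N0 by (subst ennreal_mult[symmetric]) auto
      finally show ?thesis unfolding LN by (simp add: distrib_left mult.commute)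
    qed
  qed
qed

section \<open>Dyadic blocks as convolutions\<close>

lemma borel_measurable_inv_fourier [measurable]:
  assumes [measurable]: "m \<in> borel_measurable borel"
  shows "inv_fourier m \<in> borel_measurable borel"
  unfolding inv_fourier_def by measurable

lemma borel_measurable_fourier [measurable]:
  assumes [measurable]: "a \<in> borel_measurable borel"
  shows "fourier a \<in> borel_measurable borel"
  unfolding fourier_def by measurable

lemma norm_fourier_le: "norm (fourier a \<xi>) \<le> (LINT x|lborel. norm (a x))"
  unfolding fourier_def by (rule order_trans[OF integral_norm_bound]) (simp add: norm_mult)

lemma norm_inv_fourier_le: "norm (inv_fourier m x) \<le> (LINT \<xi>|lborel. norm (m \<xi>))"
proof -
  have p1: "(2 * pi)\<^sup>2 \<ge> 1" using pi_gt3 by (intro one_le_power) auto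
  have "norm (inv_fourier m x) = norm (LINT \<xi>|lborel. cis (x \<bullet> \<xi>) * m \<xi>) / (2 * pi)\<^sup>2"
    unfolding inv_fourier_def norm_divide norm_of_real by simp
  also have "\<dots> \<le> norm (LINT \<xi>|lborel. cis (x \<bullet> \<xi>) * m \<xi>) / 1"
    using p1 by (intro divide_left_mono) auto
  also have "\<dots> \<le> (LINT \<xi>|lborel. norm (cis (x \<bullet> \<xi>) * m \<xi>))"
    unfolding div_by_1 by (rule integral_norm_bound)
  finally show ?thesis by (simp add: norm_mult)
qed

lemma isCont_fourier:
  assumes a: "integrable lborel a"
  shows "isCont (fourier a) \<xi>"
  unfolding continuous_at_sequentially o_def
proof (intro allI impI)
  fix X assume X: "X \<longlonglongrightarrow> \<xi>"
  have [measurable]: "a \<in> borel_measurable borel" using a by auto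
  show "(\<lambda>n. fourier a (X n)) \<longlonglongrightarrow> fourier a \<xi>"
    unfolding fourier_def
  proof (rule integral_dominated_convergence[where w = "\<lambda>x. norm (a x)"])
    show "integrable lborel (\<lambda>x. norm (a x))" using a by simp
    show "AE x in lborel. (\<lambda>n. cis (- (x \<bullet> X n)) * a x) \<longlonglongrightarrow> cis (- (x \<bullet> \<xi>)) * a x"
      by (intro AE_I2 tendsto_intros X)
    show "AE x in lborel. cmod (cis (- (x \<bullet> X n)) * a x) \<le> cmod (a x)" for n
      by (simp add: norm_mult)
  qed measurable
qed

definition dyadic_kernel :: "(real \<Rightarrow> real) \<Rightarrow> int \<Rightarrow> real^2 \<Rightarrow> complex" where
  "dyadic_kernel \<theta> k x = (LINT \<xi>|lborel. cis (x \<bullet> \<xi>) * of_real (\<theta> (2 powi (- k) * norm \<xi>)))"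

lemma dyadic_multiplier_props:
  assumes \<theta>: "dyadic_partition \<theta>"
  shows "\<theta> \<in> borel_measurable borel"
    and "\<theta> (2 powi (- k) * norm \<xi>) \<noteq> 0 \<Longrightarrow> 3/4 * 2 powi k < norm \<xi> \<and> norm \<xi> < 8/3 * 2 powi k"
proof -
  show "\<theta> \<in> borel_measurable borel"
    using dyadic_partition_derivs(3)[OF \<theta>, of _ 0]
    by (auto intro!: borel_measurable_continuous_onI continuous_at_imp_continuous_on)
  assume "\<theta> (2 powi (- k) * norm \<xi>) \<noteq> 0"
  then have "2 powi (- k) * norm \<xi> \<in> {3/4<..<8/3}"
    using dyadic_partition_derivs(2)[OF \<theta>, of "2 powi (- k) * norm \<xi>" 0] by auto
  then show "3/4 * 2 powi k < norm \<xi> \<and> norm \<xi> < 8/3 * 2 powi k"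
    by (auto simp: power_int_minus field_simps)
qed

lemma dyadic_partition_bounded:
  assumes "dyadic_partition \<theta>"
  obtains T where "T > 0" "\<And>r. \<bar>\<theta> r\<bar> \<le> T"
  using bounded_of_continuous_interval_support[of \<theta> "3/4" "8/3"]
    dyadic_partition_derivs(2,3)[OF assms, of _ 0] by auto

text \<open>
  Scaling by \<open>2^k\<close> reduces every kernel to the one with \<open>k = 0\<close>; the estimate has \<open>L\<^sup>1\<close> norm independent of
  \<open>k\<close>.
\<close>

lemma dyadic_kernel_bound:
  assumes \<theta>: "dyadic_partition \<theta>"
  obtains C where "C > 0" "\<And>k x. norm (dyadic_kernel \<theta> k x) \<le> (2 powi k)\<^sup>2 * (C / (1 + norm (2 powi k *\<^sub>R x) ^ 4))"
proof -
  obtain C where C: "C > 0" 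
    "\<And>x::real^2. norm (LINT \<xi>|lborel. cis (x \<bullet> \<xi>) * of_real (\<theta> (norm \<xi>))) \<le> C / (1 + norm x ^ 4)"
    using dyadic_kernel_decay[OF \<theta>] by blast
  note [measurable] = dyadic_multiplier_props(1)[OF \<theta>]
  have "norm (dyadic_kernel \<theta> k x) \<le> (2 powi k)\<^sup>2 * (C / (1 + norm (2 powi k *\<^sub>R x) ^ 4))" for k x
  proof -
    have c: "(2::real) powi k > 0" by simp
    have "dyadic_kernel \<theta> k x = of_real (\<bar>2 powi k\<bar> ^ DIM(real^2)) *
       (LINT \<xi>|lborel. cis (x \<bullet> (0 + 2 powi k *\<^sub>R \<xi>)) * of_real (\<theta> (2 powi (- k) * norm (0 + 2 powi k *\<^sub>R \<xi>))))"
      unfolding dyadic_kernel_def by (rule lborel_integral_affine) (use c in auto)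
    also have "(\<lambda>\<xi>. cis (x \<bullet> (0 + 2 powi k *\<^sub>R \<xi>)) * complex_of_real (\<theta> (2 powi (- k) * norm (0 + 2 powi k *\<^sub>R \<xi>))))
       = (\<lambda>\<xi>::real^2. cis ((2 powi k *\<^sub>R x) \<bullet> \<xi>) * complex_of_real (\<theta> (norm \<xi>)))"
      using c by (simp add: power_int_minus mult.assoc[symmetric])
    finally have "norm (dyadic_kernel \<theta> k x) = (2 powi k)\<^sup>2 * norm (LINT \<xi>|lborel. cis ((2 powi k *\<^sub>R x) \<bullet> \<xi>) * of_real (\<theta> (norm \<xi>)))"
      by (simp only: norm_mult norm_of_real) simp
    also have "\<dots> \<le> (2 powi k)\<^sup>2 * (C / (1 + norm (2 powi k *\<^sub>R x) ^ 4))"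
      by (intro mult_left_mono C) auto
    finally show ?thesis .
  qed
  with C(1) show ?thesis by (rule that)
qed

lemma dyadic_block_eq_convolution:
  assumes \<theta>: "dyadic_partition \<theta>" and f: "integrable lborel f"
  shows "dyadic_block \<theta> k f x = (LINT y|lborel. f y * dyadic_kernel \<theta> k (x - y)) / of_real ((2 * pi)\<^sup>2)"
proof -
  note [measurable] = dyadic_multiplier_props(1)[OF \<theta>]
  obtain T where T: "T > 0" "\<And>r. \<bar>\<theta> r\<bar> \<le> T" using dyadic_partition_bounded[OF \<theta>] by blast
  let ?m = "\<lambda>\<xi>::real^2. complex_of_real (\<theta> (2 powi (- k) * norm \<xi>))"
  have I: "integrable lborel (\<lambda>\<xi>. cis (x \<bullet> \<xi>) * ?m \<xi>)"
  proof (rule integrable_bounded_cball[of _ T 0 "8/3 * 2 powi k"])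
    show "norm (cis (x \<bullet> \<xi>) * ?m \<xi>) \<le> T" for \<xi> using T by (simp add: norm_mult)
    show "norm (\<xi> - 0) \<le> 8/3 * 2 powi k" if "cis (x \<bullet> \<xi>) * ?m \<xi> \<noteq> 0" for \<xi>
      using dyadic_multiplier_props(2)[OF \<theta>, of k \<xi>] that by auto
  qed measurable
  have "(LINT \<xi>|lborel. cis (x \<bullet> \<xi>) * (?m \<xi> * fourier f \<xi>)) = (LINT \<xi>|lborel. (cis (x \<bullet> \<xi>) * ?m \<xi>) * (LINT y|lborel. cis (- (y \<bullet> \<xi>)) * f y))"
    unfolding fourier_def by (simp add: mult.assoc)
  also have "\<dots> = (LINT y|lborel. f y * (LINT \<xi>|lborel. cis (- (y \<bullet> \<xi>)) * (cis (x \<bullet> \<xi>) * ?m \<xi>)))"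
    by (rule integral_kernel_swap[OF I f]) auto
  also have "(\<lambda>y. LINT \<xi>|lborel. cis (- (y \<bullet> \<xi>)) * (cis (x \<bullet> \<xi>) * ?m \<xi>)) = (\<lambda>y. dyadic_kernel \<theta> k (x - y))"
    unfolding dyadic_kernel_def by (simp add: mult.assoc[symmetric] cis_mult inner_diff_left)
  finally show ?thesis
    unfolding dyadic_block_def fourier_multiplier_def inv_fourier_def by simp
qed

text \<open>
  Young's inequality for the convolution with the dyadic kernel: the first and third bounds use its \<open>L\<^sup>1\<close>
  norm, the second one, useful for negative \<open>k\<close>, its supremum.
\<close>

lemma dyadic_block_bounds:
  assumes \<theta>: "dyadic_partition \<theta>"
  obtains C where "C > 0"
    "\<And>k f B x. integrable lborel f \<Longrightarrow> (\<And>x. norm (f x) \<le> B) \<Longrightarrow> norm (dyadic_block \<theta> k f x) \<le> C * B"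
    "\<And>k f x. integrable lborel f \<Longrightarrow> norm (dyadic_block \<theta> k f x) \<le> C * (2 powi k)\<^sup>2 * (LINT x|lborel. norm (f x))"
    "\<And>k f. integrable lborel f \<Longrightarrow> (\<integral>\<^sup>+x. ennreal (norm (dyadic_block \<theta> k f x)) \<partial>lborel) \<le> ennreal (C * (LINT x|lborel. norm (f x)))"
proof -
  note [measurable] = dyadic_multiplier_props(1)[OF \<theta>]
  obtain C where C: "C > 0" "\<And>k x. norm (dyadic_kernel \<theta> k x) \<le> (2 powi k)\<^sup>2 * (C / (1 + norm (2 powi k *\<^sub>R x) ^ 4))"
    using dyadic_kernel_bound[OF \<theta>] by blast
  define A where "A = (LINT x::real^2|lborel. 1 / (1 + norm x ^ 4))"
  have A0: "A \<ge> 0" unfolding A_def by (rule Bochner_Integration.integral_nonneg) simp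
  have A: "(\<integral>\<^sup>+(x::real^2). ennreal (1 / (1 + norm x ^ 4)) \<partial>lborel) = ennreal A"
    unfolding A_def by (intro nn_integral_eq_integral integrable_decay4) (auto intro!: add_nonneg_nonneg)
  have [measurable]: "dyadic_kernel \<theta> k \<in> borel_measurable borel" for k
    unfolding dyadic_kernel_def by measurable
  have K1: "(\<integral>\<^sup>+x. ennreal (norm (dyadic_kernel \<theta> k x)) \<partial>lborel) \<le> ennreal (C * A)" for k
  proof -
    have c: "(2::real) powi k > 0" by simp
    have "(\<integral>\<^sup>+x. ennreal (norm (dyadic_kernel \<theta> k x)) \<partial>lborel) \<le> 
       (\<integral>\<^sup>+x. ennreal C * (ennreal ((2 powi k)\<^sup>2) * ennreal (1 / (1 + norm (0 + 2 powi k *\<^sub>R (x::real^2)) ^ 4))) \<partial>lborel)"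
    proof (intro nn_integral_mono)
      fix x :: "real^2"
      have "ennreal (norm (dyadic_kernel \<theta> k x)) \<le> ennreal (C * ((2 powi k)\<^sup>2 * (1 / (1 + norm (0 + 2 powi k *\<^sub>R x) ^ 4))))"
        using C(2)[of k x] by (intro ennreal_leI) (simp add: mult_ac)
      also have "\<dots> = ennreal C * (ennreal ((2 powi k)\<^sup>2) * ennreal (1 / (1 + norm (0 + 2 powi k *\<^sub>R x) ^ 4)))"
        using C(1) by (subst ennreal_mult[symmetric], simp, simp add: add_nonneg_nonneg, subst ennreal_mult[symmetric]) (auto intro!: add_nonneg_nonneg)
      finally show "ennreal (norm (dyadic_kernel \<theta> k x)) \<le> \<dots>" .
    qed
    also have "\<dots> = ennreal C * (ennreal (\<bar>2 powi k\<bar> ^ DIM(real^2)) * (\<integral>\<^sup>+(x::real^2). ennreal (1 / (1 + norm (0 + 2 powi k *\<^sub>R x) ^ 4)) \<partial>lborel))"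
      by (subst nn_integral_cmult, measurable, subst nn_integral_cmult) simp_all
    also have "ennreal (\<bar>2 powi k\<bar> ^ DIM(real^2)) * (\<integral>\<^sup>+(x::real^2). ennreal (1 / (1 + norm (0 + 2 powi k *\<^sub>R x) ^ 4)) \<partial>lborel) = ennreal A"
      unfolding A[symmetric] by (rule nn_integral_lborel_affine[symmetric]) (use c in auto)
    finally show ?thesis using C(1) A0 by (simp add: ennreal_mult)
  qed
  have p1: "(2 * pi)\<^sup>2 \<ge> 1" using pi_gt3 by (intro one_le_power) auto
  have conv: "ennreal (norm (dyadic_block \<theta> k f x)) \<le> (\<integral>\<^sup>+y. ennreal (norm (f y)) * ennreal (norm (dyadic_kernel \<theta> k (x - y))) \<partial>lborel)"
    if f: "integrable lborel f" for k f x
  proof -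
    have "norm (dyadic_block \<theta> k f x) \<le> norm (LINT y|lborel. f y * dyadic_kernel \<theta> k (x - y)) / 1"
      unfolding dyadic_block_eq_convolution[OF \<theta> f] norm_divide norm_of_real using p1
      by (intro divide_left_mono) auto
    then have "ennreal (norm (dyadic_block \<theta> k f x)) \<le> ennreal (norm (LINT y|lborel. f y * dyadic_kernel \<theta> k (x - y)))"
      by (intro ennreal_leI) simp
    also have "\<dots> \<le> (\<integral>\<^sup>+y. norm (f y * dyadic_kernel \<theta> k (x - y)) \<partial>lborel)"
      by (rule integral_norm_le_nn_integral)
    finally show ?thesis by (simp add: norm_mult ennreal_mult)
  qed
  have shift: "(\<integral>\<^sup>+y. ennreal (norm (dyadic_kernel \<theta> k (x - y))) \<partial>lborel) \<le> ennreal (C * A)" for k x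
  proof -
    have "(\<integral>\<^sup>+z. ennreal (norm (dyadic_kernel \<theta> k z)) \<partial>lborel) = ennreal (\<bar>-1\<bar> ^ DIM(real^2)) * (\<integral>\<^sup>+y. ennreal (norm (dyadic_kernel \<theta> k (x + (-1) *\<^sub>R y))) \<partial>lborel)"
      by (rule nn_integral_lborel_affine) auto
    then show ?thesis using K1[of k] by simp
  qed
  have shift': "(\<integral>\<^sup>+x. ennreal (norm (dyadic_kernel \<theta> k (x - y))) \<partial>lborel) \<le> ennreal (C * A)" for k y
  proof -
    have "(\<integral>\<^sup>+z. ennreal (norm (dyadic_kernel \<theta> k z)) \<partial>lborel) = ennreal (\<bar>1\<bar> ^ DIM(real^2)) * (\<integral>\<^sup>+x. ennreal (norm (dyadic_kernel \<theta> k (-y + 1 *\<^sub>R x))) \<partial>lborel)"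
      by (rule nn_integral_lborel_affine) auto
    then show ?thesis using K1[of k] by simp
  qed
  show ?thesis
  proof (rule that[of "C * A + C"])
    show "C * A + C > 0" using C(1) A0 by (simp add: add_nonneg_pos)
  next
    fix k and f :: "real^2 \<Rightarrow> complex" and B and x :: "real^2" assume f: "integrable lborel f" and B: "\<And>x. norm (f x) \<le> B"
    have B0: "B \<ge> 0" using B[of 0] norm_ge_zero order_trans by blast
    have [measurable]: "f \<in> borel_measurable borel" using f by auto
    have "ennreal (norm (dyadic_block \<theta> k f x)) \<le> (\<integral>\<^sup>+y. ennreal (norm (f y)) * ennreal (norm (dyadic_kernel \<theta> k (x - y))) \<partial>lborel)"
      by (rule conv[OF f])
    also have "\<dots> \<le> (\<integral>\<^sup>+y. ennreal B * ennreal (norm (dyadic_kernel \<theta> k (x - y))) \<partial>lborel)"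
      by (intro nn_integral_mono mult_right_mono ennreal_leI B) auto
    also have "\<dots> = ennreal B * (\<integral>\<^sup>+y. ennreal (norm (dyadic_kernel \<theta> k (x - y))) \<partial>lborel)"
      by (rule nn_integral_cmult) measurable
    also have "\<dots> \<le> ennreal B * ennreal (C * A)" by (intro mult_left_mono shift) auto
    also have "\<dots> = ennreal (B * (C * A))" using B0 by (simp add: ennreal_mult')
    finally have "norm (dyadic_block \<theta> k f x) \<le> B * (C * A)" using B0 C(1) A0 by (simp add: ennreal_le_iff)
    also have "\<dots> \<le> (C * A + C) * B" using B0 C(1) by (simp add: algebra_simps)
    finally show "norm (dyadic_block \<theta> k f x) \<le> (C * A + C) * B" .
  next
    fix k and f :: "real^2 \<Rightarrow> complex" and x :: "real^2" assume f: "integrable lborel f"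
    have [measurable]: "f \<in> borel_measurable borel" using f by auto
    have fn: "(\<integral>\<^sup>+y. ennreal (norm (f y)) \<partial>lborel) = ennreal (LINT y|lborel. norm (f y))"
      using f by (intro nn_integral_eq_integral) auto
    have L0: "(LINT y|lborel. norm (f y)) \<ge> 0" by simp
    have "ennreal (norm (dyadic_block \<theta> k f x)) \<le> (\<integral>\<^sup>+y. ennreal (norm (f y)) * ennreal (norm (dyadic_kernel \<theta> k (x - y))) \<partial>lborel)"
      by (rule conv[OF f])
    also have "\<dots> \<le> (\<integral>\<^sup>+y. ennreal (norm (f y)) * ennreal (C * (2 powi k)\<^sup>2) \<partial>lborel)"
    proof (intro nn_integral_mono mult_left_mono ennreal_leI)
      fix y
      have "C / (1 + norm (2 powi k *\<^sub>R (x - y)) ^ 4) \<le> C / 1" using C(1) by (intro divide_left_mono) (auto intro: add_pos_nonneg)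
      then have "(2 powi k)\<^sup>2 * (C / (1 + norm (2 powi k *\<^sub>R (x - y)) ^ 4)) \<le> (2 powi k)\<^sup>2 * C"
        by (intro mult_left_mono) auto
      then show "norm (dyadic_kernel \<theta> k (x - y)) \<le> C * (2 powi k)\<^sup>2" using C(2)[of k "x - y"] by (simp only: mult.commute)
    qed auto
    also have "\<dots> = (\<integral>\<^sup>+y. ennreal (norm (f y)) \<partial>lborel) * ennreal (C * (2 powi k)\<^sup>2)"
      by (rule nn_integral_multc) measurable
    also have "\<dots> = ennreal ((LINT y|lborel. norm (f y)) * (C * (2 powi k)\<^sup>2))" unfolding fn by (rule ennreal_mult'[symmetric]) (rule L0)
    finally have "norm (dyadic_block \<theta> k f x) \<le> (LINT y|lborel. norm (f y)) * (C * (2 powi k)\<^sup>2)"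
      using C(1) L0 by (simp add: ennreal_le_iff)
    also have "\<dots> \<le> (LINT y|lborel. norm (f y)) * ((C * A + C) * (2 powi k)\<^sup>2)" 
      using C(1) A0 by (intro mult_left_mono mult_right_mono) auto
    finally show "norm (dyadic_block \<theta> k f x) \<le> (C * A + C) * (2 powi k)\<^sup>2 * (LINT x|lborel. norm (f x))"
      by (simp only: mult.commute)
  next
    fix k and f :: "real^2 \<Rightarrow> complex" assume f: "integrable lborel f"
    have [measurable]: "f \<in> borel_measurable borel" using f by auto
    have fn: "(\<integral>\<^sup>+y. ennreal (norm (f y)) \<partial>lborel) = ennreal (LINT y|lborel. norm (f y))"
      using f by (intro nn_integral_eq_integral) auto
    have "(\<integral>\<^sup>+x. ennreal (norm (dyadic_block \<theta> k f x)) \<partial>lborel) \<le> (\<integral>\<^sup>+x. \<integral>\<^sup>+y. ennreal (norm (f y)) * ennreal (norm (dyadic_kernel \<theta> k (x - y))) \<partial>lborel \<partial>lborel)"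
      by (intro nn_integral_mono conv[OF f])
    also have "\<dots> = (\<integral>\<^sup>+y. \<integral>\<^sup>+x. ennreal (norm (f y)) * ennreal (norm (dyadic_kernel \<theta> k (x - y))) \<partial>lborel \<partial>lborel)"
      by (rule lborel_pair.Fubini'[symmetric]) measurable
    also have "\<dots> = (\<integral>\<^sup>+y. ennreal (norm (f y)) * (\<integral>\<^sup>+x. ennreal (norm (dyadic_kernel \<theta> k (x - y))) \<partial>lborel) \<partial>lborel)"
      by (intro nn_integral_cong nn_integral_cmult) measurable
    also have "\<dots> \<le> (\<integral>\<^sup>+y. ennreal (norm (f y)) * ennreal (C * A) \<partial>lborel)"
      by (intro nn_integral_mono mult_left_mono shift') auto
    also have "\<dots> = (\<integral>\<^sup>+y. ennreal (norm (f y)) \<partial>lborel) * ennreal (C * A)"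
      by (rule nn_integral_multc) measurable
    also have "\<dots> = ennreal ((LINT y|lborel. norm (f y)) * (C * A))" unfolding fn by (rule ennreal_mult'[symmetric]) simp
    also have "\<dots> \<le> ennreal ((C * A + C) * (LINT y|lborel. norm (f y)))"
      using C(1) by (intro ennreal_leI) (simp add: algebra_simps)
    finally show "(\<integral>\<^sup>+x. ennreal (norm (dyadic_block \<theta> k f x)) \<partial>lborel) \<le> ennreal ((C * A + C) * (LINT x|lborel. norm (f x)))" .
  qed
qed

section \<open>Dyadic sums and sums of blocks\<close>

text \<open>
  The sum is part of a geometric series that starts at the first index \<open>k\<close> with \<open>2^k \<ge> y\<close>.
\<close>

lemma sum_dyadic_tail:
  fixes s y :: real and F :: "int set"
  assumes s: "s > 0" and y: "y > 0" and F: "finite F" "\<And>k. k \<in> F \<Longrightarrow> y \<le> 2 powi k"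
  shows "(\<Sum>k\<in>F. 2 powr (- s * of_int k)) \<le> y powr (- s) / (1 - 2 powr (- s))"
proof -
  define z where "z = (2::real) powr (- s)"
  have z: "0 < z" "z < 1" using s powr_less_mono[of "-s" 0 2] by (auto simp: z_def)
  define k0 where "k0 = \<lceil>log 2 y\<rceil>"
  have k0: "k0 \<le> k" if "k \<in> F" for k
  proof -
    have "log 2 y \<le> log 2 (2 powi k)" using y F(2)[OF that] by simp
    also have "\<dots> = of_int k" by (simp flip: powr_real_of_int')
    finally show ?thesis by (simp add: k0_def ceiling_le_iff)
  qed
  have e: "2 powr (- s * of_int k) = 2 powr (- s * of_int k0) * z ^ nat (k - k0)" if "k \<in> F" for k
  proof -
    have "z ^ nat (k - k0) = 2 powr (- s * of_int (k - k0))"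
      using k0[OF that] z(1) by (simp add: z_def powr_powr flip: powr_realpow)
    then show ?thesis by (simp add: powr_add[symmetric] algebra_simps)
  qed
  have "(\<Sum>k\<in>F. 2 powr (- s * of_int k)) = 2 powr (- s * of_int k0) * (\<Sum>k\<in>F. z ^ nat (k - k0))"
    unfolding sum_distrib_left by (rule sum.cong[OF refl e])
  also have "(\<Sum>k\<in>F. z ^ nat (k - k0)) = (\<Sum>n\<in>(\<lambda>k. nat (k - k0)) ` F. z ^ n)"
    by (subst sum.reindex) (auto intro!: inj_onI dest!: k0)
  also have "\<dots> \<le> (\<Sum>n. z ^ n)"
    using z F by (intro sum_le_suminf summable_geometric) auto
  also have "\<dots> = 1 / (1 - z)" using z by (intro suminf_geometric) auto
  also have "2 powr (- s * of_int k0) * (1 / (1 - z)) \<le> y powr (- s) * (1 / (1 - z))"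
  proof (rule mult_right_mono)
    have "2 powr (- s * of_int k0) \<le> 2 powr (- s * log 2 y)"
      using s by (intro powr_mono) (auto simp: k0_def)
    also have "\<dots> = y powr (- s)" using y by (simp add: powr_def log_def)
    finally show "2 powr (- s * of_int k0) \<le> y powr (- s)" .
  qed (use z in auto)
  finally show ?thesis using z by (simp add: z_def)
qed

lemma sum_dyadic_head:
  fixes s y :: real and F :: "int set"
  assumes s: "s > 0" and y: "y > 0" and F: "finite F" "\<And>k. k \<in> F \<Longrightarrow> 2 powi k \<le> y"
  shows "(\<Sum>k\<in>F. 2 powr (s * of_int k)) \<le> y powr s / (1 - 2 powr (- s))"
proof -
  have "(\<Sum>k\<in>F. 2 powr (s * of_int k)) = (\<Sum>k\<in>uminus ` F. 2 powr (- s * of_int k))"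
    by (subst sum.reindex) auto
  also have "\<dots> \<le> (1 / y) powr (- s) / (1 - 2 powr (- s))"
  proof (rule sum_dyadic_tail)
    fix k assume "k \<in> uminus ` F"
    then have "2 powi (- k) \<le> y" using F(2)[of "- k"] by auto
    then show "1 / y \<le> 2 powi k" using y by (simp add: power_int_minus field_simps)
  qed (use s y F in auto)
  also have "(1 / y) powr (- s) = y powr s" using y by (simp add: powr_divide powr_minus_divide)
  finally show ?thesis .
qed

definition block_multiplier :: "(real \<Rightarrow> real) \<Rightarrow> int \<Rightarrow> real^2 \<Rightarrow> real" where
  "block_multiplier \<theta> k \<xi> = \<theta> (2 powi (- k) * norm \<xi>)"

definition multiplier_sum :: "(real \<Rightarrow> real) \<Rightarrow> int set \<Rightarrow> real^2 \<Rightarrow> real" where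
  "multiplier_sum \<theta> A \<xi> = (\<Sum>\<^sub>\<infinity>k\<in>A. block_multiplier \<theta> k \<xi>)"

lemma dyadic_block_eq: "dyadic_block \<theta> k f = inv_fourier (\<lambda>\<xi>. of_real (block_multiplier \<theta> k \<xi>) * fourier f \<xi>)"
  by (simp add: dyadic_block_def fourier_multiplier_def block_multiplier_def)

text \<open>
  Two multipliers that both differ from zero at \<open>\<xi>\<close> have indices differing by at most one, as
  \<open>(8/3) / (3/4) < 4\<close>.
\<close>

lemma block_multiplier_overlap:
  assumes \<theta>: "dyadic_partition \<theta>"
  shows "finite {k. block_multiplier \<theta> k \<xi> \<noteq> 0}" and "card {k. block_multiplier \<theta> k \<xi> \<noteq> 0} \<le> 3"
proof -
  let ?S = "{k. block_multiplier \<theta> k \<xi> \<noteq> 0}"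
  have le: "l \<le> k + 1" if "k \<in> ?S" "l \<in> ?S" for k l
  proof (rule ccontr)
    assume "\<not> l \<le> k + 1"
    then have "(2::real) powi (k + 2) \<le> 2 powi l" by (intro power_int_increasing) auto
    then have "3/4 * (4 * 2 powi k) \<le> 3/4 * (2::real) powi l" by (simp add: power_int_add)
    moreover have "3/4 * 2 powi l < norm \<xi>" "norm \<xi> < 8/3 * 2 powi k"
      using that dyadic_multiplier_props(2)[OF \<theta>] by (auto simp: block_multiplier_def)
    moreover have "(2::real) powi k > 0" by simp
    ultimately show False by linarith
  qed
  have "\<exists>k. ?S \<subseteq> {k - 1..k + 1}"
  proof (cases "?S = {}")
    case False
    then obtain k where k: "k \<in> ?S" by blast
    then have "l \<in> {k - 1..k + 1}" if "l \<in> ?S" for l using le[OF k that] le[OF that k] by auto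
    then show ?thesis by blast
  qed auto
  then obtain k where k: "?S \<subseteq> {k - 1..k + 1}" ..
  then show "finite ?S" by (rule finite_subset) simp
  have "card ?S \<le> card {k - 1..k + 1}" using k by (intro card_mono) auto
  then show "card ?S \<le> 3" by simp
qed

lemma block_multiplier_measurable:
  assumes "dyadic_partition \<theta>"
  shows "block_multiplier \<theta> k \<in> borel_measurable borel"
proof -
  note [measurable] = dyadic_multiplier_props(1)[OF assms]
  show ?thesis unfolding block_multiplier_def by measurable
qed

lemma sum_block_multiplier_bound:
  assumes \<theta>: "dyadic_partition \<theta>"
  obtains T where "T > 0" "\<And>G \<xi>. finite G \<Longrightarrow> (\<Sum>k\<in>G. \<bar>block_multiplier \<theta> k \<xi>\<bar>) \<le> T"
proof -
  obtain T where T: "T > 0" "\<And>r. \<bar>\<theta> r\<bar> \<le> T" using dyadic_partition_bounded[OF \<theta>] by blast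
  have "(\<Sum>k\<in>G. \<bar>block_multiplier \<theta> k \<xi>\<bar>) \<le> 3 * T" if "finite G" for G \<xi>
  proof -
    let ?S = "{k. block_multiplier \<theta> k \<xi> \<noteq> 0}"
    have "(\<Sum>k\<in>G. \<bar>block_multiplier \<theta> k \<xi>\<bar>) = (\<Sum>k\<in>G \<inter> ?S. \<bar>block_multiplier \<theta> k \<xi>\<bar>)"
      using that by (intro sum.mono_neutral_right) auto
    also have "\<dots> \<le> of_nat (card (G \<inter> ?S)) * T"
      by (rule sum_bounded_above) (simp add: block_multiplier_def T)
    also have "card (G \<inter> ?S) \<le> card ?S" using block_multiplier_overlap(1)[OF \<theta>] by (intro card_mono) auto
    then have "of_nat (card (G \<inter> ?S)) * T \<le> 3 * T"
      using block_multiplier_overlap(2)[OF \<theta>, of \<xi>] T by (intro mult_right_mono) auto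
    finally show ?thesis .
  qed
  with T(1) show ?thesis using that[of "3 * T"] by simp
qed

lemma multiplier_sum_finite:
  assumes \<theta>: "dyadic_partition \<theta>" and G: "finite G" "G \<subseteq> A" 
    and out: "\<And>k. k \<in> A - G \<Longrightarrow> block_multiplier \<theta> k \<xi> = 0"
  shows "multiplier_sum \<theta> A \<xi> = (\<Sum>k\<in>G. block_multiplier \<theta> k \<xi>)"
proof -
  have "multiplier_sum \<theta> A \<xi> = (\<Sum>\<^sub>\<infinity>k\<in>G. block_multiplier \<theta> k \<xi>)"
    unfolding multiplier_sum_def using G out by (intro infsum_cong_neutral) auto
  then show ?thesis using G by simp
qed

text \<open>
  An exhaustion of \<open>A\<close> by finite sets, so that sequential limit theorems apply to unordered sums over \<open>A\<close>.
\<close>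

definition window :: "int set \<Rightarrow> nat \<Rightarrow> int set" where
  "window A n = A \<inter> {- int n..int n}"

lemma finite_window [simp]: "finite (window A n)"
  by (simp add: window_def)

lemma filterlim_window: "filterlim (window A) (finite_subsets_at_top A) sequentially"
  unfolding filterlim_finite_subsets_at_top
proof (intro allI impI)
  fix X assume X: "finite X \<and> X \<subseteq> A"
  obtain N where N: "\<And>k. k \<in> X \<Longrightarrow> \<bar>k\<bar> \<le> int N"
  proof -
    have "\<bar>k\<bar> \<le> int (nat (Max (insert 0 (abs ` X))))" if "k \<in> X" for k
    proof -
      have "\<bar>k\<bar> \<le> Max (insert 0 (abs ` X))" using X that by (intro Max_ge) auto
      moreover from this have "0 \<le> Max (insert 0 (abs ` X))" using abs_ge_zero[of k] by linarith
      ultimately show ?thesis by simp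
    qed
    then show ?thesis by (rule that)
  qed
  show "\<forall>\<^sub>F n in sequentially. finite (window A n) \<and> X \<subseteq> window A n \<and> window A n \<subseteq> A"
    using eventually_ge_at_top[of N]
  proof eventually_elim
    case (elim n)
    have "k \<in> window A n" if "k \<in> X" for k
    proof -
      have "\<bar>k\<bar> \<le> int n" using N[OF that] elim by linarith
      then show ?thesis using X that by (auto simp: window_def abs_le_iff)
    qed
    then show ?case by (auto simp: window_def)
  qed
qed

lemma multiplier_sum_eventually:
  assumes \<theta>: "dyadic_partition \<theta>"
  shows "\<forall>\<^sub>F n in sequentially. (\<Sum>k\<in>window A n. block_multiplier \<theta> k \<xi>) = multiplier_sum \<theta> A \<xi>"
proof -
  let ?X = "A \<inter> {k. block_multiplier \<theta> k \<xi> \<noteq> 0}"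
  have "finite ?X" using block_multiplier_overlap(1)[OF \<theta>] by blast
  then have "\<forall>\<^sub>F n in sequentially. ?X \<subseteq> window A n"
    using filterlim_window[of A] unfolding filterlim_finite_subsets_at_top
    by (auto elim!: allE[of _ ?X] eventually_mono)
  then show ?thesis
    by eventually_elim (intro multiplier_sum_finite[OF \<theta>, symmetric], auto simp: window_def)
qed

lemma multiplier_sum_measurable:
  assumes \<theta>: "dyadic_partition \<theta>"
  shows "multiplier_sum \<theta> A \<in> borel_measurable borel"
proof (rule borel_measurable_LIMSEQ_real)
  note block_multiplier_measurable[OF \<theta>, measurable]
  show "(\<lambda>\<xi>. \<Sum>k\<in>window A n. block_multiplier \<theta> k \<xi>) \<in> borel_measurable borel" for n
    by measurable
  show "(\<lambda>n. \<Sum>k\<in>window A n. block_multiplier \<theta> k \<xi>) \<longlonglongrightarrow> multiplier_sum \<theta> A \<xi>" for \<xi>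
    by (rule tendsto_eventually[OF multiplier_sum_eventually[OF \<theta>]])
qed

lemma multiplier_sum_nonzero:
  assumes "multiplier_sum \<theta> A \<xi> \<noteq> 0"
  obtains k where "k \<in> A" "block_multiplier \<theta> k \<xi> \<noteq> 0"
  using assms infsum_0[of A "\<lambda>k. block_multiplier \<theta> k \<xi>"] unfolding multiplier_sum_def by blast

lemma multiplier_sum_bound:
  assumes \<theta>: "dyadic_partition \<theta>"
    and T: "\<And>G \<xi>. finite G \<Longrightarrow> (\<Sum>k\<in>G. \<bar>block_multiplier \<theta> k \<xi>\<bar>) \<le> T"
  shows "\<bar>multiplier_sum \<theta> A \<xi>\<bar> \<le> T"
proof -
  obtain n where "(\<Sum>k\<in>window A n. block_multiplier \<theta> k \<xi>) = multiplier_sum \<theta> A \<xi>"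
    using eventually_happens[OF multiplier_sum_eventually[OF \<theta>]] by auto
  then have "\<bar>multiplier_sum \<theta> A \<xi>\<bar> \<le> (\<Sum>k\<in>window A n. \<bar>block_multiplier \<theta> k \<xi>\<bar>)"
    using sum_abs by metis
  also have "\<dots> \<le> T" by (rule T) simp
  finally show ?thesis .
qed

lemma multiplier_sum_UNIV:
  assumes \<theta>: "dyadic_partition \<theta>" and "\<xi> \<noteq> 0"
  shows "multiplier_sum \<theta> UNIV \<xi> = 1"
  using assms unfolding multiplier_sum_def block_multiplier_def dyadic_partition_def
  by (intro infsumI) auto

text \<open>
  Locally the sum over \<open>k \<ge> 0\<close> is finite. Near \<open>\<xi> = 0\<close> this would fail if all negative \<open>k\<close> were
  included.
\<close>

lemma isCont_multiplier_sum_high: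
  assumes \<theta>: "dyadic_partition \<theta>"
  shows "isCont (multiplier_sum \<theta> {0..}) \<xi>"
proof -
  obtain n where n: "norm \<xi> + 1 < 2 ^ n" using real_arch_pow[of 2] by auto
  have eq: "multiplier_sum \<theta> {0..} \<zeta> = (\<Sum>k\<in>{0..int n + 1}. block_multiplier \<theta> k \<zeta>)" if "\<zeta> \<in> ball \<xi> 1" for \<zeta>
  proof (rule multiplier_sum_finite[OF \<theta>])
    fix k assume k: "k \<in> {0..} - {0..int n + 1}"
    show "block_multiplier \<theta> k \<zeta> = 0"
    proof (rule ccontr)
      assume "block_multiplier \<theta> k \<zeta> \<noteq> 0"
      then have "3/4 * 2 powi k < norm \<zeta>"
        using dyadic_multiplier_props(2)[OF \<theta>, of k \<zeta>] by (simp add: block_multiplier_def)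
      also have "norm \<zeta> < norm \<xi> + 1"
        using that norm_triangle_ineq2[of \<zeta> \<xi>] by (simp add: dist_norm norm_minus_commute)
      also have "\<dots> < 2 ^ n" by (rule n)
      finally have "3/4 * 2 powi k < (2::real) ^ n" .
      moreover have "(2::real) powi (int n + 1) \<le> 2 powi k" using k by (intro power_int_increasing) auto
      then have "2 * (2::real) ^ n \<le> 2 powi k" by (simp add: power_int_add)
      moreover have "(2::real) ^ n > 0" by simp
      ultimately show False by linarith
    qed
  qed auto
  have c\<theta>: "isCont \<theta> r" for r using dyadic_partition_derivs(3)[OF \<theta>, of _ 0] by simp
  have c: "isCont (\<lambda>\<zeta>. \<Sum>k\<in>{0..int n + 1}. block_multiplier \<theta> k \<zeta>) \<xi>"
    unfolding block_multiplier_def by (intro continuous_intros isCont_o2[OF _ c\<theta>])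
  have ev: "\<forall>\<^sub>F \<zeta> in nhds \<xi>. (\<Sum>k\<in>{0..int n + 1}. block_multiplier \<theta> k \<zeta>) = multiplier_sum \<theta> {0..} \<zeta>"
    using eventually_nhds_in_open[of "ball \<xi> 1" \<xi>] by (auto elim!: eventually_mono simp: eq)
  show ?thesis by (rule isCont_cong[THEN iffD1, OF ev c])
qed

text \<open>
  At each frequency only boundedly many multipliers differ from zero, so the partial sums of the multipliers are
  bounded and eventually constant; dominated convergence passes to the limit under the inverse transform.
  Convergence along the windows then identifies the unordered sum.
\<close>

lemma block_sum_convergence:
  fixes F :: "real^2 \<Rightarrow> complex"
  assumes \<theta>: "dyadic_partition \<theta>" and F: "integrable lborel F"
  defines "b k x \<equiv> inv_fourier (\<lambda>\<xi>. of_real (block_multiplier \<theta> k \<xi>) * F \<xi>) x"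
  shows "(\<lambda>n. \<Sum>k\<in>window A n. b k x) \<longlonglongrightarrow> inv_fourier (\<lambda>\<xi>. of_real (multiplier_sum \<theta> A \<xi>) * F \<xi>) x"
    and "(\<Sum>\<^sub>\<infinity>k\<in>A. b k x) = inv_fourier (\<lambda>\<xi>. of_real (multiplier_sum \<theta> A \<xi>) * F \<xi>) x"
proof -
  note [measurable] = block_multiplier_measurable[OF \<theta>] multiplier_sum_measurable[OF \<theta>]
  have [measurable]: "F \<in> borel_measurable borel" using F by auto
  obtain T where T: "T > 0" "\<And>G \<xi>. finite G \<Longrightarrow> (\<Sum>k\<in>G. \<bar>block_multiplier \<theta> k \<xi>\<bar>) \<le> T"
    using sum_block_multiplier_bound[OF \<theta>] by blast
  have T1: "\<bar>block_multiplier \<theta> k \<xi>\<bar> \<le> T" for k \<xi> using T(2)[of "{k}" \<xi>] by simp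
  have I: "integrable lborel (\<lambda>\<xi>. of_real (block_multiplier \<theta> k \<xi>) * F \<xi>)" for k
    by (rule Bochner_Integration.integrable_bound[of _ "\<lambda>\<xi>. of_real T * F \<xi>"])
       (use F T T1[of k] in \<open>auto simp: norm_mult intro!: mult_right_mono order_trans[OF T1]\<close>)
  then have I': "integrable lborel (\<lambda>\<xi>. cis (x \<bullet> \<xi>) * (of_real (block_multiplier \<theta> k \<xi>) * F \<xi>))" for k
    by (rule Bochner_Integration.integrable_bound) (auto simp: norm_mult)
  show L: "(\<lambda>n. \<Sum>k\<in>window A n. b k x) \<longlonglongrightarrow> inv_fourier (\<lambda>\<xi>. of_real (multiplier_sum \<theta> A \<xi>) * F \<xi>) x"
  proof -
    have "(\<Sum>k\<in>window A n. b k x) = (LINT \<xi>|lborel. cis (x \<bullet> \<xi>) * (of_real (\<Sum>k\<in>window A n. block_multiplier \<theta> k \<xi>) * F \<xi>)) / of_real ((2 * pi)\<^sup>2)" for n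
      unfolding b_def inv_fourier_def sum_divide_distrib[symmetric]
      by (subst Bochner_Integration.integral_sum[symmetric]) (auto intro!: I' simp: sum_distrib_left sum_distrib_right)
    moreover have "(\<lambda>n. (LINT \<xi>|lborel. cis (x \<bullet> \<xi>) * (of_real (\<Sum>k\<in>window A n. block_multiplier \<theta> k \<xi>) * F \<xi>)) / of_real ((2 * pi)\<^sup>2))
      \<longlonglongrightarrow> (LINT \<xi>|lborel. cis (x \<bullet> \<xi>) * (of_real (multiplier_sum \<theta> A \<xi>) * F \<xi>)) / of_real ((2 * pi)\<^sup>2)"
    proof (intro tendsto_divide integral_dominated_convergence[where w = "\<lambda>\<xi>. T * norm (F \<xi>)"] tendsto_const)
      show "integrable lborel (\<lambda>\<xi>. T * norm (F \<xi>))" using F by simp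
      show "AE \<xi> in lborel. (\<lambda>n. cis (x \<bullet> \<xi>) * (complex_of_real (\<Sum>k\<in>window A n. block_multiplier \<theta> k \<xi>) * F \<xi>))
           \<longlonglongrightarrow> cis (x \<bullet> \<xi>) * (complex_of_real (multiplier_sum \<theta> A \<xi>) * F \<xi>)"
        by (intro AE_I2 tendsto_mult tendsto_const tendsto_of_real tendsto_eventually[OF multiplier_sum_eventually[OF \<theta>]])
      show "AE \<xi> in lborel. norm (cis (x \<bullet> \<xi>) * (complex_of_real (\<Sum>k\<in>window A n. block_multiplier \<theta> k \<xi>) * F \<xi>)) \<le> T * norm (F \<xi>)" for n
      proof (rule AE_I2)
        fix \<xi>
        have "\<bar>\<Sum>k\<in>window A n. block_multiplier \<theta> k \<xi>\<bar> \<le> T"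
          by (rule order_trans[OF sum_abs T(2)]) simp
        then show "norm (cis (x \<bullet> \<xi>) * (complex_of_real (\<Sum>k\<in>window A n. block_multiplier \<theta> k \<xi>) * F \<xi>)) \<le> T * norm (F \<xi>)"
          unfolding norm_mult norm_cis norm_of_real mult_1_left by (rule mult_right_mono) simp
      qed
    qed (use pi_gt_zero in auto)
    ultimately show ?thesis unfolding inv_fourier_def by simp
  qed
  have "(\<Sum>k\<in>G. norm (b k x)) \<le> T * (LINT \<xi>|lborel. norm (F \<xi>))" if "finite G" for G
  proof -
    have "(\<Sum>k\<in>G. norm (b k x)) \<le> (\<Sum>k\<in>G. LINT \<xi>|lborel. norm (of_real (block_multiplier \<theta> k \<xi>) * F \<xi>))"
      unfolding b_def by (intro sum_mono norm_inv_fourier_le)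
    also have "\<dots> = (LINT \<xi>|lborel. (\<Sum>k\<in>G. \<bar>block_multiplier \<theta> k \<xi>\<bar>) * norm (F \<xi>))"
      using integrable_norm[OF I]
      by (subst Bochner_Integration.integral_sum[symmetric]) (auto simp: norm_mult sum_distrib_right)
    also have "\<dots> \<le> (LINT \<xi>|lborel. T * norm (F \<xi>))"
    proof (rule integral_mono)
      show "integrable lborel (\<lambda>\<xi>. (\<Sum>k\<in>G. \<bar>block_multiplier \<theta> k \<xi>\<bar>) * norm (F \<xi>))"
        using integrable_norm[OF I] by (auto simp: norm_mult sum_distrib_right)
      show "integrable lborel (\<lambda>\<xi>. T * norm (F \<xi>))" using F by simp
    qed (use T(2)[OF that] in \<open>auto intro!: mult_right_mono\<close>)
    finally show ?thesis by simp
  qed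
  then have "(\<lambda>k. norm (b k x)) summable_on A"
    by (intro nonneg_bdd_above_summable_on bdd_aboveI2) auto
  then have "(\<lambda>k. b k x) summable_on A" by (rule abs_summable_summable)
  then have "((\<lambda>k. b k x) has_sum (\<Sum>\<^sub>\<infinity>k\<in>A. b k x)) A" by (rule has_sum_infsum)
  then have "(\<lambda>n. \<Sum>k\<in>window A n. b k x) \<longlonglongrightarrow> (\<Sum>\<^sub>\<infinity>k\<in>A. b k x)"
    unfolding has_sum_def by (rule filterlim_compose[OF _ filterlim_window])
  then show "(\<Sum>\<^sub>\<infinity>k\<in>A. b k x) = inv_fourier (\<lambda>\<xi>. of_real (multiplier_sum \<theta> A \<xi>) * F \<xi>) x"
    using L by (rule LIMSEQ_unique)
qed

section \<open>Modulated Schwartz functions\<close>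

text \<open>
  The centre \<open>c\<close> does not enter the constants. It will be \<open>e\<^sub>1 / \<epsilon>\<close>, and the bounds have to be uniform in
  \<open>\<epsilon>\<close>.
\<close>

lemma ball_supported_bounds:
  fixes m :: "'a::euclidean_space \<Rightarrow> complex"
  assumes [measurable]: "m \<in> borel_measurable borel" and R: "R \<ge> 0"
    and H: "\<And>\<xi>. norm (m \<xi>) \<le> H" and supp: "\<And>\<xi>. m \<xi> \<noteq> 0 \<Longrightarrow> norm (\<xi> - c) \<le> R"
  defines "V \<equiv> unit_ball_vol (real DIM('a)) * R ^ DIM('a)"
  shows "integrable lborel m" and "(LINT \<xi>|lborel. norm (m \<xi>)) \<le> H * V"
    and "(\<integral>\<^sup>+\<xi>. ennreal ((norm (m \<xi>))\<^sup>2) \<partial>lborel) \<le> ennreal (H\<^sup>2 * V)"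
proof -
  have V0: "V \<ge> 0" using R by (auto simp: V_def unit_ball_vol_nonneg)
  have H0: "H \<ge> 0" using H norm_ge_zero order_trans by blast
  have em: "emeasure lborel (cball c R) = ennreal V" unfolding V_def using R by (rule emeasure_cball)
  show I: "integrable lborel m" by (rule integrable_bounded_cball[OF _ H supp]) measurable
  have ind: "norm (m \<xi>) \<le> H * indicator (cball c R) \<xi>" for \<xi>
    using H[of \<xi>] supp[of \<xi>] by (cases "m \<xi> = 0") (auto simp: indicator_def dist_norm norm_minus_commute H0)
  have "ennreal (LINT \<xi>|lborel. norm (m \<xi>)) = (\<integral>\<^sup>+\<xi>. ennreal (norm (m \<xi>)) \<partial>lborel)"
    using I by (intro nn_integral_eq_integral[symmetric]) auto
  also have "\<dots> \<le> (\<integral>\<^sup>+\<xi>. ennreal H * indicator (cball c R) \<xi> \<partial>lborel)"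
  proof (rule nn_integral_mono)
    fix \<xi>
    have "ennreal (norm (m \<xi>)) \<le> ennreal (H * indicator (cball c R) \<xi>)" by (rule ennreal_leI[OF ind])
    then show "ennreal (norm (m \<xi>)) \<le> ennreal H * indicator (cball c R) \<xi>" by (auto simp: indicator_def split: if_splits)
  qed
  also have "\<dots> = ennreal (H * V)"
    by (subst nn_integral_cmult_indicator) (auto simp: em ennreal_mult' H0)
  finally show "(LINT \<xi>|lborel. norm (m \<xi>)) \<le> H * V" using H0 V0 by (simp add: ennreal_le_iff)
  have "(\<integral>\<^sup>+\<xi>. ennreal ((norm (m \<xi>))\<^sup>2) \<partial>lborel) \<le> (\<integral>\<^sup>+\<xi>. ennreal (H\<^sup>2) * indicator (cball c R) \<xi> \<partial>lborel)"
  proof (rule nn_integral_mono)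
    fix \<xi>
    have "(norm (m \<xi>))\<^sup>2 \<le> (H * indicator (cball c R) \<xi>)\<^sup>2" by (intro power_mono ind) auto
    then have "ennreal ((norm (m \<xi>))\<^sup>2) \<le> ennreal ((H * indicator (cball c R) \<xi>)\<^sup>2)" by (rule ennreal_leI)
    then show "ennreal ((norm (m \<xi>))\<^sup>2) \<le> ennreal (H\<^sup>2) * indicator (cball c R) \<xi>" by (auto simp: indicator_def split: if_splits)
  qed
  also have "\<dots> = ennreal (H\<^sup>2 * V)"
    by (subst nn_integral_cmult_indicator) (auto simp: em ennreal_mult')
  finally show "(\<integral>\<^sup>+\<xi>. ennreal ((norm (m \<xi>))\<^sup>2) \<partial>lborel) \<le> ennreal (H\<^sup>2 * V)" .
qed

text \<open>
  The decay of \<open>f\<close> itself, for the powers \<open>0\<close> and \<open>4\<close>, gives domination by a multiple of \<open>1 / (1 + \<bar>x\<bar>^4)\<close>.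
\<close>

lemma schwartz_continuous_bounded_integrable:
  assumes "schwartz f"
  shows "isCont f x" and "\<exists>B>0. \<forall>x. norm (f x) \<le> B" and "integrable lborel f"
proof -
  have d: "f differentiable (at x)" for x
    using assms unfolding schwartz_def by (metis fold_simps(1))
  then show c: "isCont f x" for x by (rule differentiable_imp_continuous_within)
  have B: "\<exists>B. \<forall>x. norm x ^ n * cmod (f x) \<le> B" for n
    using assms unfolding schwartz_def by (metis fold_simps(1))
  obtain B0 where B0: "\<And>x. norm (f x) \<le> B0" using B[of 0] by auto
  obtain B4 where B4: "\<And>x. norm x ^ 4 * norm (f x) \<le> B4" using B[of 4] by auto
  have "norm (f x) \<le> \<bar>B0\<bar> + 1" for x using B0[of x] by linarith
  then show "\<exists>B>0. \<forall>x. norm (f x) \<le> B" by (intro exI[of _ "\<bar>B0\<bar> + 1"]) auto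
  have [measurable]: "f \<in> borel_measurable borel"
    using c by (auto intro!: borel_measurable_continuous_onI continuous_at_imp_continuous_on)
  show "integrable lborel f"
  proof (rule Bochner_Integration.integrable_bound)
    show "integrable lborel (\<lambda>x::real^2. (B0 + B4) * (1 / (1 + norm x ^ 4)))"
      by (rule integrable_mult_right[OF integrable_decay4])
    show "AE x in lborel. norm (f x) \<le> norm ((B0 + B4) * (1 / (1 + norm x ^ 4)))"
    proof (rule AE_I2)
      fix x :: "real^2"
      have p: "1 + norm x ^ 4 > 0" by (intro add_pos_nonneg) auto
      have "norm (f x) * (1 + norm x ^ 4) \<le> B0 + B4"
        unfolding distrib_left mult_1_right using B0[of x] B4[of x] by (simp add: mult.commute)
      then have "norm (f x) \<le> (B0 + B4) * (1 / (1 + norm x ^ 4))" using p by (simp add: pos_le_divide_eq)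
      then show "norm (f x) \<le> norm ((B0 + B4) * (1 / (1 + norm x ^ 4)))"
        unfolding real_norm_def by (rule order_trans[OF _ abs_ge_self])
    qed
  qed measurable
qed

lemma norm_modulate [simp]: "norm (modulate \<epsilon> f x) = norm (f x)"
  by (simp add: modulate_def norm_mult)

lemma fourier_modulate: "fourier (modulate \<epsilon> f) \<xi> = fourier f (\<xi> - axis 1 (1 / \<epsilon>))"
  unfolding fourier_def modulate_def
  by (simp add: mult.assoc[symmetric] cis_mult inner_diff_right inner_axis)

lemma Lq_norm_zero: "Lq_norm q (\<lambda>x. 0) = 0"
proof -
  have "emeasure lborel (UNIV :: (real^2) set) \<noteq> 0" by simp
  then have "esssup lborel (\<lambda>x::real^2. 0::ennreal) = 0" using esssup_const[of lborel] by simp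
  then show ?thesis by (simp add: Lq_norm_def)
qed

lemma inv_fourier_zero [simp]: "inv_fourier (\<lambda>\<xi>. 0) = (\<lambda>x. 0)"
  by (simp add: inv_fourier_def fun_eq_iff)

locale modulated_wave =
  fixes \<theta> :: "real \<Rightarrow> real" and \<phi> :: "real^2 \<Rightarrow> complex" and R :: real
  assumes \<theta>: "dyadic_partition \<theta>" and schwartz: "schwartz \<phi>" and R: "R > 0"
    and spectrum: "\<And>\<xi>. fourier \<phi> \<xi> \<noteq> 0 \<Longrightarrow> norm \<xi> \<le> R"
begin

definition mass :: real where "mass = (LINT x|lborel. norm (\<phi> x))"

abbreviation block :: "real \<Rightarrow> int \<Rightarrow> real^2 \<Rightarrow> complex" where
  "block \<epsilon> k \<equiv> dyadic_block \<theta> k (modulate \<epsilon> \<phi>)"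

abbreviation spec :: "real \<Rightarrow> real^2 \<Rightarrow> complex" where "spec \<epsilon> \<equiv> fourier (modulate \<epsilon> \<phi>)"

lemma mass_nonneg: "mass \<ge> 0"
  by (simp add: mass_def)

lemma wave_measurable [measurable]: "\<phi> \<in> borel_measurable borel" "modulate \<epsilon> \<phi> \<in> borel_measurable borel"
proof -
  show [measurable]: "\<phi> \<in> borel_measurable borel"
    using borel_measurable_integrable[OF schwartz_continuous_bounded_integrable(3)[OF schwartz]] by simp
  show "modulate \<epsilon> \<phi> \<in> borel_measurable borel" unfolding modulate_def by measurable
qed

lemma wave_integrable: "integrable lborel (modulate \<epsilon> \<phi>)"
  by (rule Bochner_Integration.integrable_bound[OF schwartz_continuous_bounded_integrable(3)[OF schwartz]]) auto

lemma wave_isCont: "isCont (modulate \<epsilon> \<phi>) x"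
proof -
  have "isCont (\<lambda>x::real^2. exp (\<i> * complex_of_real (x $ 1 / \<epsilon>))) x"
    by (cases "\<epsilon> = 0") (auto intro!: continuous_intros)
  then show ?thesis
    unfolding modulate_def cis_conv_exp
    by (intro continuous_mult schwartz_continuous_bounded_integrable(1)[OF schwartz])
qed

lemma spec_bound: "norm (spec \<epsilon> \<xi>) \<le> mass"
  using norm_fourier_le[of "modulate \<epsilon> \<phi>" \<xi>] by (simp add: mass_def)

lemma spec_support: "spec \<epsilon> \<xi> \<noteq> 0 \<Longrightarrow> norm (\<xi> - axis 1 (1 / \<epsilon>)) \<le> R"
  unfolding fourier_modulate by (rule spectrum)

lemma spec_frequency:
  assumes "spec \<epsilon> \<xi> \<noteq> 0" and "\<epsilon> > 0"
  shows "1 / \<epsilon> - R \<le> norm \<xi>" "norm \<xi> \<le> 1 / \<epsilon> + R"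
proof -
  have n: "norm (axis 1 (1 / \<epsilon>) :: real^2) = 1 / \<epsilon>"
    using assms(2) by (simp add: norm_eq_sqrt_inner inner_axis_axis real_sqrt_divide)
  have "norm (axis 1 (1 / \<epsilon>) :: real^2) - norm \<xi> \<le> R"
    using norm_triangle_ineq2[of "axis 1 (1 / \<epsilon>)" \<xi>] spec_support[OF assms(1)] by (simp add: norm_minus_commute)
  moreover have "norm \<xi> - norm (axis 1 (1 / \<epsilon>) :: real^2) \<le> R"
    using norm_triangle_ineq2[of \<xi> "axis 1 (1 / \<epsilon>)"] spec_support[OF assms(1)] by simp
  ultimately show "1 / \<epsilon> - R \<le> norm \<xi>" "norm \<xi> \<le> 1 / \<epsilon> + R" unfolding n by linarith+
qed

lemma spec_integrable: "integrable lborel (spec \<epsilon>)"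
  by (rule integrable_bounded_cball[OF _ spec_bound spec_support]) measurable

lemma spec_isCont: "isCont (spec \<epsilon>) \<xi>"
  by (rule isCont_fourier[OF wave_integrable])

lemma wave_inversion: "inv_fourier (spec \<epsilon>) = modulate \<epsilon> \<phi>"
proof -
  obtain B where "\<And>x. norm (\<phi> x) \<le> B" using schwartz_continuous_bounded_integrable(2)[OF schwartz] by blast
  then show ?thesis
    by (intro fourier_inversion[of _ B] wave_integrable wave_isCont spec_integrable) simp
qed

text \<open>
  The spectrum of \<open>\<phi>\<^sub>\<epsilon>\<close> lies between \<open>1 / \<epsilon> - R\<close> and \<open>1 / \<epsilon> + R\<close> and has to meet the annulus of the block.
\<close>

lemma block_frequency:
  assumes "block \<epsilon> k \<noteq> (\<lambda>x. 0)" and "\<epsilon> > 0"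
  shows "1 / \<epsilon> - R < 8/3 * 2 powi k" "3/4 * 2 powi k < 1 / \<epsilon> + R"
proof -
  have "\<exists>\<xi>. block_multiplier \<theta> k \<xi> \<noteq> 0 \<and> spec \<epsilon> \<xi> \<noteq> 0"
  proof (rule ccontr)
    assume "\<nexists>\<xi>. block_multiplier \<theta> k \<xi> \<noteq> 0 \<and> spec \<epsilon> \<xi> \<noteq> 0"
    then have "(\<lambda>\<xi>. of_real (block_multiplier \<theta> k \<xi>) * spec \<epsilon> \<xi>) = (\<lambda>\<xi>. 0)" by (auto simp: fun_eq_iff)
    then show False using assms(1) by (simp add: dyadic_block_eq)
  qed
  then obtain \<xi> where \<xi>: "block_multiplier \<theta> k \<xi> \<noteq> 0" "spec \<epsilon> \<xi> \<noteq> 0" by blast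
  have "3/4 * 2 powi k < norm \<xi> \<and> norm \<xi> < 8/3 * 2 powi k"
    using \<xi>(1) dyadic_multiplier_props(2)[OF \<theta>] by (simp add: block_multiplier_def)
  then show "1 / \<epsilon> - R < 8/3 * 2 powi k" "3/4 * 2 powi k < 1 / \<epsilon> + R"
    using spec_frequency[OF \<xi>(2) assms(2)] by linarith+
qed

lemma block_measurable [measurable]: "block \<epsilon> k \<in> borel_measurable borel"
proof -
  note [measurable] = block_multiplier_measurable[OF \<theta>]
  show ?thesis unfolding dyadic_block_eq by measurable
qed

text \<open>
  The constant serves all \<open>q\<close>, because \<open>K^(1 - 1/q) K^(1/q) = K\<close> when the same \<open>K\<close> bounds the \<open>L\<^sup>1\<close> and
  \<open>L\<^sup>\<infinity>\<close> norms. The second estimate uses the supremum bound \<open>4^k K\<close> and is better for \<open>k < 0\<close>.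
\<close>

lemma block_Lq_bounds:
  obtains K where "K > 0"
    "\<And>q k \<epsilon>. q > 1 \<Longrightarrow> Lq_norm q (block \<epsilon> k) \<le> ennreal K"
    "\<And>q k \<epsilon>. q > 1 \<Longrightarrow> Lq_norm q (block \<epsilon> k) \<le> ennreal (K * 2 powr (2 * (1 - 1 / enn2real q) * of_int k))"
proof -
  obtain C where C: "C > 0"
    "\<And>k f B x. integrable lborel f \<Longrightarrow> (\<And>x. norm (f x) \<le> B) \<Longrightarrow> norm (dyadic_block \<theta> k f x) \<le> C * B"
    "\<And>k f x. integrable lborel f \<Longrightarrow> norm (dyadic_block \<theta> k f x) \<le> C * (2 powi k)\<^sup>2 * (LINT x|lborel. norm (f x))"
    "\<And>k f. integrable lborel f \<Longrightarrow> (\<integral>\<^sup>+x. ennreal (norm (dyadic_block \<theta> k f x)) \<partial>lborel) \<le> ennreal (C * (LINT x|lborel. norm (f x)))"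
    using dyadic_block_bounds[OF \<theta>] by blast
  obtain B where B: "B > 0" "\<And>x. norm (\<phi> x) \<le> B" using schwartz_continuous_bounded_integrable(2)[OF schwartz] by blast
  define K where "K = C * (B + mass + 1)"
  have K: "K > 0" using C(1) B(1) mass_nonneg by (simp add: K_def add_pos_nonneg)
  have i: "norm (block \<epsilon> k x) \<le> K" for k \<epsilon> x
  proof -
    have "norm (block \<epsilon> k x) \<le> C * B" by (rule C(2)[OF wave_integrable]) (simp add: B)
    also have "\<dots> \<le> K" unfolding K_def using C(1) mass_nonneg by (intro mult_left_mono) auto
    finally show ?thesis .
  qed
  have ii: "norm (block \<epsilon> k x) \<le> K * (2 powi k)\<^sup>2" for k \<epsilon> x
  proof -
    have "norm (block \<epsilon> k x) \<le> C * (2 powi k)\<^sup>2 * mass"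
      using C(3)[OF wave_integrable] by (simp add: mass_def)
    also have "\<dots> \<le> C * (2 powi k)\<^sup>2 * (B + mass + 1)" using C(1) B(1) by (intro mult_left_mono) auto
    finally show ?thesis by (simp add: K_def mult_ac)
  qed
  have iii: "(\<integral>\<^sup>+x. ennreal (norm (block \<epsilon> k x)) \<partial>lborel) \<le> ennreal K" for k \<epsilon>
  proof -
    have "(\<integral>\<^sup>+x. ennreal (norm (block \<epsilon> k x)) \<partial>lborel) \<le> ennreal (C * mass)"
      using C(4)[OF wave_integrable] by (simp add: mass_def)
    also have "\<dots> \<le> ennreal K" unfolding K_def using C(1) B(1) by (intro ennreal_leI mult_left_mono) auto
    finally show ?thesis .
  qed
  show ?thesis
  proof (rule that[OF K])
    fix q :: ennreal and k \<epsilon> assume q: "q > 1"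
    let ?u = "1 / enn2real q"
    have "Lq_norm q (block \<epsilon> k) \<le> ennreal (K powr (1 - ?u) * K powr ?u)"
      by (rule Lq_norm_interpolation[OF _ i K iii K q]) measurable
    then show "Lq_norm q (block \<epsilon> k) \<le> ennreal K"
      using K by (simp flip: powr_add)
    have "Lq_norm q (block \<epsilon> k) \<le> ennreal ((K * (2 powi k)\<^sup>2) powr (1 - ?u) * K powr ?u)"
      by (rule Lq_norm_interpolation[OF _ ii _ iii K q]) (use K in auto)
    also have "(K * (2 powi k)\<^sup>2) powr (1 - ?u) = K powr (1 - ?u) * 2 powr (2 * (1 - ?u) * of_int k)"
    proof -
      have "(2 powi k)\<^sup>2 = (2::real) powr (2 * of_int k)"
        by (simp add: power2_eq_square flip: powr_real_of_int' powr_add)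
      then show ?thesis using K by (simp add: powr_mult powr_powr mult_ac)
    qed
    also have "\<dots> * K powr ?u = (K powr (1 - ?u) * K powr ?u) * 2 powr (2 * (1 - ?u) * of_int k)" by (simp add: mult_ac)
    also have "K powr (1 - ?u) * K powr ?u = K" using K by (simp flip: powr_add)
    finally show "Lq_norm q (block \<epsilon> k) \<le> ennreal (K * 2 powr (2 * (1 - ?u) * of_int k))" .
  qed
qed

end

section \<open>Upper bounds\<close>

lemma infsum_ennreal_le:
  fixes f :: "'a \<Rightarrow> ennreal"
  assumes "\<And>F. finite F \<Longrightarrow> F \<subseteq> A \<Longrightarrow> (\<Sum>x\<in>F. f x) \<le> c"
  shows "(\<Sum>\<^sub>\<infinity>x\<in>A. f x) \<le> c"
  using assms by (intro infsum_le_finite_sums nonneg_summable_on_complete) auto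

context modulated_wave
begin

text \<open>
  A nonzero block with \<open>k \<ge> 0\<close> satisfies \<open>1 / \<epsilon> < (8/3) 2^k + R \<le> (8/3 + R) 2^k\<close>. So only indices with \<open>2^k \<ge> c / \<epsilon>\<close>
  count, whatever the size of \<open>\<epsilon>\<close>, and a geometric tail of order \<open>\<epsilon>^\<sigma>\<close> remains.
\<close>

lemma high_block_sum:
  assumes \<sigma>: "\<sigma> > 0"
  obtains C where "C > 0" "\<And>\<epsilon> q F. \<epsilon> > 0 \<Longrightarrow> q > 1 \<Longrightarrow> finite F \<Longrightarrow> F \<subseteq> {0..} \<Longrightarrow>
     (\<Sum>k\<in>F. ennreal (2 powr (- \<sigma> * of_int k)) * Lq_norm q (block \<epsilon> k)) \<le> ennreal (C * \<epsilon> powr \<sigma>)"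
proof -
  obtain K where K: "K > 0" "\<And>q k \<epsilon>. q > 1 \<Longrightarrow> Lq_norm q (block \<epsilon> k) \<le> ennreal K"
    using block_Lq_bounds by metis
  define z where "z = 1 - (2::real) powr (- \<sigma>)"
  have z: "z > 0" using \<sigma> powr_less_mono[of "-\<sigma>" 0 2] by (simp add: z_def)
  define c where "c = 1 / (8/3 + R)"
  have c: "c > 0" using R by (simp add: c_def add_pos_pos)
  define C where "C = K * (c powr (- \<sigma>) / z)"
  have C: "C > 0" using K c z by (simp add: C_def)
  show ?thesis
  proof (rule that[OF C])
    fix \<epsilon> :: real and q :: ennreal and F :: "int set"
    assume \<epsilon>: "\<epsilon> > 0" and q: "q > 1" and F: "finite F" "F \<subseteq> {0..}"
    define F' where "F' = {k\<in>F. block \<epsilon> k \<noteq> (\<lambda>x. 0)}"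
    have F': "finite F'" "F' \<subseteq> F" using F by (auto simp: F'_def)
    have low: "c / \<epsilon> \<le> 2 powi k" if "k \<in> F'" for k
    proof -
      have "1 / \<epsilon> - R < 8/3 * 2 powi k" using that \<epsilon> by (intro block_frequency) (auto simp: F'_def)
      moreover have "(1::real) \<le> 2 powi k" 
        using that F' F power_int_increasing[of 0 k "2::real"] by auto
      then have "R * 1 \<le> R * 2 powi k" using R by (intro mult_left_mono) auto
      ultimately have "1 / \<epsilon> \<le> (8/3 + R) * 2 powi k" unfolding distrib_right mult_1_right by linarith
      moreover have "8/3 + R > 0" using R by (intro add_pos_pos) auto
      ultimately have "1 / \<epsilon> / (8/3 + R) \<le> 2 powi k" by (subst pos_divide_le_eq) (simp_all only: mult.commute)
      then show ?thesis by (simp add: c_def mult.commute)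
    qed
    have "(\<Sum>k\<in>F. ennreal (2 powr (- \<sigma> * of_int k)) * Lq_norm q (block \<epsilon> k))
      = (\<Sum>k\<in>F'. ennreal (2 powr (- \<sigma> * of_int k)) * Lq_norm q (block \<epsilon> k))"
      using F by (intro sum.mono_neutral_right) (auto simp: F'_def Lq_norm_zero)
    also have "\<dots> \<le> (\<Sum>k\<in>F'. ennreal (2 powr (- \<sigma> * of_int k)) * ennreal K)"
      by (intro sum_mono mult_left_mono K(2) q) auto
    also have "\<dots> = ennreal ((\<Sum>k\<in>F'. 2 powr (- \<sigma> * of_int k)) * K)"
      using K(1) by (simp add: sum_distrib_right[symmetric] sum_nonneg ennreal_mult)
    also have "\<dots> \<le> ennreal ((c / \<epsilon>) powr (- \<sigma>) / z * K)"
      unfolding z_def using K(1) c \<epsilon> by (intro ennreal_leI mult_right_mono sum_dyadic_tail \<sigma> F' low) auto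
    also have "(c / \<epsilon>) powr (- \<sigma>) / z * K = C * \<epsilon> powr \<sigma>"
      using c \<epsilon> by (simp add: C_def powr_divide powr_minus field_simps)
    finally show "(\<Sum>k\<in>F. ennreal (2 powr (- \<sigma> * of_int k)) * Lq_norm q (block \<epsilon> k)) \<le> ennreal (C * \<epsilon> powr \<sigma>)" .
  qed
qed

text \<open>
  Data needed to apply \<open>ball_supported_bounds\<close> to partial Littlewood-Paley sums of \<open>\<phi>\<^sub>\<epsilon>\<close>.
\<close>

lemma multiplier_spec_props:
  assumes T: "\<And>G \<xi>. finite G \<Longrightarrow> (\<Sum>k\<in>G. \<bar>block_multiplier \<theta> k \<xi>\<bar>) \<le> T"
  shows "(\<lambda>\<xi>. complex_of_real (multiplier_sum \<theta> A \<xi>) * spec \<epsilon> \<xi>) \<in> borel_measurable borel"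
    and "norm (complex_of_real (multiplier_sum \<theta> A \<xi>) * spec \<epsilon> \<xi>) \<le> T * mass"
    and "complex_of_real (multiplier_sum \<theta> A \<xi>) * spec \<epsilon> \<xi> \<noteq> 0 \<Longrightarrow> norm (\<xi> - axis 1 (1 / \<epsilon>)) \<le> R"
proof -
  note [measurable] = multiplier_sum_measurable[OF \<theta>]
  show "(\<lambda>\<xi>. complex_of_real (multiplier_sum \<theta> A \<xi>) * spec \<epsilon> \<xi>) \<in> borel_measurable borel" by measurable
  have "T \<ge> 0" using T[of "{}"] by simp
  then show "norm (complex_of_real (multiplier_sum \<theta> A \<xi>) * spec \<epsilon> \<xi>) \<le> T * mass"
    unfolding norm_mult norm_of_real by (intro mult_mono multiplier_sum_bound[OF \<theta> T] spec_bound) auto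
qed (use spec_support in auto)

text \<open>
  Frequencies below \<open>4/3\<close> occur only if \<open>1 / \<epsilon> < R + 4/3\<close>. Then \<open>((R + 4/3) \<epsilon>)^\<sigma> \<ge> 1\<close>, and a bound of the
  \<open>L\<^sup>2\<close> norm that is uniform in \<open>\<epsilon>\<close> suffices; Plancherel supplies it.
\<close>

lemma low_freq_bound:
  assumes \<sigma>: "\<sigma> > 0"
  obtains C where "C > 0" "\<And>\<epsilon>. \<epsilon> > 0 \<Longrightarrow> Lq_norm 2 (low_freq \<theta> 0 (modulate \<epsilon> \<phi>)) \<le> ennreal (C * \<epsilon> powr \<sigma>)"
proof -
  obtain T where T: "T > 0" "\<And>G \<xi>. finite G \<Longrightarrow> (\<Sum>k\<in>G. \<bar>block_multiplier \<theta> k \<xi>\<bar>) \<le> T"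
    using sum_block_multiplier_bound[OF \<theta>] by blast
  define V where "V = unit_ball_vol (real DIM(real^2)) * R ^ DIM(real^2)"
  have V: "V \<ge> 0" using R by (auto simp: V_def)
  define H where "H = sqrt ((T * mass)\<^sup>2 * V)"
  have H: "H \<ge> 0" using V by (simp add: H_def)
  define C where "C = (H + 1) * (R + 4/3) powr \<sigma>"
  have C: "C > 0" using H R by (auto simp: C_def intro!: mult_pos_pos add_nonneg_pos)
  have "Lq_norm 2 (low_freq \<theta> 0 (modulate \<epsilon> \<phi>)) \<le> ennreal (C * \<epsilon> powr \<sigma>)" if \<epsilon>: "\<epsilon> > 0" for \<epsilon>
  proof -
    let ?m = "\<lambda>\<xi>. complex_of_real (multiplier_sum \<theta> {..-1} \<xi>) * spec \<epsilon> \<xi>"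
    have low: "low_freq \<theta> 0 (modulate \<epsilon> \<phi>) = inv_fourier ?m"
      unfolding low_freq_def fun_eq_iff dyadic_block_eq
      using block_sum_convergence(2)[OF \<theta> spec_integrable, where A = "{..-1}"] by simp
    note m = multiplier_spec_props[OF T(2)]
    note b = ball_supported_bounds[OF m(1) less_imp_le[OF R] m(2) m(3)]
    show ?thesis
    proof (cases "1 / \<epsilon> < R + 4/3")
      case True
      have "(\<integral>\<^sup>+x. ennreal ((cmod (inv_fourier ?m x))\<^sup>2) \<partial>lborel) \<le> ennreal ((T * mass)\<^sup>2 * V)"
        unfolding V_def by (rule order_trans[OF inv_fourier_L2_le[OF b(1)] b(3)])
      then have "Lq_norm 2 (low_freq \<theta> 0 (modulate \<epsilon> \<phi>)) \<le> ennreal H"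
        unfolding low H_def using V by (intro Lq_norm_2_le) auto
      also have "H \<le> C * \<epsilon> powr \<sigma>"
      proof -
        have "1 \<le> (R + 4/3) * \<epsilon>" using True \<epsilon> by (simp only: pos_divide_less_eq less_imp_le)
        then have "1 \<le> ((R + 4/3) * \<epsilon>) powr \<sigma>" using \<sigma> by (intro ge_one_powr_ge_zero) auto
        then have "H * 1 \<le> (H + 1) * ((R + 4/3) * \<epsilon>) powr \<sigma>" using H by (intro mult_mono) auto
        then show ?thesis using R \<epsilon> by (simp add: C_def powr_mult mult.assoc)
      qed
      then have "ennreal H \<le> ennreal (C * \<epsilon> powr \<sigma>)" by (rule ennreal_leI)
      finally show ?thesis .
    next
      case False
      have "?m \<xi> = 0" for \<xi>
      proof (rule ccontr)
        assume "?m \<xi> \<noteq> 0"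
        then have ne: "multiplier_sum \<theta> {..-1} \<xi> \<noteq> 0" "spec \<epsilon> \<xi> \<noteq> 0" by auto
        obtain k where k: "k \<in> {..-1}" "block_multiplier \<theta> k \<xi> \<noteq> 0" by (rule multiplier_sum_nonzero[OF ne(1)])
        have "norm \<xi> < 8/3 * 2 powi k"
          using dyadic_multiplier_props(2)[OF \<theta> k(2)[unfolded block_multiplier_def]] by blast
        moreover have "(2::real) powi k \<le> 2 powi (-1)" using k by (intro power_int_increasing) auto
        then have "(2::real) powi k \<le> 1/2" by (simp add: power_int_minus)
        ultimately show False using spec_frequency(1)[OF ne(2) \<epsilon>] False by linarith
      qed
      then have "?m = (\<lambda>\<xi>. 0)" ..
      then show ?thesis unfolding low by (simp add: Lq_norm_zero)
    qed
  qed
  then show ?thesis using that[OF C] by blast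
qed

lemma tilde_besov_upper_bound:
  assumes \<sigma>: "\<sigma> > 0"
  shows "\<exists>C>0. \<forall>\<epsilon>>0. \<forall>q>1. tilde_besov_norm \<theta> (- \<sigma>) q (modulate \<epsilon> \<phi>) \<le> ennreal (C * \<epsilon> powr \<sigma>)"
proof -
  obtain C1 where C1: "C1 > 0" "\<And>\<epsilon>. \<epsilon> > 0 \<Longrightarrow> Lq_norm 2 (low_freq \<theta> 0 (modulate \<epsilon> \<phi>)) \<le> ennreal (C1 * \<epsilon> powr \<sigma>)"
    using low_freq_bound[OF \<sigma>] by blast
  obtain C2 where C2: "C2 > 0" "\<And>\<epsilon> q F. \<epsilon> > 0 \<Longrightarrow> q > 1 \<Longrightarrow> finite F \<Longrightarrow> F \<subseteq> {0..} \<Longrightarrow>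
     (\<Sum>k\<in>F. ennreal (2 powr (- \<sigma> * of_int k)) * Lq_norm q (block \<epsilon> k)) \<le> ennreal (C2 * \<epsilon> powr \<sigma>)"
    using high_block_sum[OF \<sigma>] by blast
  show ?thesis
  proof (intro exI[of _ "C1 + C2"] conjI allI impI)
    fix \<epsilon> :: real and q :: ennreal assume \<epsilon>: "\<epsilon> > 0" and q: "q > 1"
    have "tilde_besov_norm \<theta> (- \<sigma>) q (modulate \<epsilon> \<phi>) \<le> ennreal (C1 * \<epsilon> powr \<sigma>) + ennreal (C2 * \<epsilon> powr \<sigma>)"
      unfolding tilde_besov_norm_def by (intro add_mono C1 infsum_ennreal_le C2 \<epsilon> q)
    also have "\<dots> = ennreal ((C1 + C2) * \<epsilon> powr \<sigma>)"
      using C1(1) C2(1) by (simp add: distrib_right)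
    finally show "tilde_besov_norm \<theta> (- \<sigma>) q (modulate \<epsilon> \<phi>) \<le> ennreal ((C1 + C2) * \<epsilon> powr \<sigma>)" .
  qed (use C1 C2 in auto)
qed

text \<open>
  As for the low frequency part, there is a contribution only for \<open>\<epsilon>\<close> bounded below. The blocks decay like
  \<open>2^(2 (1 - 1/q) k)\<close> as \<open>k \<rightarrow> -\<infinity>\<close>, which beats the weight \<open>2^(- s k)\<close>.
\<close>

lemma low_block_sum:
  assumes q: "q > 1" and s: "0 < s" "s < 2 * (1 - 1 / enn2real q)"
  obtains C where "C > 0" "\<And>\<epsilon> F. \<epsilon> > 0 \<Longrightarrow> finite F \<Longrightarrow> F \<subseteq> {..-1} \<Longrightarrow>
     (\<Sum>k\<in>F. ennreal (2 powr (- s * of_int k)) * Lq_norm q (block \<epsilon> k)) \<le> ennreal (C * \<epsilon> powr s)"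
proof -
  obtain K where K: "K > 0" 
    "\<And>q k \<epsilon>. q > 1 \<Longrightarrow> Lq_norm q (block \<epsilon> k) \<le> ennreal (K * 2 powr (2 * (1 - 1 / enn2real q) * of_int k))"
    using block_Lq_bounds by metis
  \<comment> \<open>The exponent that is left after the weight has been absorbed; it is positive by the assumption on \<open>s\<close>.\<close>
  define d where "d = 2 * (1 - 1 / enn2real q) - s"
  have d: "d > 0" using s by (simp add: d_def)
  define z where "z = 1 - (2::real) powr (- d)"
  have z: "z > 0" using d powr_less_mono[of "-d" 0 2] by (simp add: z_def)
  define C where "C = K / z * (R + 4/3) powr s"
  have C: "C > 0" using K z R by (auto simp: C_def intro!: mult_pos_pos)
  show ?thesis
  proof (rule that[OF C])
    fix \<epsilon> :: real and F :: "int set"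
    assume \<epsilon>: "\<epsilon> > 0" and F: "finite F" "F \<subseteq> {..-1}"
    have half: "(2::real) powi k \<le> 1/2" if "k \<in> F" for k
    proof -
      have "(2::real) powi k \<le> 2 powi (-1)" using that F by (intro power_int_increasing) auto
      then show ?thesis by (simp add: power_int_minus)
    qed
    show "(\<Sum>k\<in>F. ennreal (2 powr (- s * of_int k)) * Lq_norm q (block \<epsilon> k)) \<le> ennreal (C * \<epsilon> powr s)"
    proof (cases "1 / \<epsilon> < R + 4/3")
      case True
      have "(\<Sum>k\<in>F. ennreal (2 powr (- s * of_int k)) * Lq_norm q (block \<epsilon> k))
        \<le> (\<Sum>k\<in>F. ennreal (K * 2 powr (d * of_int k)))"
      proof (rule sum_mono)
        fix k
        have "ennreal (2 powr (- s * of_int k)) * Lq_norm q (block \<epsilon> k) \<le>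
           ennreal (2 powr (- s * of_int k)) * ennreal (K * 2 powr (2 * (1 - 1 / enn2real q) * of_int k))"
          by (intro mult_left_mono K(2) q) auto
        also have "\<dots> = ennreal (2 powr (- s * of_int k) * (K * 2 powr (2 * (1 - 1 / enn2real q) * of_int k)))"
          using K(1) by (intro ennreal_mult[symmetric]) auto
        also have "2 powr (- s * of_int k) * (K * 2 powr (2 * (1 - 1 / enn2real q) * of_int k)) = K * 2 powr (d * of_int k)"
          unfolding d_def left_diff_distrib[of _ s] by (simp add: powr_diff powr_minus divide_inverse mult_ac)
        finally show "ennreal (2 powr (- s * of_int k)) * Lq_norm q (block \<epsilon> k) \<le> ennreal (K * 2 powr (d * of_int k))" .
      qed
      also have "\<dots> = ennreal (K * (\<Sum>k\<in>F. 2 powr (d * of_int k)))"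
        using K(1) by (simp add: sum_distrib_left)
      also have "\<dots> \<le> ennreal (K * (1 powr d / z))"
        unfolding z_def using K(1) 
        by (intro ennreal_leI mult_left_mono sum_dyadic_head d F(1)) (auto intro: order_trans[OF half])
      also have "\<dots> \<le> ennreal (C * \<epsilon> powr s)"
      proof (rule ennreal_leI)
        have "1 \<le> (R + 4/3) * \<epsilon>" using True \<epsilon> by (simp only: pos_divide_less_eq less_imp_le)
        then have "1 \<le> ((R + 4/3) * \<epsilon>) powr s" using s by (intro ge_one_powr_ge_zero) auto
        then have "K / z * 1 \<le> K / z * ((R + 4/3) * \<epsilon>) powr s" using K z by (intro mult_left_mono) auto
        then show "K * (1 powr d / z) \<le> C * \<epsilon> powr s" using R \<epsilon> by (simp add: C_def powr_mult mult.assoc)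
      qed
      finally show ?thesis .
    next
      case False
      have "block \<epsilon> k = (\<lambda>x. 0)" if "k \<in> F" for k
      proof (rule ccontr)
        assume "block \<epsilon> k \<noteq> (\<lambda>x. 0)"
        from block_frequency(1)[OF this \<epsilon>] show False using half[OF that] False by linarith
      qed
      then show ?thesis by (simp add: Lq_norm_zero)
    qed
  qed
qed

lemma besov_1_upper_bound:
  assumes q: "q > 1" and \<alpha>: "\<alpha> > 0" "ennreal \<alpha> < 2 * (1 - 1 / q)"
  shows "\<exists>C>0. \<forall>\<epsilon>>0. besov_1_norm \<theta> (- \<alpha>) q (modulate \<epsilon> \<phi>) \<le> ennreal (C * \<epsilon> powr \<alpha>)"
proof -
  have "\<alpha> < 2 * (1 - 1 / enn2real q)"
  proof (cases "q = \<infinity>")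
    case True
    then have "ennreal \<alpha> < ennreal 2" using \<alpha>(2) by simp
    then show ?thesis using True \<alpha>(1) by (simp add: ennreal_less_iff)
  next
    case False
    define p where "p = enn2real q"
    have p: "p > 1" unfolding p_def using q False by (rule enn2real_gt_1)
    have qp: "q = ennreal p" using False by (simp add: p_def less_top)
    have a: "1 - 1 / q = ennreal (1 - 1 / p)"
      unfolding qp using p by (simp add: ennreal_1[symmetric] divide_ennreal ennreal_minus del: ennreal_1)
    have "2 * (1 - 1 / q) = ennreal (2 * (1 - 1 / p))"
      unfolding a by (subst ennreal_mult') auto
    then show ?thesis using \<alpha> by (simp add: ennreal_less_iff p_def)
  qed
  then obtain C1 where C1: "C1 > 0" "\<And>\<epsilon> F. \<epsilon> > 0 \<Longrightarrow> finite F \<Longrightarrow> F \<subseteq> {..-1} \<Longrightarrow>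
     (\<Sum>k\<in>F. ennreal (2 powr (- \<alpha> * of_int k)) * Lq_norm q (block \<epsilon> k)) \<le> ennreal (C1 * \<epsilon> powr \<alpha>)"
    using low_block_sum[OF q \<alpha>(1)] by blast
  obtain C2 where C2: "C2 > 0" "\<And>\<epsilon> q F. \<epsilon> > 0 \<Longrightarrow> q > 1 \<Longrightarrow> finite F \<Longrightarrow> F \<subseteq> {0..} \<Longrightarrow>
     (\<Sum>k\<in>F. ennreal (2 powr (- \<alpha> * of_int k)) * Lq_norm q (block \<epsilon> k)) \<le> ennreal (C2 * \<epsilon> powr \<alpha>)"
    using high_block_sum[OF \<alpha>(1)] by blast
  show ?thesis
  proof (intro exI[of _ "C1 + C2"] conjI allI impI)
    fix \<epsilon> :: real assume \<epsilon>: "\<epsilon> > 0"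
    let ?f = "\<lambda>k. ennreal (2 powr (- \<alpha> * of_int k)) * Lq_norm q (block \<epsilon> k)"
    have "besov_1_norm \<theta> (- \<alpha>) q (modulate \<epsilon> \<phi>) \<le> ennreal (C1 * \<epsilon> powr \<alpha>) + ennreal (C2 * \<epsilon> powr \<alpha>)"
      unfolding besov_1_norm_def
    proof (rule infsum_ennreal_le)
      fix F :: "int set" assume F: "finite F"
      have "F = F \<inter> {..-1} \<union> F \<inter> {0..}" by auto
      then have "sum ?f F = sum ?f (F \<inter> {..-1} \<union> F \<inter> {0..})" by simp
      also have "\<dots> = sum ?f (F \<inter> {..-1}) + sum ?f (F \<inter> {0..})"
        using F by (intro sum.union_disjoint) auto
      also have "\<dots> \<le> ennreal (C1 * \<epsilon> powr \<alpha>) + ennreal (C2 * \<epsilon> powr \<alpha>)"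
        using F by (intro add_mono C1 C2 \<epsilon> q) auto
      finally show "sum ?f F \<le> ennreal (C1 * \<epsilon> powr \<alpha>) + ennreal (C2 * \<epsilon> powr \<alpha>)" .
    qed
    also have "\<dots> = ennreal ((C1 + C2) * \<epsilon> powr \<alpha>)"
      using C1(1) C2(1) by (simp add: distrib_right)
    finally show "besov_1_norm \<theta> (- \<alpha>) q (modulate \<epsilon> \<phi>) \<le> ennreal ((C1 + C2) * \<epsilon> powr \<alpha>)" .
  qed (use C1 C2 in auto)
qed

section \<open>Lower bound\<close>

text \<open>
  With \<open>N\<close> the Besov norm, every block has \<open>L^q\<close> norm at most \<open>2^(\<sigma> k) N\<close>, and \<open>2^k \<le> Y / \<epsilon>\<close> for the nonzero
  ones. Hence the integral of \<open>\<bar>\<phi>\<bar>\<close> over a ball is at most a constant times \<open>\<epsilon>^(-\<sigma>) N\<close>. The geometric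
  sum of \<open>2^(\<sigma> k)\<close> is governed by its largest index, so all negative \<open>k\<close> are included at no cost.
\<close>

lemma besov_inf_lower_bound:
  assumes ne: "\<phi> \<noteq> (\<lambda>x. 0)" and \<sigma>: "\<sigma> > 0" and M: "M > 0"
  shows "\<exists>C>0. \<forall>\<epsilon>. 0 < \<epsilon> \<and> \<epsilon> \<le> M \<longrightarrow> (\<forall>q>1. ennreal (C * \<epsilon> powr \<sigma>) \<le> besov_inf_norm \<theta> (- \<sigma>) q (modulate \<epsilon> \<phi>))"
proof -
  obtain x0 where x0: "\<phi> x0 \<noteq> 0" using ne by auto
  define \<delta> where "\<delta> = norm (\<phi> x0) / 2"
  have \<delta>: "\<delta> > 0" using x0 by (simp add: \<delta>_def)
  obtain \<rho> where \<rho>: "\<rho> > 0" "\<And>x. dist x x0 < \<rho> \<Longrightarrow> norm (\<phi> x) > \<delta>"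
  proof -
    have "isCont \<phi> x0" by (rule schwartz_continuous_bounded_integrable(1)[OF schwartz])
    then obtain \<rho> where \<rho>: "\<rho> > 0" "\<And>x. dist x x0 < \<rho> \<Longrightarrow> dist (\<phi> x) (\<phi> x0) < \<delta>"
      unfolding continuous_at_eps_delta using \<delta> by blast
    have "norm (\<phi> x) > \<delta>" if "dist x x0 < \<rho>" for x
    proof -
      have "norm (\<phi> x0) - norm (\<phi> x) \<le> norm (\<phi> x0 - \<phi> x)" by (rule norm_triangle_ineq2)
      also have "\<dots> < \<delta>" using \<rho>(2)[OF that] by (simp add: dist_norm norm_minus_commute)
      finally show ?thesis by (simp add: \<delta>_def)
    qed
    with \<rho>(1) show ?thesis by (rule that)
  qed
  define E where "E = ball x0 \<rho>"
  define v where "v = unit_ball_vol (real DIM(real^2)) * \<rho> ^ DIM(real^2)"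
  have v: "v > 0" using \<rho>(1) by (simp add: v_def unit_ball_vol_pos)
  have vE: "emeasure lborel E = ennreal v" unfolding v_def E_def using \<rho>(1) by (intro emeasure_ball) auto
  have [measurable]: "E \<in> sets borel" by (simp add: E_def)
  define z where "z = 1 - (2::real) powr (- \<sigma>)"
  have z: "z > 0" using \<sigma> powr_less_mono[of "-\<sigma>" 0 2] by (simp add: z_def)
  define Y where "Y = 4/3 * (1 + R * M)"
  have Y: "Y > 0" using R M by (simp add: Y_def add_pos_pos)
  define w where "w = (v + 1) * (Y powr \<sigma> / z)"
  have w: "w > 0" using v Y z by (simp add: w_def)
  have main: "ennreal (\<delta> * v / w * \<epsilon> powr \<sigma>) \<le> besov_inf_norm \<theta> (- \<sigma>) q (modulate \<epsilon> \<phi>)"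
    if \<epsilon>: "0 < \<epsilon>" "\<epsilon> \<le> M" and q: "q > 1" for \<epsilon> q
  proof -
    define N where "N = besov_inf_norm \<theta> (- \<sigma>) q (modulate \<epsilon> \<phi>)"
    let ?b = "\<lambda>k. block \<epsilon> k"
    have bq: "Lq_norm q (?b k) \<le> ennreal (2 powr (\<sigma> * of_int k)) * N" for k
    proof -
      have "ennreal (2 powr (- \<sigma> * of_int k)) * Lq_norm q (?b k) \<le> N"
        unfolding N_def besov_inf_norm_def by (rule SUP_upper) simp
      then have "ennreal (2 powr (\<sigma> * of_int k)) * (ennreal (2 powr (- \<sigma> * of_int k)) * Lq_norm q (?b k)) \<le> ennreal (2 powr (\<sigma> * of_int k)) * N"
        by (rule mult_left_mono) simp
      moreover have "ennreal (2 powr (\<sigma> * of_int k)) * ennreal (2 powr (- \<sigma> * of_int k)) = 1"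
        by (subst ennreal_mult[symmetric]) (simp_all add: powr_add[symmetric])
      ultimately show ?thesis by (simp add: mult.assoc[symmetric])
    qed
    have small: "2 powi k \<le> Y / \<epsilon>" if "?b k \<noteq> (\<lambda>x. 0)" for k
    proof -
      have "3/4 * 2 powi k < 1 / \<epsilon> + R" by (rule block_frequency(2)[OF that \<epsilon>(1)])
      also have "R * \<epsilon> \<le> R * M" using R \<epsilon> by (intro mult_left_mono) auto
      then have "(1 + R * \<epsilon>) / \<epsilon> \<le> (1 + R * M) / \<epsilon>" using \<epsilon>(1) by (intro divide_right_mono) auto
      then have "1 / \<epsilon> + R \<le> (1 + R * M) / \<epsilon>" using \<epsilon>(1) by (simp add: add_divide_distrib)
      finally have "3/4 * 2 powi k < (1 + R * M) / \<epsilon>" .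
      then have "4/3 * (3/4 * 2 powi k) \<le> 4/3 * ((1 + R * M) / \<epsilon>)" by (intro mult_left_mono) auto
      then show ?thesis by (simp add: Y_def)
    qed
    \<comment> \<open>A bound for finitely many blocks, uniform in their number, is enough: Fatou's lemma passes to all of them.\<close>
    have part: "(\<integral>\<^sup>+x. (\<Sum>k\<in>window UNIV n. ennreal (norm (?b k x)) * indicator E x) \<partial>lborel) \<le> ennreal (w * \<epsilon> powr (- \<sigma>)) * N" for n
    proof -
      let ?G = "{k\<in>window UNIV n. ?b k \<noteq> (\<lambda>x. 0)}"
      have "(\<integral>\<^sup>+x. (\<Sum>k\<in>window UNIV n. ennreal (norm (?b k x)) * indicator E x) \<partial>lborel)
        = (\<Sum>k\<in>window UNIV n. \<integral>\<^sup>+x\<in>E. ennreal (norm (?b k x)) \<partial>lborel)"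
        by (rule nn_integral_sum) measurable
      also have "\<dots> = (\<Sum>k\<in>?G. \<integral>\<^sup>+x\<in>E. ennreal (norm (?b k x)) \<partial>lborel)"
        by (intro sum.mono_neutral_right) auto
      also have "\<dots> \<le> (\<Sum>k\<in>?G. ennreal (2 powr (\<sigma> * of_int k)) * (ennreal (v + 1) * N))"
      proof (rule sum_mono)
        fix k
        have "(\<integral>\<^sup>+x\<in>E. ennreal (norm (?b k x)) \<partial>lborel) \<le> (emeasure lborel E + 1) * Lq_norm q (?b k)"
          by (intro set_nn_integral_le_Lq_norm q) measurable
        also have "emeasure lborel E + 1 = ennreal (v + 1)" using v by (simp add: vE)
        also have "ennreal (v + 1) * Lq_norm q (?b k) \<le> ennreal (v + 1) * (ennreal (2 powr (\<sigma> * of_int k)) * N)"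
          by (intro mult_left_mono bq) simp
        finally show "(\<integral>\<^sup>+x\<in>E. ennreal (norm (?b k x)) \<partial>lborel) \<le> ennreal (2 powr (\<sigma> * of_int k)) * (ennreal (v + 1) * N)"
          by (simp only: mult.left_commute)
      qed
      also have "\<dots> = ennreal (\<Sum>k\<in>?G. 2 powr (\<sigma> * of_int k)) * (ennreal (v + 1) * N)"
        by (simp add: sum_distrib_right[symmetric])
      also have "\<dots> \<le> ennreal ((Y / \<epsilon>) powr \<sigma> / z) * (ennreal (v + 1) * N)"
        unfolding z_def using Y \<epsilon> by (intro mult_right_mono ennreal_leI sum_dyadic_head \<sigma>) (auto intro: small)
      also have "\<dots> = ennreal ((Y / \<epsilon>) powr \<sigma> / z * (v + 1)) * N"
        unfolding mult.assoc[symmetric] using v z by (subst ennreal_mult[symmetric]) auto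
      also have "(Y / \<epsilon>) powr \<sigma> / z * (v + 1) = w * \<epsilon> powr (- \<sigma>)"
      proof -
        have "(Y / \<epsilon>) powr \<sigma> = Y powr \<sigma> * \<epsilon> powr (- \<sigma>)"
          using Y \<epsilon> by (simp add: powr_divide powr_minus_divide)
        then show ?thesis by (simp add: w_def mult_ac)
      qed
      finally show ?thesis .
    qed
    \<comment> \<open>The multipliers sum to \<open>1\<close> except at the origin, a null set.\<close>
    have inv: "inv_fourier (\<lambda>\<xi>. of_real (multiplier_sum \<theta> UNIV \<xi>) * spec \<epsilon> \<xi>) x = modulate \<epsilon> \<phi> x" for x
    proof -
      note [measurable] = multiplier_sum_measurable[OF \<theta>]
      have "AE \<xi> in lborel. cis (x \<bullet> \<xi>) * (of_real (multiplier_sum \<theta> UNIV \<xi>) * spec \<epsilon> \<xi>) = cis (x \<bullet> \<xi>) * spec \<epsilon> \<xi>"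
        using AE_lborel_singleton[of "0::real^2"] by eventually_elim (simp add: multiplier_sum_UNIV[OF \<theta>])
      then have "(LINT \<xi>|lborel. cis (x \<bullet> \<xi>) * (of_real (multiplier_sum \<theta> UNIV \<xi>) * spec \<epsilon> \<xi>)) = (LINT \<xi>|lborel. cis (x \<bullet> \<xi>) * spec \<epsilon> \<xi>)"
        by (intro integral_cong_AE) measurable
      then have "inv_fourier (\<lambda>\<xi>. of_real (multiplier_sum \<theta> UNIV \<xi>) * spec \<epsilon> \<xi>) x = inv_fourier (spec \<epsilon>) x"
        by (simp add: inv_fourier_def)
      then show ?thesis by (simp only: wave_inversion)
    qed
    have lim: "(\<lambda>n. \<Sum>k\<in>window UNIV n. ?b k x) \<longlonglongrightarrow> modulate \<epsilon> \<phi> x" for x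
      using block_sum_convergence(1)[OF \<theta> spec_integrable[of \<epsilon>], where A = UNIV and x = x] unfolding inv dyadic_block_eq .
    have "ennreal \<delta> * ennreal v \<le> (\<integral>\<^sup>+x. ennreal \<delta> * indicator E x \<partial>lborel)"
      by (subst nn_integral_cmult_indicator) (auto simp: vE)
    also have "\<dots> \<le> (\<integral>\<^sup>+x. liminf (\<lambda>n. \<Sum>k\<in>window UNIV n. ennreal (norm (?b k x)) * indicator E x) \<partial>lborel)"
    proof (rule nn_integral_mono)
      fix x
      show "ennreal \<delta> * indicator E x \<le> liminf (\<lambda>n. \<Sum>k\<in>window UNIV n. ennreal (norm (?b k x)) * indicator E x)"
      proof (cases "x \<in> E")
        case True
        then have "\<delta> < norm (\<phi> x)" using \<rho>(2)[of x] by (simp add: E_def dist_commute)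
        then have "ennreal \<delta> \<le> ennreal (norm (modulate \<epsilon> \<phi> x))" by (intro ennreal_leI) simp
        also have "\<dots> = liminf (\<lambda>n. ennreal (norm (\<Sum>k\<in>window UNIV n. ?b k x)))"
          by (intro lim_imp_Liminf[symmetric] tendsto_ennrealI tendsto_norm lim) simp
        also have "\<dots> \<le> liminf (\<lambda>n. \<Sum>k\<in>window UNIV n. ennreal (norm (?b k x)) * indicator E x)"
          using True by (intro Liminf_mono always_eventually allI) (auto intro!: ennreal_leI norm_sum)
        finally show ?thesis using True by simp
      qed simp
    qed
    also have "\<dots> \<le> liminf (\<lambda>n. \<integral>\<^sup>+x. (\<Sum>k\<in>window UNIV n. ennreal (norm (?b k x)) * indicator E x) \<partial>lborel)"
      by (rule nn_integral_liminf) measurable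
    also have "\<dots> \<le> liminf (\<lambda>n::nat. ennreal (w * \<epsilon> powr (- \<sigma>)) * N)"
      by (intro Liminf_mono always_eventually allI part)
    also have "\<dots> = ennreal (w * \<epsilon> powr (- \<sigma>)) * N" by (simp add: Liminf_const)
    finally have "ennreal (\<epsilon> powr \<sigma> / w) * (ennreal \<delta> * ennreal v) \<le> ennreal (\<epsilon> powr \<sigma> / w) * (ennreal (w * \<epsilon> powr (- \<sigma>)) * N)"
      by (rule mult_left_mono) simp
    also have "\<dots> = ennreal (\<epsilon> powr \<sigma> / w * (w * \<epsilon> powr (- \<sigma>))) * N"
      using w by (subst mult.assoc[symmetric], subst ennreal_mult[symmetric]) auto
    also have "\<epsilon> powr \<sigma> / w * (w * \<epsilon> powr (- \<sigma>)) = 1"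
      using w \<epsilon> by (simp add: powr_add[symmetric])
    also have "ennreal (\<epsilon> powr \<sigma> / w) * (ennreal \<delta> * ennreal v) = ennreal (\<delta> * v / w * \<epsilon> powr \<sigma>)"
      using w \<delta> v by (simp add: ennreal_mult[symmetric] mult_ac)
    finally show ?thesis by (simp add: N_def)
  qed
  show ?thesis
    by (intro exI[of _ "\<delta> * v / w"]) (use main \<delta> v w in auto)
qed

section \<open>Decay of the heat flow\<close>

abbreviation wave_flow :: "real \<Rightarrow> real \<Rightarrow> real \<Rightarrow> real^2 \<Rightarrow> complex" where
  "wave_flow \<nu> \<epsilon> t \<equiv> high_freq_flow \<theta> \<nu> (modulate \<epsilon> \<phi>) t"

text \<open>
  On the spectrum of the part with \<open>k \<ge> 0\<close> both \<open>\<bar>\<xi>\<bar> > 3/4\<close> and \<open>\<bar>\<xi>\<bar> \<ge> 1 / \<epsilon> - R\<close> hold, and together they give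
  \<open>\<bar>\<xi>\<bar> \<ge> c / \<epsilon>\<close> for every \<open>\<epsilon>\<close>: \<open>1 / \<epsilon> \<le> \<bar>\<xi>\<bar> + R \<le> (1 + 4 R / 3) \<bar>\<xi>\<bar>\<close>.
\<close>

lemma high_freq_flow_decay:
  assumes \<nu>: "\<nu> > 0"
  obtains H \<kappa> where "H > 0" "\<kappa> > 0"
    "\<And>\<epsilon> t. wave_flow \<nu> \<epsilon> t \<in> borel_measurable borel"
    "\<And>\<epsilon> t x. \<epsilon> > 0 \<Longrightarrow> t \<ge> 0 \<Longrightarrow> norm (wave_flow \<nu> \<epsilon> t x) \<le> H * exp (- \<kappa> * t / \<epsilon>\<^sup>2)"
    "\<And>\<epsilon> t. \<epsilon> > 0 \<Longrightarrow> t \<ge> 0 \<Longrightarrow> (\<integral>\<^sup>+x. ennreal ((norm (wave_flow \<nu> \<epsilon> t x))\<^sup>2) \<partial>lborel) \<le> ennreal ((H * exp (- \<kappa> * t / \<epsilon>\<^sup>2))\<^sup>2)"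
proof -
  obtain T where T: "T > 0" "\<And>G \<xi>. finite G \<Longrightarrow> (\<Sum>k\<in>G. \<bar>block_multiplier \<theta> k \<xi>\<bar>) \<le> T"
    using sum_block_multiplier_bound[OF \<theta>] by blast
  note props = multiplier_spec_props[OF T(2), where A = "{0..}"]
  define m where "m \<epsilon> \<xi> = complex_of_real (multiplier_sum \<theta> {0..} \<xi>) * spec \<epsilon> \<xi>" for \<epsilon> \<xi>
  have m [measurable]: "m \<epsilon> \<in> borel_measurable borel" and m_le: "norm (m \<epsilon> \<xi>) \<le> T * mass"
    and m_supp: "m \<epsilon> \<xi> \<noteq> 0 \<Longrightarrow> norm (\<xi> - axis 1 (1 / \<epsilon>)) \<le> R" for \<epsilon> \<xi>
    using props[where \<epsilon> = \<epsilon>] unfolding m_def by auto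
  define c where "c = 1 / (1 + 4/3 * R)"
  have c: "c > 0" using R by (simp add: c_def add_pos_pos)
  \<comment> \<open>The two lower bounds for \<open>\<bar>\<xi>\<bar>\<close> are combined into one that scales like \<open>1 / \<epsilon>\<close>.\<close>
  have freq: "c / \<epsilon> \<le> norm \<xi>" if "m \<epsilon> \<xi> \<noteq> 0" "\<epsilon> > 0" for \<epsilon> \<xi>
  proof -
    have ne: "multiplier_sum \<theta> {0..} \<xi> \<noteq> 0" "spec \<epsilon> \<xi> \<noteq> 0" using that(1) by (auto simp: m_def)
    obtain k where k: "k \<in> {0..}" "block_multiplier \<theta> k \<xi> \<noteq> 0" by (rule multiplier_sum_nonzero[OF ne(1)])
    have "3/4 * 2 powi k < norm \<xi>"
      using dyadic_multiplier_props(2)[OF \<theta> k(2)[unfolded block_multiplier_def]] by blast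
    moreover have "(1::real) \<le> 2 powi k" using k power_int_increasing[of 0 k "2::real"] by auto
    ultimately have "1 \<le> 4/3 * norm \<xi>" by linarith
    then have "R * 1 \<le> R * (4/3 * norm \<xi>)" using R by (intro mult_left_mono) auto
    then have "R \<le> (4/3 * R) * norm \<xi>" by (simp only: mult_ac mult_1_left mult_1_right)
    then have "1 / \<epsilon> \<le> (1 + 4/3 * R) * norm \<xi>"
      using spec_frequency(1)[OF ne(2) that(2)] unfolding distrib_right mult_1_left by linarith
    moreover have "1 + 4/3 * R > 0" using R by (intro add_pos_pos) auto
    ultimately have "1 / \<epsilon> / (1 + 4/3 * R) \<le> norm \<xi>" by (subst pos_divide_le_eq) (simp_all only: mult.commute)
    then show ?thesis by (simp add: c_def mult.commute)
  qed
  define V where "V = unit_ball_vol (real DIM(real^2)) * R ^ DIM(real^2)"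
  have V: "V \<ge> 0" using R by (auto simp: V_def)
  define H where "H = T * mass * (V + 1) + 1"
  define \<kappa> where "\<kappa> = \<nu> * c\<^sup>2"
  have TM: "T * mass \<ge> 0" using T mass_nonneg by simp
  have H: "H > 0" using TM V by (simp add: H_def add_nonneg_pos)
  have \<kappa>: "\<kappa> > 0" using \<nu> c by (simp add: \<kappa>_def)
  have sum_eq: "(\<lambda>x. \<Sum>\<^sub>\<infinity>k\<in>{0..}. block \<epsilon> k x) = inv_fourier (m \<epsilon>)" for \<epsilon>
    unfolding m_def dyadic_block_eq fun_eq_iff using block_sum_convergence(2)[OF \<theta> spec_integrable] by simp
  have mI: "integrable lborel (m \<epsilon>)" for \<epsilon> by (rule integrable_bounded_cball[OF m m_le m_supp])
  \<comment> \<open>A case distinction replaces the proof that the summed function is integrable: otherwise its Fourier transform takes the default value \<open>0\<close> everywhere, and the bounds hold for \<open>0\<close> as well.\<close>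
  have four: "\<exists>s\<in>{0, 1}. fourier (inv_fourier (m \<epsilon>)) = (\<lambda>\<xi>. s * m \<epsilon> \<xi>)" for \<epsilon>
  proof (cases "integrable lborel (inv_fourier (m \<epsilon>))")
    case True
    have "isCont (m \<epsilon>) \<xi>" for \<xi>
      unfolding m_def by (intro continuous_intros spec_isCont isCont_multiplier_sum_high[OF \<theta>])
    then have "fourier (inv_fourier (m \<epsilon>)) = m \<epsilon>"
      by (intro fourier_inv_fourier[OF mI _ m_le True])
    then show ?thesis by auto
  next
    case False
    have "\<not> integrable lborel (\<lambda>x. cis (- (x \<bullet> \<xi>)) * inv_fourier (m \<epsilon>) x)" for \<xi>
    proof
      assume "integrable lborel (\<lambda>x. cis (- (x \<bullet> \<xi>)) * inv_fourier (m \<epsilon>) x)"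
      then have "integrable lborel (inv_fourier (m \<epsilon>))"
        by (rule Bochner_Integration.integrable_bound) (auto simp: norm_mult)
      then show False using False by simp
    qed
    then have "fourier (inv_fourier (m \<epsilon>)) = (\<lambda>\<xi>. 0 * m \<epsilon> \<xi>)"
      by (simp add: fourier_def fun_eq_iff not_integrable_integral_eq)
    then show ?thesis by blast
  qed
  have flow: "\<exists>\<mu>. wave_flow \<nu> \<epsilon> t = inv_fourier \<mu> \<and> \<mu> \<in> borel_measurable borel \<and>
     (\<epsilon> > 0 \<longrightarrow> t \<ge> 0 \<longrightarrow> (\<forall>\<xi>. norm (\<mu> \<xi>) \<le> T * mass * exp (- \<kappa> * t / \<epsilon>\<^sup>2))) \<and> (\<forall>\<xi>. \<mu> \<xi> \<noteq> 0 \<longrightarrow> norm (\<xi> - axis 1 (1 / \<epsilon>)) \<le> R)" for \<epsilon> t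
  proof -
    obtain s where s: "s \<in> {0, 1}" "fourier (inv_fourier (m \<epsilon>)) = (\<lambda>\<xi>. s * m \<epsilon> \<xi>)" using four by blast
    let ?\<mu> = "\<lambda>\<xi>. of_real (exp (- \<nu> * t * (norm \<xi>)\<^sup>2)) * (s * m \<epsilon> \<xi>)"
    have "norm (?\<mu> \<xi>) \<le> T * mass * exp (- \<kappa> * t / \<epsilon>\<^sup>2)" if "\<epsilon> > 0" "t \<ge> 0" for \<xi>
    proof (cases "m \<epsilon> \<xi> = 0")
      case True
      then show ?thesis using TM by simp
    next
      case False
      have "(c / \<epsilon>)\<^sup>2 \<le> (norm \<xi>)\<^sup>2" using freq[OF False that(1)] c that by (intro power_mono) auto
      then have "\<nu> * t * (c / \<epsilon>)\<^sup>2 \<le> \<nu> * t * (norm \<xi>)\<^sup>2" using \<nu> that by (intro mult_left_mono) auto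
      moreover have "\<nu> * t * (c / \<epsilon>)\<^sup>2 = \<kappa> * t / \<epsilon>\<^sup>2" by (simp add: \<kappa>_def power_divide)
      ultimately have "exp (- \<nu> * t * (norm \<xi>)\<^sup>2) \<le> exp (- \<kappa> * t / \<epsilon>\<^sup>2)" by simp
      moreover have "norm (s * m \<epsilon> \<xi>) \<le> T * mass" using s(1) m_le[of \<epsilon> \<xi>] TM by (auto simp: norm_mult)
      ultimately have "exp (- \<nu> * t * (norm \<xi>)\<^sup>2) * norm (s * m \<epsilon> \<xi>) \<le> exp (- \<kappa> * t / \<epsilon>\<^sup>2) * (T * mass)"
        by (intro mult_mono) auto
      then show ?thesis by (simp add: norm_mult mult_ac)
    qed
    moreover have "wave_flow \<nu> \<epsilon> t = inv_fourier ?\<mu>"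
      unfolding high_freq_flow_def sum_eq heat_def fourier_multiplier_def s(2) by simp
    moreover have "?\<mu> \<in> borel_measurable borel" by measurable
    moreover have "norm (\<xi> - axis 1 (1 / \<epsilon>)) \<le> R" if "?\<mu> \<xi> \<noteq> 0" for \<xi> using that m_supp by auto
    ultimately show ?thesis by (intro exI[of _ ?\<mu>]) blast
  qed
  show ?thesis
  proof (rule that[OF H \<kappa>])
    fix \<epsilon> t
    show "wave_flow \<nu> \<epsilon> t \<in> borel_measurable borel"
      using flow[of \<epsilon> t] by (auto intro: borel_measurable_inv_fourier)
  next
    fix \<epsilon> t :: real assume \<epsilon>: "\<epsilon> > 0" and t: "t \<ge> 0"
    define e where "e = exp (- \<kappa> * t / \<epsilon>\<^sup>2)"
    have e: "e > 0" by (simp add: e_def)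
    obtain \<mu> where \<mu>: "wave_flow \<nu> \<epsilon> t = inv_fourier \<mu>" "\<mu> \<in> borel_measurable borel"
      "\<And>\<xi>. norm (\<mu> \<xi>) \<le> T * mass * e" "\<And>\<xi>. \<mu> \<xi> \<noteq> 0 \<Longrightarrow> norm (\<xi> - axis 1 (1 / \<epsilon>)) \<le> R"
      using flow[of \<epsilon> t] \<epsilon> t unfolding e_def by blast
    note b = ball_supported_bounds[OF \<mu>(2) less_imp_le[OF R] \<mu>(3) \<mu>(4), folded V_def]
    have "norm (wave_flow \<nu> \<epsilon> t x) \<le> T * mass * e * V" for x
      unfolding \<mu>(1) by (rule order_trans[OF norm_inv_fourier_le b(2)])
    also have "T * mass * e * V = (T * mass * V) * e" by (simp add: mult_ac)
    also have "\<dots> \<le> H * e"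
      unfolding H_def using TM V e by (intro mult_right_mono) (auto simp: distrib_left)
    finally show "norm (wave_flow \<nu> \<epsilon> t x) \<le> H * exp (- \<kappa> * t / \<epsilon>\<^sup>2)" for x unfolding e_def .
    have "(\<integral>\<^sup>+x. ennreal ((norm (wave_flow \<nu> \<epsilon> t x))\<^sup>2) \<partial>lborel) \<le> ennreal ((T * mass * e)\<^sup>2 * V)"
      unfolding \<mu>(1) by (rule order_trans[OF inv_fourier_L2_le[OF b(1)] b(3)])
    also have "\<dots> \<le> ennreal ((H * e)\<^sup>2)"
    proof (rule ennreal_leI)
      have "V \<le> (V + 1)\<^sup>2" using V by (simp add: power2_eq_square distrib_left distrib_right)
      then have "(T * mass * e)\<^sup>2 * V \<le> (T * mass * e)\<^sup>2 * (V + 1)\<^sup>2" by (intro mult_left_mono) auto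
      also have "\<dots> = (T * mass * (V + 1) * e)\<^sup>2" by (simp add: power_mult_distrib mult_ac)
      also have "\<dots> \<le> (H * e)\<^sup>2"
        unfolding H_def using TM V e by (intro power_mono mult_right_mono) auto
      finally show "(T * mass * e)\<^sup>2 * V \<le> (H * e)\<^sup>2" .
    qed
    finally show "(\<integral>\<^sup>+x. ennreal ((norm (wave_flow \<nu> \<epsilon> t x))\<^sup>2) \<partial>lborel) \<le> ennreal ((H * exp (- \<kappa> * t / \<epsilon>\<^sup>2))\<^sup>2)"
      unfolding e_def .
  qed
qed

end

lemma nn_integral_exp_decay:
  assumes "a > (0::real)"
  shows "(\<integral>\<^sup>+t\<in>{0..}. ennreal (exp (- a * t)) \<partial>lborel) = ennreal (1 / a)"
proof -
  have "(\<integral>\<^sup>+t. ennreal (exp (- a * t)) * indicator {0..} t \<partial>lborel) = ennreal (0 - (- exp (- a * 0) / a))"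
  proof (rule nn_integral_FTC_atLeast)
    show "((\<lambda>t. - exp (- a * t) / a) has_real_derivative exp (- a * t)) (at t)" for t
      using assms by (auto intro!: derivative_eq_intros)
    have "((\<lambda>t. exp (- a * t)) \<longlongrightarrow> 0) at_top"
      by (intro filterlim_compose[OF exp_at_bot] filterlim_tendsto_neg_mult_at_bot[OF tendsto_const] filterlim_ident)
         (use assms in auto)
    then have "((\<lambda>t. - exp (- a * t) / a) \<longlongrightarrow> - 0 / a) at_top"
      using assms by (intro tendsto_divide tendsto_minus tendsto_const) auto
    then show "((\<lambda>t. - exp (- a * t) / a) \<longlongrightarrow> 0) at_top" by simp
  qed auto
  then show ?thesis by simp
qed

lemma Lq_norm_2_mult_le:
  assumes [measurable]: "g \<in> borel_measurable borel" and f: "\<And>x. norm (f x) \<le> a" and g: "(\<integral>\<^sup>+x. ennreal ((norm (g x))\<^sup>2) \<partial>lborel) \<le> ennreal (b\<^sup>2)"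
    and b: "b \<ge> 0"
  shows "Lq_norm 2 (\<lambda>x. f x * g x) \<le> ennreal (a * b)"
proof -
  have a: "a \<ge> 0" using f norm_ge_zero order_trans by blast
  have "(\<integral>\<^sup>+x. ennreal ((norm (f x * g x))\<^sup>2) \<partial>lborel) \<le> (\<integral>\<^sup>+x. ennreal (a\<^sup>2) * ennreal ((norm (g x))\<^sup>2) \<partial>lborel)"
  proof (rule nn_integral_mono)
    fix x
    have "(norm (f x))\<^sup>2 * (norm (g x))\<^sup>2 \<le> a\<^sup>2 * (norm (g x))\<^sup>2"
      by (intro mult_right_mono power_mono f) auto
    then have "ennreal ((norm (f x * g x))\<^sup>2) \<le> ennreal (a\<^sup>2 * (norm (g x))\<^sup>2)"
      by (intro ennreal_leI) (simp add: norm_mult power_mult_distrib)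
    then show "ennreal ((norm (f x * g x))\<^sup>2) \<le> ennreal (a\<^sup>2) * ennreal ((norm (g x))\<^sup>2)"
      by (simp add: ennreal_mult)
  qed
  also have "\<dots> = ennreal (a\<^sup>2) * (\<integral>\<^sup>+x. ennreal ((norm (g x))\<^sup>2) \<partial>lborel)"
    by (rule nn_integral_cmult) measurable
  also have "\<dots> \<le> ennreal (a\<^sup>2) * ennreal (b\<^sup>2)" by (intro mult_left_mono g) auto
  also have "\<dots> = ennreal ((a * b)\<^sup>2)" by (simp add: ennreal_mult power_mult_distrib)
  finally have "Lq_norm 2 (\<lambda>x. f x * g x) \<le> ennreal (sqrt ((a * b)\<^sup>2))" by (intro Lq_norm_2_le) auto
  then show ?thesis using a b by simp
qed

text \<open>
  One factor is estimated in \<open>L\<^sup>\<infinity>\<close> and the other one in \<open>L\<^sup>2\<close>; the exponential rates add up.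
\<close>

lemma flow_product_bound:
  assumes "modulated_wave \<theta> \<phi> R" and "modulated_wave \<theta> \<psi> R" and \<nu>: "\<nu> > 0"
  shows "\<exists>C>0. \<forall>\<epsilon>>0.
       (\<integral>\<^sup>+ t\<in>{0..}. Lq_norm 2 (\<lambda>x. high_freq_flow \<theta> \<nu> (modulate \<epsilon> \<phi>) t x
                                    * high_freq_flow \<theta> \<nu> (modulate \<epsilon> \<psi>) t x) \<partial>lborel)
         \<le> ennreal (C * \<epsilon>\<^sup>2)"
proof -
  obtain H1 \<kappa>1 where 1: "H1 > 0" "\<kappa>1 > 0"
    "\<And>\<epsilon> t x. \<epsilon> > 0 \<Longrightarrow> t \<ge> 0 \<Longrightarrow> norm (high_freq_flow \<theta> \<nu> (modulate \<epsilon> \<phi>) t x) \<le> H1 * exp (- \<kappa>1 * t / \<epsilon>\<^sup>2)"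
    using modulated_wave.high_freq_flow_decay[OF assms(1) \<nu>] by metis
  obtain H2 \<kappa>2 where 2: "H2 > 0" "\<kappa>2 > 0"
    "\<And>\<epsilon> t. high_freq_flow \<theta> \<nu> (modulate \<epsilon> \<psi>) t \<in> borel_measurable borel"
    "\<And>\<epsilon> t. \<epsilon> > 0 \<Longrightarrow> t \<ge> 0 \<Longrightarrow> (\<integral>\<^sup>+x. ennreal ((norm (high_freq_flow \<theta> \<nu> (modulate \<epsilon> \<psi>) t x))\<^sup>2) \<partial>lborel) \<le> ennreal ((H2 * exp (- \<kappa>2 * t / \<epsilon>\<^sup>2))\<^sup>2)"
    using modulated_wave.high_freq_flow_decay[OF assms(2) \<nu>] by metis
  show ?thesis
  proof (intro exI[of _ "H1 * H2 / (\<kappa>1 + \<kappa>2)"] conjI allI impI)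
    show "H1 * H2 / (\<kappa>1 + \<kappa>2) > 0" using 1 2 by simp
    fix \<epsilon> :: real assume \<epsilon>: "\<epsilon> > 0"
    let ?a = "(\<kappa>1 + \<kappa>2) / \<epsilon>\<^sup>2"
    have a: "?a > 0" using 1 2 \<epsilon> by simp
    have "(\<integral>\<^sup>+ t\<in>{0..}. Lq_norm 2 (\<lambda>x. high_freq_flow \<theta> \<nu> (modulate \<epsilon> \<phi>) t x * high_freq_flow \<theta> \<nu> (modulate \<epsilon> \<psi>) t x) \<partial>lborel)
      \<le> (\<integral>\<^sup>+ t. ennreal (H1 * H2) * (ennreal (exp (- ?a * t)) * indicator {0..} t) \<partial>lborel)"
    proof (rule nn_integral_mono)
      fix t :: real
      show "Lq_norm 2 (\<lambda>x. high_freq_flow \<theta> \<nu> (modulate \<epsilon> \<phi>) t x * high_freq_flow \<theta> \<nu> (modulate \<epsilon> \<psi>) t x) * indicator {0..} t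
        \<le> ennreal (H1 * H2) * (ennreal (exp (- ?a * t)) * indicator {0..} t)"
      proof (cases "t \<ge> 0")
        case True
        have "Lq_norm 2 (\<lambda>x. high_freq_flow \<theta> \<nu> (modulate \<epsilon> \<phi>) t x * high_freq_flow \<theta> \<nu> (modulate \<epsilon> \<psi>) t x)
          \<le> ennreal (H1 * exp (- \<kappa>1 * t / \<epsilon>\<^sup>2) * (H2 * exp (- \<kappa>2 * t / \<epsilon>\<^sup>2)))"
          using 1 2 \<epsilon> True by (intro Lq_norm_2_mult_le) auto
        also have "H1 * exp (- \<kappa>1 * t / \<epsilon>\<^sup>2) * (H2 * exp (- \<kappa>2 * t / \<epsilon>\<^sup>2)) = (H1 * H2) * exp (- ?a * t)"
        proof -
          have "- ((\<kappa>1 + \<kappa>2) / d) * t = - \<kappa>1 * t / d + - \<kappa>2 * t / d" for d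
            unfolding add_divide_distrib minus_mult_left[symmetric] distrib_right
            by (simp only: times_divide_eq_left minus_divide_left minus_add_distrib)
          then have "- ?a * t = - \<kappa>1 * t / \<epsilon>\<^sup>2 + - \<kappa>2 * t / \<epsilon>\<^sup>2" .
          then have "exp (- ?a * t) = exp (- \<kappa>1 * t / \<epsilon>\<^sup>2) * exp (- \<kappa>2 * t / \<epsilon>\<^sup>2)" by (simp only: exp_add)
          then show ?thesis by (simp only: mult_ac)
        qed
        also have "ennreal ((H1 * H2) * exp (- ?a * t)) = ennreal (H1 * H2) * ennreal (exp (- ?a * t))"
          using 1 2 by (intro ennreal_mult) auto
        finally show ?thesis using True by simp
      qed simp
    qed
    also have "\<dots> = ennreal (H1 * H2) * (\<integral>\<^sup>+ t\<in>{0..}. ennreal (exp (- ?a * t)) \<partial>lborel)"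
      by (rule nn_integral_cmult) measurable
    also have "\<dots> = ennreal (H1 * H2 * (1 / ?a))"
      unfolding nn_integral_exp_decay[OF a] using 1 2 a by (intro ennreal_mult[symmetric]) auto
    also have "H1 * H2 * (1 / ?a) = H1 * H2 / (\<kappa>1 + \<kappa>2) * \<epsilon>\<^sup>2" by simp
    finally show "(\<integral>\<^sup>+ t\<in>{0..}. Lq_norm 2 (\<lambda>x. high_freq_flow \<theta> \<nu> (modulate \<epsilon> \<phi>) t x * high_freq_flow \<theta> \<nu> (modulate \<epsilon> \<psi>) t x) \<partial>lborel)
         \<le> ennreal (H1 * H2 / (\<kappa>1 + \<kappa>2) * \<epsilon>\<^sup>2)" by simp
  qed
qed

theorem proposition1p2:
  fixes \<theta> :: "real \<Rightarrow> real" and \<phi> \<psi> :: "real^2 \<Rightarrow> complex" and r R \<nu> :: real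
  assumes "dyadic_partition \<theta>"
    and "schwartz \<phi>" and "schwartz \<psi>"
    and "0 < r" and "r < R"
    and "support (fourier \<phi>) \<subseteq> annulus r R" and "support (fourier \<psi>) \<subseteq> annulus r R"
    and "0 < \<nu>"
  shows
   "(\<forall>\<sigma>>0. \<exists>C>0. \<forall>\<epsilon>>0. \<forall>q>1.
       tilde_besov_norm \<theta> (- \<sigma>) q (modulate \<epsilon> \<phi>) \<le> ennreal (C * \<epsilon> powr \<sigma>)) \<and>
    (\<forall>q>1. \<forall>\<alpha>>0. ennreal \<alpha> < 2 * (1 - 1 / q) \<longrightarrow> (\<exists>C>0. \<forall>\<epsilon>>0.
       besov_1_norm \<theta> (- \<alpha>) q (modulate \<epsilon> \<phi>) \<le> ennreal (C * \<epsilon> powr \<alpha>))) \<and>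
    (\<phi> \<noteq> (\<lambda>x. 0) \<longrightarrow> (\<forall>\<sigma>>0. \<forall>M>0. \<exists>C>0. \<forall>\<epsilon>. 0 < \<epsilon> \<and> \<epsilon> \<le> M \<longrightarrow> (\<forall>q>1.
       ennreal (C * \<epsilon> powr \<sigma>) \<le> besov_inf_norm \<theta> (- \<sigma>) q (modulate \<epsilon> \<phi>)))) \<and>
    (\<exists>C>0. \<forall>\<epsilon>>0.
       (\<integral>\<^sup>+ t\<in>{0..}. Lq_norm 2 (\<lambda>x. high_freq_flow \<theta> \<nu> (modulate \<epsilon> \<phi>) t x
                                    * high_freq_flow \<theta> \<nu> (modulate \<epsilon> \<psi>) t x) \<partial>lborel)
         \<le> ennreal (C * \<epsilon>\<^sup>2))"
proof -
  have R: "R > 0" using assms(4,5) by linarith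
  have sp: "norm \<xi> \<le> R" if "support (fourier f) \<subseteq> annulus r R" "fourier f \<xi> \<noteq> 0" for f \<xi>
    using that closure_subset[of "{x. fourier f x \<noteq> 0}"] by (auto simp: support_def annulus_def)
  interpret \<phi>: modulated_wave \<theta> \<phi> R
    using assms R sp by unfold_locales auto
  interpret \<psi>: modulated_wave \<theta> \<psi> R
    using assms R sp by unfold_locales auto
  show ?thesis
    by (intro conjI allI impI \<phi>.tilde_besov_upper_bound \<phi>.besov_1_upper_bound \<phi>.besov_inf_lower_bound
        flow_product_bound[OF \<phi>.modulated_wave_axioms \<psi>.modulated_wave_axioms assms(8)])
qed

end
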